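(* Let $\hat\phi$ be a real-valued function such that, for some $\epsilon>0$ and some constant $C$, $|\hat\phi(\xi)|\le C(1+|\xi|)^{-1-\epsilon}$ for all $\xi\in\mathbb{R}$, and let $\beta=1/(2n)$ where $n$ is any odd natural number. Then the following are equivalent: (1) The Gabor system $\mathcal{G}(\phi,1,\beta)$ is a tight frame for $L^2(\mathbb{R})$ with frame bound $\beta^{-1}$. (2) The Wilson system $\mathcal{W}(\phi,1,\beta)$ is a Parseval frame for $L^2(\mathbb{R})$. (3) The Zak transform $Z_\beta\hat\phi$ of $\hat\phi$ satisfies $$\sum_{r=0}^{\beta^{-1}-1}\left|Z_\beta\hat\phi(x,\xi-\beta r)\right|^2=\frac1\beta$$ for almost all $x,\xi\in[0,1]$. Furthermore, if one of the statements (1), (2), (3) holds (hence all of them hold), then the Parseval Wilson frame $\mathcal{W}(\phi,1,\beta)$ is an orthonormal basis for $L^2(\mathbb{R})$ if and only if $\operatorname{Re}\langle X_{j,m},Y_{j,m}\rangle=0$ for all $(j,m)\in\mathbb{Z}\times\mathbb{N}$ and $\|\phi\|_{L^2}=1/\sqrt{2\beta}$, where $X_{j,m}=e^{-2\pi i\beta jm}\phi_{j,m}$ and $Y_{j,m}=(-1)^{j+m}e^{2\pi i\beta jm}\phi_{j,-m}$.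
   Context: The Fourier transform is $\hat f(w)=\int_{\mathbb{R}} f(t)e^{-2\pi i t w}\,dt$ (extended unitarily to $L^2(\mathbb{R})$); $\phi \in L^2(\mathbb{R})$ is the function whose Fourier transform is $\hat\phi$. $\mathbb{N}=\{1,2,\dots\}$, $\mathbb{N}_0=\mathbb{N}\cup\{0\}$. For $\phi\in L^2(\mathbb{R})$ and $\alpha,\beta>0$, the Gabor system is $\mathcal{G}(\phi,\alpha,\beta)=\{\phi_{j,m}: j,m\in\mathbb{Z}\}$ with $\phi_{j,m}(x)=\phi(x-\beta j)e^{2\pi i\alpha m x}$ (here $\alpha=1$). The (bimodal) Wilson system is $\mathcal{W}(\phi,\alpha,\beta)=\{\psi_{j,m}: j\in\mathbb{Z}, m\in\mathbb{N}_0\}$ with $$\psi_{j,0}(x)=\sqrt{2\beta}\,\phi_{2j,0}(x)=\sqrt{2\beta}\,\phi(x-2\beta j)\quad (j\in\mathbb{Z}),$$ $$\psi_{j,m}(x)=\sqrt{\beta}\left[e^{-2\pi i\beta j\alpha m}\phi_{j,m}(x)+(-1)^{j+m}e^{2\pi i\beta j\alpha m}\phi_{j,-m}(x)\right]\quad (j\in\mathbb{Z},\ m\in\mathbb{N}).$$ A countable indexed family $\{e_i\}$ in $L^2(\mathbb{R})$ is a tight frame with frame bound $A>0$ if $\sum_i|\langle f,e_i\rangle|^2=A\|f\|_{L^2}^2$ for all $f\in L^2(\mathbb{R})$; it is a Parseval frame if this holds with $A=1$. For $\beta>0$ the Zak transform of $f$ is $Z_\beta f(x,\xi)=\frac{1}{\sqrt\beta}\sum_{k\in\mathbb{Z}}f(\beta^{-1}(\xi-k))e^{2\pi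 i kx}$ (extended to a unitary map from $L^2(\mathbb{R})$ onto the space of functions $F(x,\xi)$ that are square integrable on $[0,1)^2$ and satisfy $F(x+1,\xi)=F(x,\xi)$ and $F(x,\xi+1)=e^{2\pi i x}F(x,\xi)$ a.e.). *)

theory Defs
  imports "HOL-Analysis.Analysis"
begin

text \<open>
  Elements of \<open>L\<^sup>2(\<real>)\<close> are represented by Lebesgue measurable, square integrable functions;
  equality in \<open>L\<^sup>2(\<real>)\<close> is equality almost everywhere.
\<close>

definition L2 :: "(real \<Rightarrow> complex) set" where
  "L2 = {f \<in> borel_measurable lebesgue. integrable lebesgue (\<lambda>x. (cmod (f x))\<^sup>2)}"

definition inner_L2 :: "(real \<Rightarrow> complex) \<Rightarrow> (real \<Rightarrow> complex) \<Rightarrow> complex" where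
  "inner_L2 f g = (LINT x|lebesgue. f x * cnj (g x))"

definition norm_L2 :: "(real \<Rightarrow> complex) \<Rightarrow> real" where
  "norm_L2 f = sqrt (LINT x|lebesgue. (cmod (f x))\<^sup>2)"

definition fourier_L1 :: "(real \<Rightarrow> complex) \<Rightarrow> real \<Rightarrow> complex" where
  "fourier_L1 f w = (LINT t|lebesgue. f t * cis (- 2 * pi * t * w))"

text \<open>
  \<open>fourier_L2 f g\<close>: \<open>g\<close> is (a representative of) the Fourier transform of \<open>f \<in> L\<^sup>2(\<real>)\<close>, where the
  transform is the continuous extension to \<open>L\<^sup>2(\<real>)\<close> of the integral transform on
  \<open>L\<^sup>1(\<real>) \<inter> L\<^sup>2(\<real>)\<close>.  The conjunct \<open>fourier_L1 (F k) \<in> L2\<close> is automatic by Plancherel's theorem;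
  it is there because \<open>norm_L2\<close> has the junk value 0 outside \<open>L2\<close>.
\<close>

definition fourier_L2 :: "(real \<Rightarrow> complex) \<Rightarrow> (real \<Rightarrow> complex) \<Rightarrow> bool" where
  "fourier_L2 f g \<longleftrightarrow> f \<in> L2 \<and> g \<in> L2 \<and>
     (\<exists>F :: nat \<Rightarrow> real \<Rightarrow> complex.
        (\<forall>k. F k \<in> L2 \<and> integrable lebesgue (F k) \<and> fourier_L1 (F k) \<in> L2) \<and>
        (\<lambda>k. norm_L2 (\<lambda>t. F k t - f t)) \<longlonglongrightarrow> 0 \<and>
        (\<lambda>k. norm_L2 (\<lambda>w. fourier_L1 (F k) w - g w)) \<longlonglongrightarrow> 0)"

definition tight_frame :: "real \<Rightarrow> ('i::countable \<Rightarrow> real \<Rightarrow> complex) \<Rightarrow> bool" where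
  "tight_frame A e \<longleftrightarrow> A > 0 \<and> (\<forall>i. e i \<in> L2) \<and>
     (\<forall>f\<in>L2. ((\<lambda>i. (cmod (inner_L2 f (e i)))\<^sup>2) has_sum (A * (norm_L2 f)\<^sup>2)) UNIV)"

definition parseval_frame :: "('i::countable \<Rightarrow> real \<Rightarrow> complex) \<Rightarrow> bool" where
  "parseval_frame e \<longleftrightarrow> tight_frame 1 e"

definition orthonormal_basis :: "('i::countable \<Rightarrow> real \<Rightarrow> complex) \<Rightarrow> bool" where
  "orthonormal_basis e \<longleftrightarrow> (\<forall>i. e i \<in> L2) \<and>
     (\<forall>i j. inner_L2 (e i) (e j) = (if i = j then 1 else 0)) \<and>
     (\<forall>f\<in>L2. \<forall>\<delta>>0. \<exists>I c. finite I \<and> norm_L2 (\<lambda>x. f x - (\<Sum>i\<in>I. c i * e i x)) < \<delta>)"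

definition gabor :: "(real \<Rightarrow> complex) \<Rightarrow> real \<Rightarrow> real \<Rightarrow> int \<Rightarrow> int \<Rightarrow> real \<Rightarrow> complex" where
  "gabor \<phi> \<alpha> \<beta> j m x = \<phi> (x - \<beta> * of_int j) * cis (2 * pi * \<alpha> * of_int m * x)"

definition gabor_system :: "(real \<Rightarrow> complex) \<Rightarrow> real \<Rightarrow> real \<Rightarrow> int \<times> int \<Rightarrow> real \<Rightarrow> complex" where
  "gabor_system \<phi> \<alpha> \<beta> = (\<lambda>(j, m). gabor \<phi> \<alpha> \<beta> j m)"

definition wilson_X :: "(real \<Rightarrow> complex) \<Rightarrow> real \<Rightarrow> real \<Rightarrow> int \<Rightarrow> nat \<Rightarrow> real \<Rightarrow> complex" where
  "wilson_X \<phi> \<alpha> \<beta> j m x =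
     cis (- 2 * pi * \<beta> * of_int j * \<alpha> * real m) * gabor \<phi> \<alpha> \<beta> j (int m) x"

definition wilson_Y :: "(real \<Rightarrow> complex) \<Rightarrow> real \<Rightarrow> real \<Rightarrow> int \<Rightarrow> nat \<Rightarrow> real \<Rightarrow> complex" where
  "wilson_Y \<phi> \<alpha> \<beta> j m x =
     (-1) powi (j + int m) * cis (2 * pi * \<beta> * of_int j * \<alpha> * real m) * gabor \<phi> \<alpha> \<beta> j (- int m) x"

definition wilson :: "(real \<Rightarrow> complex) \<Rightarrow> real \<Rightarrow> real \<Rightarrow> int \<Rightarrow> nat \<Rightarrow> real \<Rightarrow> complex" where
  "wilson \<phi> \<alpha> \<beta> j m x =
     (if m = 0 then of_real (sqrt (2 * \<beta>)) * gabor \<phi> \<alpha> \<beta> (2 * j) 0 x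
      else of_real (sqrt \<beta>) * (wilson_X \<phi> \<alpha> \<beta> j m x + wilson_Y \<phi> \<alpha> \<beta> j m x))"

definition wilson_system :: "(real \<Rightarrow> complex) \<Rightarrow> real \<Rightarrow> real \<Rightarrow> int \<times> nat \<Rightarrow> real \<Rightarrow> complex" where
  "wilson_system \<phi> \<alpha> \<beta> = (\<lambda>(j, m). wilson \<phi> \<alpha> \<beta> j m)"

text \<open>
  The Zak transform is given by its defining series, which converges absolutely at every point for
  \<open>f\<close> dominated by \<open>C (1 + \<bar>\<xi>\<bar>)\<^bsup>-1-\<epsilon>\<^esup>\<close>; for such \<open>f\<close> it agrees almost everywhere with the
  unitary extension of the series to \<open>L\<^sup>2(\<real>)\<close>.
\<close>

definition zak :: "real \<Rightarrow> (real \<Rightarrow> complex) \<Rightarrow> real \<Rightarrow> real \<Rightarrow> complex" where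
  "zak \<beta> f x \<xi> = of_real (1 / sqrt \<beta>) *
     (\<Sum>\<^sub>\<infinity>k\<in>(UNIV :: int set). f ((\<xi> - of_int k) / \<beta>) * cis (2 * pi * of_int k * x))"

end

theory Submission imports Defs "HOL-Probability.Characteristic_Functions"
begin

text \<open>
  The Fourier transform carries the Gabor and Wilson systems to systems of translates of
  \<open>\<phi>hat\<close> multiplied by exponentials. For fixed modulation index the sum over the time shifts is the
  energy of a Fourier series, and Parseval's identity turns the frame sum of a bounded, compactly
  supported \<open>g\<close> into the quadratic form \<open>\<Sum>\<^sub>l \<integral> g(w) cnj(g(w + l T)) corr(l T)(w) dw\<close>, where
  \<open>corr(a)(w) = \<Sum>\<^sub>m \<phi>hat(w - m) \<phi>hat(w + a - m)\<close>. For the Gabor system the period is \<open>T = 2 n\<close>; for the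
  Wilson system it is \<open>T = n\<close>, but the terms with odd \<open>l\<close> cancel because \<open>n\<close> is odd, so both systems lead
  to the same form. Testing with indicator functions, either system is tight iff
  \<open>corr(2 n l) = (if l = 0 then 1 else 0)\<close> almost everywhere, and these correlations are the Fourier
  coefficients in \<open>x\<close> of the sum of squared Zak transforms. Finally, a Parseval frame is an orthonormal
  basis iff its members have norm \<open>1\<close>.

  Plancherel's theorem is used only for a dense class of functions: Gaussian mollifications of
  continuous functions with compact support, for which Fourier inversion is Fubini's theorem.
\<close>

section \<open>Square integrable functions\<close>

text \<open>\<open>fourier_L2\<close> provides only an approximating sequence for
  \<open>\<phi>\<close>, so there is no transform of a general element of \<open>L2\<close> to
  compute with. The way round is that a tight frame identity extends from any dense set
  (\<open>tight_frame_dense\<close>): coefficients are compared on pairs where inversion holds at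
  every point, and frame sums are evaluated on functions of bounded support. There the sum over
  lattice shifts \<open>l\<close> is finite; only the sum over modulations \<open>m\<close> needs a
  limit, and the decay of \<open>\<phi>hat\<close> gives it a summable majorant uniform for
  \<open>w\<close> in \<open>[-R, R]\<close>. The value \<open>\<beta> = 1 / (2 n)\<close> enters in
  several ways. As \<open>1 / \<beta>\<close> is an integer, the modulations split into residue
  classes mod \<open>1 / \<beta>\<close>, which turns correlations into Zak coefficients; as it is
  at least 1, a unit interval is disjoint from its lattice translates, which lets indicators isolate
  a single correlation. The Wilson sign depends on the parity of \<open>j\<close>, each parity class
  having period \<open>n = 1 / (2 \<beta>)\<close>, and the normalisations
  \<open>sqrt (2 * \<beta>)\<close> and \<open>sqrt \<beta>\<close> fit because
  \<open>\<beta> n = 1 / 2\<close>.\<close>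

lemma L2_measurable: "f \<in> L2 \<Longrightarrow> f \<in> borel_measurable lebesgue"
  by (simp add: L2_def)

lemma L2_integrable: "f \<in> L2 \<Longrightarrow> integrable lebesgue (\<lambda>x. (cmod (f x))\<^sup>2)"
  by (simp add: L2_def)

lemma borel_measurable_cnj [measurable (raw)]:
  "f \<in> borel_measurable M \<Longrightarrow> (\<lambda>x. cnj (f x)) \<in> borel_measurable M"
  by (rule borel_measurable_continuous_on[of cnj]) (auto intro: continuous_intros)

lemma inner_integrable:
  assumes "f \<in> L2" "g \<in> L2"
  shows "integrable lebesgue (\<lambda>x. f x * cnj (g x))"
proof (rule Bochner_Integration.integrable_bound)
  have [measurable]: "f \<in> borel_measurable lebesgue" "g \<in> borel_measurable lebesgue"
    using assms by (auto intro: L2_measurable)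
  show "integrable lebesgue (\<lambda>x. (cmod (f x))\<^sup>2 + (cmod (g x))\<^sup>2)"
    using assms by (auto intro: L2_integrable)
  show "(\<lambda>x. f x * cnj (g x)) \<in> borel_measurable lebesgue"
    by measurable
  have "a * b \<le> a\<^sup>2 + b\<^sup>2" if "a \<ge> 0" "b \<ge> 0" for a b :: real
    using sum_squares_bound[of a b] mult_nonneg_nonneg[OF that] by linarith
  then show "AE x in lebesgue. norm (f x * cnj (g x)) \<le> norm ((cmod (f x))\<^sup>2 + (cmod (g x))\<^sup>2)"
    by (intro AE_I2) (simp add: norm_mult)
qed

lemma L2_cnj: "f \<in> L2 \<Longrightarrow> (\<lambda>x. cnj (f x)) \<in> L2"
  by (auto simp: L2_def intro: borel_measurable_cnj)

lemma L2_bounded_mult: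
  assumes f: "f \<in> L2" and b: "b \<in> borel_measurable lebesgue" and le: "\<And>x. cmod (b x) \<le> K"
  shows "(\<lambda>x. b x * f x) \<in> L2"
proof -
  have [measurable]: "f \<in> borel_measurable lebesgue" "b \<in> borel_measurable lebesgue"
    using assms by (auto intro: L2_measurable)
  have "integrable lebesgue (\<lambda>x. (cmod (b x * f x))\<^sup>2)"
  proof (rule Bochner_Integration.integrable_bound)
    show "integrable lebesgue (\<lambda>x. K\<^sup>2 * (cmod (f x))\<^sup>2)"
      using f by (auto intro: L2_integrable)
    show "AE x in lebesgue. norm ((cmod (b x * f x))\<^sup>2) \<le> norm (K\<^sup>2 * (cmod (f x))\<^sup>2)"
      using le by (intro AE_I2) (auto simp: norm_mult power_mult_distrib intro!: mult_right_mono power_mono)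
  qed measurable
  then show ?thesis by (simp add: L2_def)
qed

lemma L2_scale: "f \<in> L2 \<Longrightarrow> (\<lambda>x. c * f x) \<in> L2"
  using L2_bounded_mult[of f "\<lambda>_. c" "cmod c"] by simp

lemma L2_cis: "f \<in> L2 \<Longrightarrow> (\<lambda>x. cis (a * x + b) * f x) \<in> L2"
proof -
  have "(\<lambda>x::real. cis (a * x + b)) \<in> borel_measurable borel"
    by (intro borel_measurable_continuous_onI continuous_intros)
  then have "(\<lambda>x::real. cis (a * x + b)) \<in> borel_measurable lebesgue"
    by (simp add: measurable_completion)
  then show "f \<in> L2 \<Longrightarrow> (\<lambda>x. cis (a * x + b) * f x) \<in> L2"
    by (intro L2_bounded_mult[where K=1]) auto
qed

lemma L2_add:
  assumes "f \<in> L2" "g \<in> L2"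
  shows "(\<lambda>x. f x + g x) \<in> L2"
proof -
  have [measurable]: "f \<in> borel_measurable lebesgue" "g \<in> borel_measurable lebesgue"
    using assms by (auto intro: L2_measurable)
  have "integrable lebesgue (\<lambda>x. (cmod (f x + g x))\<^sup>2)"
  proof (rule Bochner_Integration.integrable_bound)
    show "integrable lebesgue (\<lambda>x. 2 * (cmod (f x))\<^sup>2 + 2 * (cmod (g x))\<^sup>2)"
      using assms by (auto simp: L2_def)
    have "(cmod (a + b))\<^sup>2 \<le> 2 * (cmod a)\<^sup>2 + 2 * (cmod b)\<^sup>2" for a b
    proof -
      have "(cmod (a + b))\<^sup>2 \<le> (cmod a + cmod b)\<^sup>2"
        by (intro power_mono norm_triangle_ineq) auto
      also have "\<dots> \<le> 2 * (cmod a)\<^sup>2 + 2 * (cmod b)\<^sup>2"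
        using sum_squares_bound[of "cmod a" "cmod b"] by (simp add: power2_sum)
      finally show ?thesis .
    qed
    then show "AE x in lebesgue. norm ((cmod (f x + g x))\<^sup>2) \<le> norm (2 * (cmod (f x))\<^sup>2 + 2 * (cmod (g x))\<^sup>2)"
      by (intro AE_I2) auto
  qed measurable
  then show ?thesis by (simp add: L2_def)
qed

lemma L2_diff: "f \<in> L2 \<Longrightarrow> g \<in> L2 \<Longrightarrow> (\<lambda>x. f x - g x) \<in> L2"
  using L2_add[of f "\<lambda>x. - 1 * g x"] L2_scale[of g "-1"] by simp

lemma L2_zero: "(\<lambda>x. 0) \<in> L2"
  by (simp add: L2_def)

lemma L2_sum: "(\<And>i. i \<in> I \<Longrightarrow> e i \<in> L2) \<Longrightarrow> (\<lambda>x. \<Sum>i\<in>I. e i x) \<in> L2"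
  by (induction I rule: infinite_finite_induct) (auto intro: L2_add L2_zero)

lemma inner_add_l: "f \<in> L2 \<Longrightarrow> g \<in> L2 \<Longrightarrow> h \<in> L2 \<Longrightarrow>
    inner_L2 (\<lambda>x. f x + g x) h = inner_L2 f h + inner_L2 g h"
  unfolding inner_L2_def by (simp add: ring_distribs inner_integrable)

lemma inner_diff_l: "f \<in> L2 \<Longrightarrow> g \<in> L2 \<Longrightarrow> h \<in> L2 \<Longrightarrow>
    inner_L2 (\<lambda>x. f x - g x) h = inner_L2 f h - inner_L2 g h"
  unfolding inner_L2_def by (simp add: ring_distribs inner_integrable)

lemma inner_scale_l: "inner_L2 (\<lambda>x. c * f x) h = c * inner_L2 f h"
  unfolding inner_L2_def by (simp add: mult.assoc)

lemma inner_cnj: "cnj (inner_L2 f g) = inner_L2 g f"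
  unfolding inner_L2_def by (subst Bochner_Integration.integral_cnj[symmetric]) (simp add: mult.commute)

lemma inner_add_r: "f \<in> L2 \<Longrightarrow> g \<in> L2 \<Longrightarrow> h \<in> L2 \<Longrightarrow>
    inner_L2 h (\<lambda>x. f x + g x) = inner_L2 h f + inner_L2 h g"
  by (subst (1 2 3) inner_cnj[symmetric]) (simp add: inner_add_l)

lemma inner_diff_r: "f \<in> L2 \<Longrightarrow> g \<in> L2 \<Longrightarrow> h \<in> L2 \<Longrightarrow>
    inner_L2 h (\<lambda>x. f x - g x) = inner_L2 h f - inner_L2 h g"
  by (subst (1 2 3) inner_cnj[symmetric]) (simp add: inner_diff_l)

lemma inner_scale_r: "inner_L2 h (\<lambda>x. c * f x) = cnj c * inner_L2 h f"
  by (subst (1 2) inner_cnj[symmetric]) (simp add: inner_scale_l)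

lemma inner_sum_l:
  assumes "\<And>i. i \<in> I \<Longrightarrow> e i \<in> L2" "h \<in> L2"
  shows "inner_L2 (\<lambda>x. \<Sum>i\<in>I. e i x) h = (\<Sum>i\<in>I. inner_L2 (e i) h)"
  unfolding inner_L2_def sum_distrib_right
  by (rule Bochner_Integration.integral_sum) (use assms inner_integrable in auto)

lemma norm_L2_nonneg: "norm_L2 f \<ge> 0"
  by (simp add: norm_L2_def)

lemma norm_L2_sq: "(norm_L2 f)\<^sup>2 = (LINT x|lebesgue. (cmod (f x))\<^sup>2)"
  by (simp add: norm_L2_def)

lemma inner_self: "inner_L2 f f = of_real ((norm_L2 f)\<^sup>2)"
  unfolding norm_L2_sq inner_L2_def
  by (simp add: complex_norm_square[symmetric] flip: of_real_power)

lemma Cauchy_Schwarz: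
  assumes "f \<in> L2" "g \<in> L2"
  shows "cmod (inner_L2 f g) \<le> norm_L2 f * norm_L2 g"
proof -
  define c where "c = inner_L2 f g"
  define a where "a = (norm_L2 f)\<^sup>2"
  define b where "b = (norm_L2 g)\<^sup>2"
  have ab: "a \<ge> 0" "b \<ge> 0" by (auto simp: a_def b_def)
  \<comment> \<open>The scalar \<open>t c\<close>, with \<open>c\<close> the inner product itself,
    makes both cross terms equal to the real number \<open>t |c|^2\<close>, so a real quadratic in
    \<open>t\<close> results.\<close>
  have key: "0 \<le> a - 2 * t * (cmod c)\<^sup>2 + t\<^sup>2 * (cmod c)\<^sup>2 * b" for t :: real
  proof -
    define h where "h = (\<lambda>x. f x - (of_real t * c) * g x)"
    have tg: "(\<lambda>x. (of_real t * c) * g x) \<in> L2" using assms L2_scale by blast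
    have hL: "h \<in> L2" unfolding h_def by (intro L2_diff assms tg)
    have "inner_L2 h h = inner_L2 f f - cnj (of_real t * c) * inner_L2 f g - (of_real t * c) * inner_L2 g f
        + (of_real t * c) * cnj (of_real t * c) * inner_L2 g g"
      unfolding h_def inner_diff_l[OF assms(1) tg L2_diff[OF assms(1) tg]]
        inner_diff_r[OF assms(1) tg assms(1)] inner_diff_r[OF assms(1) tg tg]
        inner_scale_l inner_scale_r by algebra
    also have "inner_L2 g f = cnj c" by (simp add: c_def inner_cnj)
    also have "inner_L2 f g = c" by (simp add: c_def)
    finally have "of_real ((norm_L2 h)\<^sup>2) = of_real a - cnj (of_real t * c) * c - of_real t * c * cnj c
        + of_real t * c * cnj (of_real t * c) * of_real b"
      by (simp add: inner_self a_def b_def)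
    also have "\<dots> = of_real a - 2 * of_real t * (c * cnj c) + (of_real t)\<^sup>2 * (c * cnj c) * of_real b"
      by (simp add: algebra_simps power2_eq_square)
    also have "\<dots> = of_real (a - 2 * t * (cmod c)\<^sup>2 + t\<^sup>2 * (cmod c)\<^sup>2 * b)"
      by (simp add: complex_norm_square[symmetric])
    finally have "(norm_L2 h)\<^sup>2 = a - 2 * t * (cmod c)\<^sup>2 + t\<^sup>2 * (cmod c)\<^sup>2 * b"
      using of_real_eq_iff by blast
    then show ?thesis by (metis zero_le_power2)
  qed
  have "(cmod c)\<^sup>2 \<le> a * b"
  proof (cases "b = 0")
    case True
    show ?thesis
    proof (rule ccontr)
      assume "\<not> (cmod c)\<^sup>2 \<le> a * b"
      then have c0: "(cmod c)\<^sup>2 > 0" using True by simp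
      \<comment> \<open>With \<open>b = 0\<close> the quadratic is affine in \<open>t\<close>, and
        this \<open>t\<close> gives it the value -1.\<close>
      have "0 \<le> a - 2 * ((a + 1) / (2 * (cmod c)\<^sup>2)) * (cmod c)\<^sup>2"
        using key[of "(a + 1) / (2 * (cmod c)\<^sup>2)"] True by simp
      then show False using c0 by (simp add: field_simps)
    qed
  next
    case False
    then have "b > 0" using ab by simp
    \<comment> \<open>\<open>t = 1 / b\<close> is the minimum of the quadratic.\<close>
    have "0 \<le> a - 2 * (1/b) * (cmod c)\<^sup>2 + (1/b)\<^sup>2 * (cmod c)\<^sup>2 * b" by (rule key)
    also have "\<dots> = a - (cmod c)\<^sup>2 / b" using \<open>b > 0\<close> by (simp add: field_simps power2_eq_square)
    finally show ?thesis using \<open>b > 0\<close> by (simp add: field_simps)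
  qed
  then have "(cmod c)\<^sup>2 \<le> (norm_L2 f * norm_L2 g)\<^sup>2" by (simp add: a_def b_def power_mult_distrib)
  then show ?thesis unfolding c_def
    by (rule power2_le_imp_le) (simp add: norm_L2_nonneg)
qed

lemma norm_L2_add_sq:
  assumes "f \<in> L2" "g \<in> L2"
  shows "(norm_L2 (\<lambda>x. f x + g x))\<^sup>2 = (norm_L2 f)\<^sup>2 + (norm_L2 g)\<^sup>2 + 2 * Re (inner_L2 f g)"
proof -
  have "inner_L2 (\<lambda>x. f x + g x) (\<lambda>x. f x + g x) = inner_L2 f f + inner_L2 g g + (inner_L2 f g + cnj (inner_L2 f g))"
    using assms by (simp add: inner_add_l inner_add_r L2_add inner_cnj)
  then have "Re (inner_L2 (\<lambda>x. f x + g x) (\<lambda>x. f x + g x)) = Re (inner_L2 f f + inner_L2 g g + (inner_L2 f g + cnj (inner_L2 f g)))"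
    by (rule arg_cong)
  then show ?thesis by (simp add: inner_self del: of_real_power)
qed

lemma norm_L2_scale: "norm_L2 (\<lambda>x. c * f x) = cmod c * norm_L2 f"
proof -
  have "(norm_L2 (\<lambda>x. c * f x))\<^sup>2 = (cmod c * norm_L2 f)\<^sup>2"
    unfolding norm_L2_sq power_mult_distrib by (simp add: norm_mult power_mult_distrib)
  then show ?thesis by (simp add: norm_L2_nonneg)
qed

lemma norm_L2_triangle:
  assumes "f \<in> L2" "g \<in> L2"
  shows "norm_L2 (\<lambda>x. f x + g x) \<le> norm_L2 f + norm_L2 g"
proof (rule power2_le_imp_le)
  have "Re (inner_L2 f g) \<le> norm_L2 f * norm_L2 g"
    using Cauchy_Schwarz[OF assms] complex_Re_le_cmod[of "inner_L2 f g"] by linarith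
  then show "(norm_L2 (\<lambda>x. f x + g x))\<^sup>2 \<le> (norm_L2 f + norm_L2 g)\<^sup>2"
    unfolding norm_L2_add_sq[OF assms] by (simp add: power2_sum)
qed (simp add: norm_L2_nonneg)

lemma norm_L2_minus_commute: "norm_L2 (\<lambda>x. f x - g x) = norm_L2 (\<lambda>x. g x - f x)"
  unfolding norm_L2_def by (simp add: norm_minus_commute)

lemma norm_L2_triangle_diff:
  assumes "f \<in> L2" "g \<in> L2" "h \<in> L2"
  shows "norm_L2 (\<lambda>x. f x - h x) \<le> norm_L2 (\<lambda>x. f x - g x) + norm_L2 (\<lambda>x. g x - h x)"
  using norm_L2_triangle[of "\<lambda>x. f x - g x" "\<lambda>x. g x - h x"] assms by (simp add: L2_diff)

lemma norm_L2_triangle_sub: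
  assumes "f \<in> L2" "g \<in> L2"
  shows "\<bar>norm_L2 f - norm_L2 g\<bar> \<le> norm_L2 (\<lambda>x. f x - g x)"
  using norm_L2_triangle_diff[of f g "\<lambda>_. 0"] norm_L2_triangle_diff[of g f "\<lambda>_. 0"] assms L2_zero
  by (simp add: norm_L2_minus_commute[of f g])

lemma norm_L2_cnj: "norm_L2 (\<lambda>x. cnj (f x)) = norm_L2 f"
  by (simp add: norm_L2_def)

lemma norm_L2_tendsto_zeroI:
  assumes "(\<lambda>k::nat. LINT x|lebesgue. (cmod (u k x))\<^sup>2) \<longlonglongrightarrow> 0" "\<epsilon> > 0"
  shows "\<exists>k. norm_L2 (u k) < \<epsilon>"
proof -
  have "(\<lambda>k. norm_L2 (u k)) \<longlonglongrightarrow> sqrt 0"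
    unfolding norm_L2_def by (intro tendsto_real_sqrt assms)
  then have "\<forall>\<^sub>F k in sequentially. norm_L2 (u k) < \<epsilon>"
    using assms(2) order_tendstoD(2) by (metis real_sqrt_zero)
  then show ?thesis using eventually_happens by fastforce
qed

section \<open>Dense subspaces and tight frames\<close>

text \<open>Test functions for the quadratic forms. Continuity is deliberately absent: indicators of
  bounded measurable sets must belong to the class, and it must be stable under multiplication by
  bounded measurable windows. The bounds hold at every point, so that sums over lattice shifts
  really are finite.\<close>

definition bcs :: "(real \<Rightarrow> complex) \<Rightarrow> bool" where
  "bcs p \<longleftrightarrow> p \<in> borel_measurable lebesgue \<and> (\<exists>K R. \<forall>x. cmod (p x) \<le> K \<and> (\<bar>x\<bar> > R \<longrightarrow> p x = 0))"

lemma bcsE: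
  assumes "bcs p"
  obtains K R where "K > 0" "R > 0" "p \<in> borel_measurable lebesgue" "\<And>x. cmod (p x) \<le> K"
    "\<And>x. \<bar>x\<bar> > R \<Longrightarrow> p x = 0"
proof -
  from assms obtain K R where KR: "p \<in> borel_measurable lebesgue" "\<forall>x. cmod (p x) \<le> K \<and> (\<bar>x\<bar> > R \<longrightarrow> p x = 0)"
    by (auto simp: bcs_def)
  show ?thesis
  proof (rule that[of "max K 1" "max R 1"])
    show "cmod (p x) \<le> max K 1" for x using KR(2)[rule_format, of x] by (simp add: le_max_iff_disj)
    show "p x = 0" if "\<bar>x\<bar> > max R 1" for x using KR(2)[rule_format, of x] that by simp
  qed (use KR in auto)
qed

lemma integrable_interval: "integrable lebesgue (\<lambda>x::real. K * indicat_real {- R..R} x)"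
proof -
  have "integrable lebesgue (indicat_real {- R..R})"
    by (intro integrable_real_indicator) (auto simp: emeasure_lborel_Icc_eq)
  then show ?thesis by simp
qed

lemma bounded_supp_integrable:
  fixes p :: "real \<Rightarrow> 'a :: euclidean_space"
  assumes "p \<in> borel_measurable lebesgue" "\<And>x. norm (p x) \<le> K" "\<And>x. \<bar>x\<bar> > R \<Longrightarrow> p x = 0"
  shows "integrable lebesgue p"
proof (rule Bochner_Integration.integrable_bound[OF integrable_interval[of K R]])
  show "AE x in lebesgue. norm (p x) \<le> norm (K * indicat_real {- R..R} x)"
  proof (intro AE_I2)
    fix x show "norm (p x) \<le> norm (K * indicat_real {- R..R} x)"
      using assms(2)[of x] assms(3)[of x] by (cases "\<bar>x\<bar> \<le> R") (auto simp: indicator_def)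
  qed
qed (use assms in auto)

lemma bcs_integrable: "bcs p \<Longrightarrow> integrable lebesgue p"
  by (elim bcsE) (rule bounded_supp_integrable)

lemma bcs_L2: assumes "bcs p" shows "p \<in> L2"
  using assms
proof (rule bcsE)
  fix K R :: real assume *: "p \<in> borel_measurable lebesgue" "\<And>x. cmod (p x) \<le> K" "\<And>x. \<bar>x\<bar> > R \<Longrightarrow> p x = 0"
  have [measurable]: "p \<in> borel_measurable lebesgue" by fact
  have "integrable lebesgue (\<lambda>x. (cmod (p x))\<^sup>2)"
    by (rule bounded_supp_integrable[where K="K\<^sup>2" and R=R]) (use * in \<open>auto intro: power_mono\<close>)
  then show "p \<in> L2" using * by (simp add: L2_def)
qed

definition Cc :: "(real \<Rightarrow> complex) \<Rightarrow> bool" where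
  "Cc h \<longleftrightarrow> continuous_on UNIV h \<and> (\<exists>R. \<forall>x. \<bar>x\<bar> > R \<longrightarrow> h x = 0)"

lemma Cc_bcs: assumes "Cc h" shows "bcs h"
proof -
  from assms obtain R where h: "continuous_on UNIV h" and R: "\<And>x. \<bar>x\<bar> > R \<Longrightarrow> h x = 0" by (auto simp: Cc_def)
  have "compact (h ` {-R..R})"
    by (intro compact_continuous_image continuous_on_subset[OF h]) auto
  then obtain K where K: "\<And>x. x \<in> {-R..R} \<Longrightarrow> cmod (h x) \<le> K"
    using compact_imp_bounded bounded_iff by (metis imageI)
  have "h \<in> borel_measurable lebesgue"
    using borel_measurable_continuous_onI[OF h] by (simp add: measurable_completion)
  moreover have "cmod (h x) \<le> max K 0" for x
    using K[of x] R[of x] by (cases "\<bar>x\<bar> > R") (auto simp: le_max_iff_disj abs_le_iff not_less)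
  ultimately show ?thesis unfolding bcs_def using R by blast
qed

text \<open>Cutting \<open>f\<close> off in both argument and value leaves an error that is 0 from
  some \<open>k\<close> on at each point and is dominated by \<open>|f|^2\<close>.\<close>

lemma dense_truncation:
  assumes f: "f \<in> L2" and e: "\<epsilon> > 0"
  shows "\<exists>h. bcs h \<and> norm_L2 (\<lambda>x. f x - h x) < \<epsilon>"
proof -
  define h where "h k x = (if \<bar>x\<bar> \<le> real k \<and> cmod (f x) \<le> real k then f x else 0)" for k x
  have [measurable]: "f \<in> borel_measurable lebesgue" using f by (rule L2_measurable)
  have [measurable]: "(\<lambda>x::real. x) \<in> borel_measurable lebesgue" by (simp add: measurable_completion)
  have [measurable]: "h k \<in> borel_measurable lebesgue" for k unfolding h_def by measurable
  have bc: "bcs (h k)" for k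
    unfolding bcs_def by (auto simp: h_def intro!: exI[of _ "real k"])
  have "(\<lambda>k. LINT x|lebesgue. (cmod (f x - h k x))\<^sup>2) \<longlonglongrightarrow> (LINT x|(lebesgue :: real measure). 0)"
  proof (rule integral_dominated_convergence[where w="\<lambda>x. (cmod (f x))\<^sup>2"])
    show "integrable lebesgue (\<lambda>x. (cmod (f x))\<^sup>2)" using f by (rule L2_integrable)
    show "AE x in lebesgue. (\<lambda>k. (cmod (f x - h k x))\<^sup>2) \<longlonglongrightarrow> 0"
    proof (intro AE_I2 tendsto_eventually)
      fix x :: real
      obtain N where "real N \<ge> max \<bar>x\<bar> (cmod (f x))" using real_arch_simple by blast
      then have "(cmod (f x - h k x))\<^sup>2 = 0" if "k \<ge> N" for k
        using that by (auto simp: h_def)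
      then show "\<forall>\<^sub>F k in sequentially. (cmod (f x - h k x))\<^sup>2 = 0"
        using eventually_sequentially by blast
    qed
    show "AE x in lebesgue. norm ((cmod (f x - h k x))\<^sup>2) \<le> (cmod (f x))\<^sup>2" for k
      by (intro AE_I2) (auto simp: h_def)
  qed measurable
  then have "\<exists>k. norm_L2 (\<lambda>x. f x - h k x) < \<epsilon>"
    by (intro norm_L2_tendsto_zeroI e) simp
  then show ?thesis using bc by blast
qed

text \<open>A measurable function is an almost everywhere limit of continuous functions, but these
  need neither a common bound nor a common support. A clip of the values and a cutoff of the
  argument supply both without changing the limit, and dominated convergence applies.\<close>

lemma dense_Cc_bcs:
  assumes f: "bcs f" and e: "\<epsilon> > 0"
  shows "\<exists>h. Cc h \<and> norm_L2 (\<lambda>x. f x - h x) < \<epsilon>"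
proof -
  from f obtain K R where K: "K > 0" and R: "R > 0" and fm [measurable]: "f \<in> borel_measurable lebesgue"
    and fK: "\<And>x. cmod (f x) \<le> K" and fR: "\<And>x. \<bar>x\<bar> > R \<Longrightarrow> f x = 0" by (rule bcsE) blast
  have "f measurable_on UNIV"
    by (rule lebesgue_measurable_imp_measurable_on) (use fm in auto)
  then obtain N g where N: "negligible N" and g: "\<And>n. continuous_on UNIV (g n)"
    and lim: "\<And>x. x \<notin> N \<Longrightarrow> (\<lambda>n. g n x) \<longlonglongrightarrow> f x"
    unfolding measurable_on_def by auto
  \<comment> \<open>\<open>clip\<close> retracts the plane radially onto the disc of radius
    \<open>K\<close>, and \<open>chi\<close> is a continuous cutoff equal to 1 on
    \<open>[-R, R]\<close>; neither alters the values of \<open>f\<close>.\<close>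
  define clip where "clip z = of_real (K / max K (cmod z)) * z" for z :: complex
  define chi where "chi x = max 0 (min 1 (R + 1 - \<bar>x\<bar>))" for x :: real
  define h where "h n x = of_real (chi x) * clip (g n x)" for n x
  have clipK: "cmod (clip z) \<le> K" for z
    using K by (auto simp: clip_def norm_mult norm_divide field_simps max_def)
  have clip_id: "clip z = z" if "cmod z \<le> K" for z
    using that K by (simp add: clip_def)
  have contclip: "continuous_on UNIV clip"
    unfolding clip_def using K by (intro continuous_intros) (auto simp: max_def)
  have contchi: "continuous_on UNIV chi"
    unfolding chi_def by (intro continuous_intros)
  have conth: "continuous_on UNIV (h n)" for n
    unfolding h_def by (intro continuous_intros contchi continuous_on_compose2[OF contclip g]) auto
  have h0: "h n x = 0" if "\<bar>x\<bar> > R + 1" for n x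
    using that by (simp add: h_def chi_def)
  have Cch: "Cc (h n)" for n using conth h0 by (auto simp: Cc_def)
  have [measurable]: "h n \<in> borel_measurable lebesgue" for n
    using borel_measurable_continuous_onI[OF conth] by (simp add: measurable_completion)
  have hK: "cmod (h n x) \<le> K" for n x
  proof -
    have "\<bar>chi x\<bar> \<le> 1" by (auto simp: chi_def)
    then have "\<bar>chi x\<bar> * cmod (clip (g n x)) \<le> 1 * K"
      using clipK[of "g n x"] by (intro mult_mono) auto
    then show ?thesis by (simp add: h_def norm_mult)
  qed
  have "(\<lambda>n. LINT x|lebesgue. (cmod (f x - h n x))\<^sup>2) \<longlonglongrightarrow> (LINT x|(lebesgue :: real measure). 0)"
  proof (rule integral_dominated_convergence[where w="\<lambda>x. (2 * K)\<^sup>2 * indicat_real {- (R + 1)..R + 1} x"])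
    have "AE x in lebesgue. x \<notin> N"
      using N by (simp add: negligible_iff_null_sets AE_not_in)
    then show "AE x in lebesgue. (\<lambda>k. (cmod (f x - h k x))\<^sup>2) \<longlonglongrightarrow> 0"
    proof eventually_elim
      case (elim x)
      have "(\<lambda>n. clip (g n x)) \<longlonglongrightarrow> clip (f x)"
        using contclip lim[OF elim] continuous_on_tendsto_compose[OF contclip lim[OF elim]] by simp
      then have "(\<lambda>n. h n x) \<longlonglongrightarrow> of_real (chi x) * clip (f x)"
        unfolding h_def by (intro tendsto_intros)
      also have "of_real (chi x) * clip (f x) = f x"
        using fR[of x] clip_id[OF fK] by (cases "\<bar>x\<bar> > R") (auto simp: chi_def clip_def)
      finally have "(\<lambda>n. (cmod (f x - h n x))\<^sup>2) \<longlonglongrightarrow> (cmod (f x - f x))\<^sup>2"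
        by (intro tendsto_intros)
      then show ?case by simp
    qed
    show "AE x in lebesgue. norm ((cmod (f x - h n x))\<^sup>2) \<le> (2 * K)\<^sup>2 * indicat_real {- (R + 1)..R + 1} x" for n
    proof (intro AE_I2)
      fix x :: real
      have "cmod (f x - h n x) \<le> 2 * K"
        using norm_triangle_ineq4[of "f x" "h n x"] fK[of x] hK[of n x] by linarith
      then have "(cmod (f x - h n x))\<^sup>2 \<le> (2 * K)\<^sup>2" by (intro power_mono) auto
      then show "norm ((cmod (f x - h n x))\<^sup>2) \<le> (2 * K)\<^sup>2 * indicat_real {- (R + 1)..R + 1} x"
        using fR[of x] h0[of x n] by (auto simp: indicator_def)
    qed
  qed (use integrable_interval in measurable)
  then have "\<exists>k. norm_L2 (\<lambda>x. f x - h k x) < \<epsilon>"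
    by (intro norm_L2_tendsto_zeroI e) simp
  then show ?thesis using Cch by blast
qed

lemma dense_Cc:
  assumes f: "f \<in> L2" and e: "\<epsilon> > 0"
  shows "\<exists>h. Cc h \<and> norm_L2 (\<lambda>x. f x - h x) < \<epsilon>"
proof -
  obtain p where p: "bcs p" "norm_L2 (\<lambda>x. f x - p x) < \<epsilon> / 2"
    using dense_truncation[OF f, of "\<epsilon> / 2"] e by auto
  obtain h where h: "Cc h" "norm_L2 (\<lambda>x. p x - h x) < \<epsilon> / 2"
    using dense_Cc_bcs[OF p(1), of "\<epsilon> / 2"] e by auto
  have "norm_L2 (\<lambda>x. f x - h x) \<le> norm_L2 (\<lambda>x. f x - p x) + norm_L2 (\<lambda>x. p x - h x)"
    using f p(1) h(1) by (intro norm_L2_triangle_diff) (auto intro: bcs_L2 Cc_bcs)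
  then show ?thesis using p h by (intro exI[of _ h]) auto
qed

section \<open>Extending the frame identity from a dense set\<close>

lemma has_sum_nonnegI:
  fixes f :: "'i \<Rightarrow> real"
  assumes "\<And>i. f i \<ge> 0" "\<And>I. finite I \<Longrightarrow> sum f I \<le> S"
    and "\<And>\<delta>. \<delta> > 0 \<Longrightarrow> \<exists>I. finite I \<and> sum f I \<ge> S - \<delta>"
  shows "(f has_sum S) UNIV"
proof -
  have bdd: "bdd_above (sum f ` {F. F \<subseteq> UNIV \<and> finite F})"
    using assms(2) by (auto intro!: bdd_aboveI2)
  then have hs: "(f has_sum (SUP F\<in>{F. finite F \<and> F \<subseteq> UNIV}. sum f F)) UNIV"
    using assms(1) by (intro nonneg_bdd_above_has_sum) auto
  define T where "T = (SUP F\<in>{F. finite F \<and> F \<subseteq> (UNIV :: 'i set)}. sum f F)"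
  have "T \<le> S" unfolding T_def using assms(2) by (intro cSUP_least) auto
  moreover have "S \<le> T"
  proof (rule field_le_epsilon)
    fix \<delta> :: real assume "\<delta> > 0"
    then obtain I where I: "finite I" "sum f I \<ge> S - \<delta>" using assms(3) by blast
    have "sum f I \<le> T" unfolding T_def
      by (rule cSUP_upper) (use I bdd in \<open>auto simp: conj_commute\<close>)
    then show "S \<le> T + \<delta>" using I by linarith
  qed
  ultimately have "T = S" by simp
  then show ?thesis using hs unfolding T_def by simp
qed

lemma coeff_L2_set_triangle:
  assumes "f \<in> L2" "h \<in> L2" "\<And>i. e i \<in> L2"
  shows "L2_set (\<lambda>i. cmod (inner_L2 f (e i))) I
    \<le> L2_set (\<lambda>i. cmod (inner_L2 h (e i))) I + L2_set (\<lambda>i. cmod (inner_L2 (\<lambda>x. f x - h x) (e i))) I"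
proof -
  have "cmod (inner_L2 f (e i)) \<le> cmod (inner_L2 h (e i)) + cmod (inner_L2 (\<lambda>x. f x - h x) (e i))" for i
    using norm_triangle_ineq[of "inner_L2 h (e i)" "inner_L2 (\<lambda>x. f x - h x) (e i)"] assms by (simp add: inner_diff_l)
  then have "L2_set (\<lambda>i. cmod (inner_L2 f (e i))) I
      \<le> L2_set (\<lambda>i. cmod (inner_L2 h (e i)) + cmod (inner_L2 (\<lambda>x. f x - h x) (e i))) I"
    by (intro L2_set_mono) auto
  also note L2_set_triangle_ineq
  finally show ?thesis .
qed

text \<open>On a finite \<open>I\<close> the root of the coefficient sum is a seminorm
  \<open>s I\<close>, continuous with a modulus that depends on \<open>I\<close>. This extends the
  Bessel bound from \<open>D\<close> to all of \<open>L2\<close>; that bound then controls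
  \<open>h - f\<close> uniformly in \<open>I\<close> and yields the lower estimate.\<close>

lemma tight_frame_dense:
  fixes e :: "'i::countable \<Rightarrow> real \<Rightarrow> complex"
  assumes A: "A > 0" and e: "\<And>i. e i \<in> L2"
    and dense: "\<And>f \<epsilon>. f \<in> L2 \<Longrightarrow> \<epsilon> > 0 \<Longrightarrow> \<exists>h. h \<in> D \<and> h \<in> L2 \<and> norm_L2 (\<lambda>x. f x - h x) < \<epsilon>"
    and par: "\<And>h. h \<in> D \<Longrightarrow> h \<in> L2 \<Longrightarrow> ((\<lambda>i. (cmod (inner_L2 h (e i)))\<^sup>2) has_sum (A * (norm_L2 h)\<^sup>2)) UNIV"
  shows "tight_frame A e"
proof -
  define s where "s I f = L2_set (\<lambda>i. cmod (inner_L2 f (e i))) I" for I f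
  define a where "a = sqrt A"
  have a: "a > 0" "a\<^sup>2 = A" using A by (auto simp: a_def)
  have tri: "s I f \<le> s I h + s I (\<lambda>x. f x - h x)" if "f \<in> L2" "h \<in> L2" for I f h
    unfolding s_def using coeff_L2_set_triangle that e by blast
  have s0: "s I f \<ge> 0" for I f by (simp add: s_def)
  have s2: "(\<Sum>i\<in>I. (cmod (inner_L2 f (e i)))\<^sup>2) = (s I f)\<^sup>2" for I f
    by (simp add: s_def L2_set_def sum_nonneg)
  have besD: "s I h \<le> a * norm_L2 h" if "h \<in> D" "h \<in> L2" "finite I" for I h
  proof (rule power2_le_imp_le)
    show "(s I h)\<^sup>2 \<le> (a * norm_L2 h)\<^sup>2"
      unfolding s2[symmetric] power_mult_distrib a
      by (rule finite_sum_le_has_sum[OF par[OF that(1,2)] that(3)]) auto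
  qed (use a norm_L2_nonneg in auto)
  have bes: "s I f \<le> a * norm_L2 f" if f: "f \<in> L2" and I: "finite I" for I f
  proof (rule field_le_epsilon)
    fix \<delta> :: real assume d: "\<delta> > 0"
    \<comment> \<open>The two error terms below, one from \<open>s I\<close> and one from the norm,
      add up to \<open>B\<close> times the distance from \<open>f\<close> to \<open>h\<close>. The
      summand \<open>a > 0\<close> keeps \<open>B\<close> positive when all \<open>e i\<close>
      vanish.\<close>
    define B where "B = (\<Sum>i\<in>I. norm_L2 (e i)) + a"
    have B: "B > 0" unfolding B_def using a norm_L2_nonneg by (intro add_nonneg_pos sum_nonneg) auto
    obtain h where h: "h \<in> D" "h \<in> L2" "norm_L2 (\<lambda>x. f x - h x) < \<delta> / B"
      using dense[OF f, of "\<delta> / B"] d B by auto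
    have fh: "(\<lambda>x. f x - h x) \<in> L2" using f h L2_diff by blast
    have "s I (\<lambda>x. f x - h x) \<le> (\<Sum>i\<in>I. cmod (inner_L2 (\<lambda>x. f x - h x) (e i)))"
      unfolding s_def by (rule L2_set_le_sum) auto
    also have "\<dots> \<le> (\<Sum>i\<in>I. norm_L2 (\<lambda>x. f x - h x) * norm_L2 (e i))"
      by (intro sum_mono Cauchy_Schwarz fh e)
    also have "\<dots> = norm_L2 (\<lambda>x. f x - h x) * (\<Sum>i\<in>I. norm_L2 (e i))" by (simp add: sum_distrib_left)
    finally have 1: "s I (\<lambda>x. f x - h x) \<le> norm_L2 (\<lambda>x. f x - h x) * (\<Sum>i\<in>I. norm_L2 (e i))" .
    have 2: "norm_L2 h \<le> norm_L2 f + norm_L2 (\<lambda>x. f x - h x)"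
      using norm_L2_triangle_sub[OF f h(2)] by linarith
    have "s I f \<le> a * norm_L2 h + norm_L2 (\<lambda>x. f x - h x) * (\<Sum>i\<in>I. norm_L2 (e i))"
      using tri[OF f h(2), of I] besD[OF h(1,2) I] 1 by linarith
    also have "a * norm_L2 h \<le> a * (norm_L2 f + norm_L2 (\<lambda>x. f x - h x))"
      using 2 a by (intro mult_left_mono) auto
    finally have "s I f \<le> a * norm_L2 f + norm_L2 (\<lambda>x. f x - h x) * B"
      by (simp add: B_def algebra_simps)
    also have "norm_L2 (\<lambda>x. f x - h x) * B \<le> \<delta>"
      using h(3) B by (simp add: field_simps)
    finally show "s I f \<le> a * norm_L2 f + \<delta>" by simp
  qed
  have "((\<lambda>i. (cmod (inner_L2 f (e i)))\<^sup>2) has_sum (A * (norm_L2 f)\<^sup>2)) UNIV" if f: "f \<in> L2" for f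
  proof (rule has_sum_nonnegI)
    fix I :: "'i set" assume I: "finite I"
    have "(s I f)\<^sup>2 \<le> (a * norm_L2 f)\<^sup>2" using bes[OF f I] s0 by (intro power_mono) auto
    then show "(\<Sum>i\<in>I. (cmod (inner_L2 f (e i)))\<^sup>2) \<le> A * (norm_L2 f)\<^sup>2"
      by (simp add: s2 power_mult_distrib a)
  next
    fix \<delta> :: real assume d: "\<delta> > 0"
    define T where "T = a * norm_L2 f"
    have T: "T \<ge> 0" "A * (norm_L2 f)\<^sup>2 = T\<^sup>2" using a norm_L2_nonneg by (auto simp: T_def power_mult_distrib)
    \<comment> \<open>Chosen so that \<open>s I f \<ge> T - \<eta>\<close> gives
      \<open>(s I f)\<^sup>2 \<ge> T\<^sup>2 - \<delta>\<close>; the added 1 covers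
      \<open>T = 0\<close>.\<close>
    define \<eta> where "\<eta> = \<delta> / (2 * T + 1)"
    have eta: "\<eta> > 0" "2 * T * \<eta> \<le> \<delta>" using d T(1) by (auto simp: \<eta>_def field_simps)
    obtain h where h: "h \<in> D" "h \<in> L2" "norm_L2 (\<lambda>x. f x - h x) < \<eta> / (4 * a)"
      using dense[OF f, of "\<eta> / (4 * a)"] eta a by auto
    have fh: "(\<lambda>x. h x - f x) \<in> L2" using f h L2_diff by blast
    have "((\<lambda>I. sqrt (\<Sum>i\<in>I. (cmod (inner_L2 h (e i)))\<^sup>2)) \<longlongrightarrow> sqrt (A * (norm_L2 h)\<^sup>2)) (finite_subsets_at_top UNIV)"
      using par[OF h(1,2)] unfolding has_sum_def by (rule tendsto_real_sqrt)
    moreover have "sqrt (A * (norm_L2 h)\<^sup>2) > a * norm_L2 h - \<eta> / 2"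
      using eta norm_L2_nonneg by (simp add: a_def real_sqrt_mult)
    ultimately have "\<forall>\<^sub>F I in finite_subsets_at_top UNIV. sqrt (\<Sum>i\<in>I. (cmod (inner_L2 h (e i)))\<^sup>2) > a * norm_L2 h - \<eta> / 2"
      by (rule order_tendstoD(1))
    then obtain I where I: "finite I" "s I h > a * norm_L2 h - \<eta> / 2"
      unfolding eventually_finite_subsets_at_top s_def L2_set_def by blast
    have 1: "s I h \<le> s I f + s I (\<lambda>x. h x - f x)" using tri[OF h(2) f] .
    have 2: "s I (\<lambda>x. h x - f x) \<le> a * norm_L2 (\<lambda>x. h x - f x)" using bes[OF fh I(1)] .
    have 3: "a * norm_L2 (\<lambda>x. h x - f x) \<le> \<eta> / 4"
      using h(3) a by (simp add: norm_L2_minus_commute[of h] field_simps)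
    have 4: "norm_L2 f \<le> norm_L2 h + norm_L2 (\<lambda>x. h x - f x)"
      using norm_L2_triangle_sub[OF h(2) f] by linarith
    have "T \<le> a * (norm_L2 h + norm_L2 (\<lambda>x. h x - f x))"
      unfolding T_def using 4 a by (intro mult_left_mono) auto
    then have sT: "s I f \<ge> T - \<eta>" using 1 2 3 I(2) by (simp add: distrib_left)
    have "(s I f)\<^sup>2 \<ge> T\<^sup>2 - 2 * T * \<eta>"
    proof (cases "T \<ge> \<eta>")
      case True
      then have "(T - \<eta>)\<^sup>2 \<le> (s I f)\<^sup>2" using sT by (intro power_mono) auto
      then show ?thesis using zero_le_power2[of \<eta>] by (simp only: power2_diff)
    next
      case False
      then have "T * T \<le> T * \<eta>" using T by (intro mult_left_mono) auto
      then have "T\<^sup>2 \<le> T * \<eta>" by (simp add: power2_eq_square)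
      moreover have "0 \<le> T * \<eta>" using T(1) eta by simp
      moreover have "0 \<le> (s I f)\<^sup>2" by simp
      ultimately show ?thesis by linarith
    qed
    then show "\<exists>I. finite I \<and> A * (norm_L2 f)\<^sup>2 - \<delta> \<le> (\<Sum>i\<in>I. (cmod (inner_L2 f (e i)))\<^sup>2)"
      using I(1) eta T by (intro exI[of _ I]) (simp add: s2)
  qed simp
  then show ?thesis using A e by (simp add: tight_frame_def)
qed

section \<open>Plancherel on a dense class\<close>

lemma sigma_finite_lebesgue: "sigma_finite_measure (lebesgue :: real measure)"
proof
  obtain A :: "real set set" where A: "countable A" "A \<subseteq> sets lborel" "\<Union>A = space lborel" "\<forall>a\<in>A. emeasure lborel a \<noteq> \<infinity>"
    using sigma_finite_lborel unfolding sigma_finite_measure_def by blast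
  then show "\<exists>A::real set set. countable A \<and> A \<subseteq> sets lebesgue \<and> \<Union>A = space lebesgue \<and> (\<forall>a\<in>A. emeasure lebesgue a \<noteq> \<infinity>)"
    by (intro exI[of _ A]) (auto simp: subset_iff)
qed

interpretation lebesgue: sigma_finite_measure "lebesgue :: real measure"
  by (rule sigma_finite_lebesgue)

interpretation lebesgue_pair: pair_sigma_finite "lebesgue :: real measure" "lebesgue :: real measure" ..

lemma measurable_ident_lebesgue [measurable]: "(\<lambda>x::real. x) \<in> borel_measurable lebesgue"
  by (simp add: measurable_completion)

lemma continuous_borel_measurable_lebesgue:
  "continuous_on UNIV f \<Longrightarrow> f \<in> borel_measurable (lebesgue :: real measure)"
  by (simp add: measurable_completion borel_measurable_continuous_onI)

lemma borel_measurable_cis [measurable (raw)]: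
  "f \<in> borel_measurable M \<Longrightarrow> (\<lambda>x. cis (f x)) \<in> borel_measurable M"
  by (rule borel_measurable_continuous_on[of cis]) (auto intro: continuous_intros)

text \<open>The kernel has modulus 1, so the double integrand has modulus \<open>|u t| |v w|\<close>
  whatever the phase \<open>k\<close>. The multiplication formula and Fourier inversion are both
  instances.\<close>

lemma Fubini_kernel:
  fixes u v :: "real \<Rightarrow> complex" and k :: "real \<Rightarrow> real \<Rightarrow> real"
  assumes u: "integrable lebesgue u" and v: "integrable lebesgue v"
    and k: "case_prod k \<in> borel_measurable borel"
  shows "(LINT t|lebesgue. u t * (LINT w|lebesgue. cis (k t w) * v w)) =
    (LINT w|lebesgue. (LINT t|lebesgue. u t * cis (k t w)) * v w)"
proof -
  have [measurable]: "u \<in> borel_measurable lebesgue" "v \<in> borel_measurable lebesgue"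
    using u v by auto
  have "(\<lambda>p::real\<times>real. (fst p, snd p)) \<in> lebesgue \<Otimes>\<^sub>M lebesgue \<rightarrow>\<^sub>M borel \<Otimes>\<^sub>M borel"
    by measurable
  then have pr: "(\<lambda>p::real\<times>real. p) \<in> lebesgue \<Otimes>\<^sub>M lebesgue \<rightarrow>\<^sub>M borel"
    by (simp add: borel_prod)
  have [measurable]: "(\<lambda>p. k (fst p) (snd p)) \<in> borel_measurable (lebesgue \<Otimes>\<^sub>M lebesgue)"
    using measurable_compose[OF pr k] by (simp add: case_prod_beta)
  have int: "integrable (lebesgue \<Otimes>\<^sub>M lebesgue) (\<lambda>(t, w). u t * cis (k t w) * v w)"
  proof (rule lebesgue_pair.Fubini_integrable)
    show "(\<lambda>(t, w). u t * cis (k t w) * v w) \<in> borel_measurable (lebesgue \<Otimes>\<^sub>M lebesgue)"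
      unfolding case_prod_beta by measurable
    show "integrable lebesgue (\<lambda>t. LINT w|lebesgue. norm (case (t, w) of (t, w) \<Rightarrow> u t * cis (k t w) * v w))"
      using u by (simp add: norm_mult)
    show "AE t in lebesgue. integrable lebesgue (\<lambda>w. case (t, w) of (t, w) \<Rightarrow> u t * cis (k t w) * v w)"
    proof (intro AE_I2)
      fix t :: real
      have m: "(\<lambda>w. k t w) \<in> borel_measurable lebesgue"
        using measurable_compose[OF measurable_Pair1'[of t borel borel] k[unfolded borel_prod[symmetric]]]
        by (simp add: measurable_completion)
      show "integrable lebesgue (\<lambda>w. case (t, w) of (t, w) \<Rightarrow> u t * cis (k t w) * v w)"
      proof (rule Bochner_Integration.integrable_bound)
        show "integrable lebesgue (\<lambda>w. u t * v w)" using v by simp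
        show "(\<lambda>w. case (t, w) of (t, w) \<Rightarrow> u t * cis (k t w) * v w) \<in> borel_measurable lebesgue"
          using m by simp
      qed (auto simp: norm_mult)
    qed
  qed
  show ?thesis
    using lebesgue_pair.Fubini_integral[OF int]
    by (simp add: mult.assoc flip: integral_mult_right_zero integral_mult_left_zero)
qed

text \<open>Pairs for which both inversion formulas are absolutely convergent integrals valid at
  every point; \<open>fourier_L1 g (- x)\<close> is the inverse transform. Working with them avoids
  constructing the transform as an operator on \<open>L2\<close>.\<close>

definition fourier_pair :: "(real \<Rightarrow> complex) \<Rightarrow> (real \<Rightarrow> complex) \<Rightarrow> bool" where
  "fourier_pair f g \<longleftrightarrow> f \<in> L2 \<and> g \<in> L2 \<and> integrable lebesgue f \<and> integrable lebesgue g \<and>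
    (\<forall>x. f x = fourier_L1 g (- x)) \<and> (\<forall>w. g w = fourier_L1 f w)"

lemma fourier_pair_L2: "fourier_pair f g \<Longrightarrow> f \<in> L2" "fourier_pair f g \<Longrightarrow> g \<in> L2"
  by (auto simp: fourier_pair_def)

lemma fourier_pair_integrable:
  assumes "fourier_pair f g" shows "integrable lebesgue f" "integrable lebesgue g"
  using assms unfolding fourier_pair_def by blast+

lemma fourier_pair_eq:
  assumes "fourier_pair f g" shows "f x = fourier_L1 g (- x)" "fourier_L1 f = g"
  using assms unfolding fourier_pair_def by (blast, auto)

lemma fourier_cnj: "fourier_L1 (\<lambda>t. cnj (f t)) w = cnj (fourier_L1 f (- w))"
  unfolding fourier_L1_def by (simp add: cis_cnj flip: Bochner_Integration.integral_cnj)

text \<open>Conjugation exchanges the transform with its inverse. Hence conjugates of first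
  components occur as second components, and density of the former gives density of the
  latter.\<close>

lemma fourier_pair_cnj:
  assumes "fourier_pair f g" shows "fourier_pair (\<lambda>w. cnj (g w)) (\<lambda>x. cnj (f x))"
  unfolding fourier_pair_def
proof (intro conjI allI)
  show "integrable lebesgue (\<lambda>w. cnj (g w))" "integrable lebesgue (\<lambda>x. cnj (f x))"
    using fourier_pair_integrable[OF assms] by simp_all
  show "(\<lambda>w. cnj (g w)) \<in> L2" "(\<lambda>x. cnj (f x)) \<in> L2"
    using fourier_pair_L2[OF assms] by (auto intro: L2_cnj)
  show "cnj (g x) = fourier_L1 (\<lambda>x. cnj (f x)) (- x)" for x
    using fourier_pair_eq(2)[OF assms] by (simp add: fourier_cnj)
  show "cnj (f w) = fourier_L1 (\<lambda>w. cnj (g w)) w" for w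
    using fourier_pair_eq(1)[OF assms] by (simp add: fourier_cnj)
qed

text \<open>Multiplication formula: \<open>f\<close> is replaced by its inversion integral and
  Fubini moves the kernel onto \<open>F\<close>. Having \<open>F\<close> merely integrable is what
  makes it applicable to the approximating sequence inside \<open>fourier_L2\<close>.\<close>

lemma inner_fourier_L1:
  assumes "fourier_pair f g" "integrable lebesgue F"
  shows "inner_L2 F f = inner_L2 (fourier_L1 F) g"
proof -
  have g: "integrable lebesgue (\<lambda>w. cnj (g w))" using fourier_pair_integrable[OF assms(1)] by simp
  have "cnj (f t) = (LINT w|lebesgue. cis (- 2 * pi * t * w) * cnj (g w))" for t
    using fourier_pair_eq(1)[OF assms(1), of t] unfolding fourier_L1_def
    by (simp add: cis_cnj mult_ac flip: Bochner_Integration.integral_cnj)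
  then have "inner_L2 F f = (LINT t|lebesgue. F t * (LINT w|lebesgue. cis (- 2 * pi * t * w) * cnj (g w)))"
    by (simp add: inner_L2_def)
  also have "\<dots> = (LINT w|lebesgue. (LINT t|lebesgue. F t * cis (- 2 * pi * t * w)) * cnj (g w))"
    by (rule Fubini_kernel[OF assms(2) g])
      (auto simp: case_prod_beta intro!: borel_measurable_continuous_onI continuous_intros)
  finally show ?thesis by (simp add: inner_L2_def fourier_L1_def)
qed

lemma fourier_pair_norm: assumes "fourier_pair f g" shows "norm_L2 f = norm_L2 g"
proof -
  have "inner_L2 f f = inner_L2 g g"
    using inner_fourier_L1[OF assms fourier_pair_integrable(1)[OF assms]] by (simp add: fourier_pair_eq[OF assms])
  then have "(norm_L2 f)\<^sup>2 = (norm_L2 g)\<^sup>2" by (simp add: inner_self del: of_real_power)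
  then show ?thesis using norm_L2_nonneg by (simp add: power2_eq_iff_nonneg)
qed

lemma inner_tendsto:
  assumes "\<And>k. F k \<in> L2" "f \<in> L2" "h \<in> L2" "(\<lambda>k. norm_L2 (\<lambda>t. F k t - f t)) \<longlonglongrightarrow> 0"
  shows "(\<lambda>k. inner_L2 (F k) h) \<longlonglongrightarrow> inner_L2 f h"
proof (rule Lim_null_comparison[THEN Lim_null[THEN iffD2]])
  show "(\<lambda>k. norm_L2 (\<lambda>t. F k t - f t) * norm_L2 h) \<longlonglongrightarrow> 0"
    using tendsto_mult_left_zero[OF assms(4)] by blast
  show "\<forall>\<^sub>F k in sequentially. norm (inner_L2 (F k) h - inner_L2 f h) \<le> norm_L2 (\<lambda>t. F k t - f t) * norm_L2 h"
    using Cauchy_Schwarz[OF L2_diff[OF assms(1,2)] assms(3)] assms by (simp add: inner_diff_l)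
qed

text \<open>Along the approximating sequence the numbers \<open>inner_L2 (F k) f\<close> have both
  sides as limits, by continuity of the inner product before and after the transform.\<close>

lemma inner_fourier_L2:
  assumes "fourier_L2 \<phi> \<phi>h" "fourier_pair f g"
  shows "inner_L2 \<phi> f = inner_L2 \<phi>h g"
proof -
  from assms(1) obtain F where F: "\<And>k. F k \<in> L2" "\<And>k. integrable lebesgue (F k)" "\<And>k. fourier_L1 (F k) \<in> L2"
    "(\<lambda>k. norm_L2 (\<lambda>t. F k t - \<phi> t)) \<longlonglongrightarrow> 0" "(\<lambda>k. norm_L2 (\<lambda>w. fourier_L1 (F k) w - \<phi>h w)) \<longlonglongrightarrow> 0"
    and L: "\<phi> \<in> L2" "\<phi>h \<in> L2"
    unfolding fourier_L2_def by blast
  have "(\<lambda>k. inner_L2 (F k) f) \<longlonglongrightarrow> inner_L2 \<phi> f"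
    using assms(2) by (intro inner_tendsto F L) (auto intro: fourier_pair_L2)
  moreover have "(\<lambda>k. inner_L2 (F k) f) \<longlonglongrightarrow> inner_L2 \<phi>h g"
    unfolding inner_fourier_L1[OF assms(2) F(2)]
    using assms(2) by (intro inner_tendsto F L) (auto intro: fourier_pair_L2)
  ultimately show ?thesis by (rule LIMSEQ_unique)
qed

section \<open>Gaussian integrals and mollification\<close>

lemma gaussian_fourier:
  "(LINT t|lebesgue. std_normal_density t * cis (a * t)) = complex_of_real (exp (- a\<^sup>2 / 2))"
proof -
  have m: "(\<lambda>t::real. cis (a * t)) \<in> borel_measurable lborel"
    by (simp add: borel_measurable_continuous_onI continuous_intros)
  have d: "std_normal_density \<in> borel_measurable lborel" by simp
  have "complex_of_real (exp (- a\<^sup>2 / 2)) = char std_normal_distribution a"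
    by (simp add: char_std_normal_distribution)
  also have "\<dots> = (CLINT t|density lborel std_normal_density. cis (a * t))"
    unfolding char_def by (simp add: cis_conv_exp)
  also have "\<dots> = (LINT t|lborel. std_normal_density t *\<^sub>R cis (a * t))"
    by (rule integral_density[OF m d]) simp
  also have "\<dots> = (LINT t|lebesgue. std_normal_density t *\<^sub>R cis (a * t))"
    by (intro integral_completion[symmetric] borel_measurable_scaleR d m)
  finally show ?thesis by (simp add: scaleR_conv_of_real)
qed

lemma integrable_gaussian: "integrable lebesgue std_normal_density"
  by (subst integrable_completion) auto

lemma integral_gaussian: "(LINT t|lebesgue. std_normal_density t) = 1"
  by (subst integral_completion) auto

lemma integrable_lebesgue_affine:
  fixes f :: "real \<Rightarrow> 'a :: euclidean_space"
  shows "integrable lebesgue f \<Longrightarrow> integrable lebesgue (\<lambda>x. f (x + a))"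
  using lebesgue_integrable_real_affine[of f 1 a] by (simp add: add.commute)

lemma integral_lebesgue_shift:
  fixes f :: "real \<Rightarrow> 'a :: euclidean_space"
  shows "(LINT x|lebesgue. f (x + a)) = (LINT x|lebesgue. f x)"
  using lebesgue_integral_real_affine[of 1 f a] by (simp add: add.commute)

text \<open>After rescaling, the integral is a characteristic function of the normal law again; the
  value is the density at \<open>z\<close> of the centred normal law with deviation
  \<open>\<sigma>\<close>.\<close>

lemma gaussian_inverse:
  assumes s: "\<sigma> > 0"
  shows "(LINT w|lebesgue. cis (2 * pi * z * w) * complex_of_real (exp (- 2 * (pi * \<sigma> * w)\<^sup>2))) =
    complex_of_real (std_normal_density (z / \<sigma>) / \<sigma>)"
proof -
  \<comment> \<open>Solves \<open>2 * (pi * \<sigma> * c * t)\<^sup>2 = t\<^sup>2 / 2\<close>, so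
    that the Gaussian becomes \<open>sqrt (2 * pi)\<close> times the standard normal
    density.\<close>
  define c where "c = 1 / (2 * pi * \<sigma>)"
  have c: "c > 0" using s by (simp add: c_def)
  have e: "exp (- 2 * (pi * \<sigma> * (c * t))\<^sup>2) = sqrt (2 * pi) * std_normal_density t" for t
    using s by (simp add: c_def std_normal_density_def power2_eq_square)
  have t: "2 * pi * z * (c * t) = (z / \<sigma>) * t" for t
    using s by (simp add: c_def)
  have "(LINT w|lebesgue. cis (2 * pi * z * w) * complex_of_real (exp (- 2 * (pi * \<sigma> * w)\<^sup>2))) =
      c *\<^sub>R (LINT t|lebesgue. cis ((z / \<sigma>) * t) * complex_of_real (sqrt (2 * pi) * std_normal_density t))"
    by (subst lebesgue_integral_real_affine[where c=c and t=0]) (use c in \<open>simp_all add: e[simplified] t del: of_real_mult\<close>)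
  also have "(LINT t|lebesgue. cis ((z / \<sigma>) * t) * complex_of_real (sqrt (2 * pi) * std_normal_density t)) =
      (LINT t|lebesgue. of_real (sqrt (2 * pi)) * (std_normal_density t * cis ((z / \<sigma>) * t)))"
    by (intro Bochner_Integration.integral_cong) (auto simp: mult_ac)
  also have "\<dots> = of_real (sqrt (2 * pi)) * complex_of_real (exp (- (z / \<sigma>)\<^sup>2 / 2))"
    by (simp only: integral_mult_right_zero gaussian_fourier)
  also have "c *\<^sub>R \<dots> = complex_of_real (c * (sqrt (2 * pi) * exp (- (z / \<sigma>)\<^sup>2 / 2)))"
    by (simp add: scaleR_conv_of_real)
  also have "c * (sqrt (2 * pi) * exp (- (z / \<sigma>)\<^sup>2 / 2)) = std_normal_density (z / \<sigma>) / \<sigma>"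
  proof -
    have "sqrt (2 * pi) * sqrt (2 * pi) = 2 * pi" by simp
    then have "c * sqrt (2 * pi) = 1 / (sqrt (2 * pi) * \<sigma>)"
      using s by (simp add: c_def field_simps del: real_sqrt_mult_self)
    then have "(c * sqrt (2 * pi)) * exp (- (z / \<sigma>)\<^sup>2 / 2) = 1 / (sqrt (2 * pi) * \<sigma>) * exp (- (z / \<sigma>)\<^sup>2 / 2)"
      by (simp only:)
    then show ?thesis by (simp add: std_normal_density_def mult_ac)
  qed
  finally show ?thesis .
qed

lemma integrable_gaussian_hat:
  assumes s: "\<sigma> > 0"
  shows "integrable lebesgue (\<lambda>w. exp (- 2 * (pi * \<sigma> * w)\<^sup>2))"
proof -
  define c where "c = 2 * pi * \<sigma>"
  have c: "c \<noteq> 0" using s by (simp add: c_def)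
  have "integrable lebesgue (\<lambda>w. sqrt (2 * pi) * std_normal_density (0 + c * w))"
    using lebesgue_integrable_real_affine[OF integrable_gaussian c, of 0] by simp
  also have "(\<lambda>w. sqrt (2 * pi) * std_normal_density (0 + c * w)) = (\<lambda>w. exp (- 2 * (pi * \<sigma> * w)\<^sup>2))"
    by (auto simp: std_normal_density_def c_def power2_eq_square)
  finally show ?thesis .
qed

lemma bounded_integrable_L2:
  assumes "integrable lebesgue f" "\<And>x. cmod (f x) \<le> K"
  shows "f \<in> L2"
proof -
  have [measurable]: "f \<in> borel_measurable lebesgue" using assms by simp
  have "integrable lebesgue (\<lambda>x. (cmod (f x))\<^sup>2)"
  proof (rule Bochner_Integration.integrable_bound)
    show "integrable lebesgue (\<lambda>x. K * cmod (f x))" using assms by simp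
    show "AE x in lebesgue. norm ((cmod (f x))\<^sup>2) \<le> norm (K * cmod (f x))"
      using assms(2) order_trans[OF norm_ge_zero assms(2)]
      by (intro AE_I2) (auto simp: power2_eq_square intro!: mult_right_mono)
  qed measurable
  then show ?thesis using \<open>f \<in> borel_measurable lebesgue\<close> by (simp add: L2_def)
qed

text \<open>The convolution of \<open>h\<close> with the normal density of deviation
  \<open>\<sigma>\<close>, written as a mean over a standard normal \<open>t\<close>. With the scale
  inside \<open>h\<close> the weight does not depend on \<open>\<sigma>\<close>, which suits
  dominated convergence as \<open>\<sigma>\<close> tends to 0.\<close>

definition mollify :: "real \<Rightarrow> (real \<Rightarrow> complex) \<Rightarrow> real \<Rightarrow> complex" where
  "mollify \<sigma> h x = (LINT t|lebesgue. complex_of_real (std_normal_density t) * h (x - \<sigma> * t))"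

text \<open>For continuous \<open>h\<close> of compact support \<open>fourier_L1 h\<close> is
  bounded but possibly not integrable; the Gaussian factor makes the product integrable, and with it
  the inversion integral.\<close>

definition mollify_hat :: "real \<Rightarrow> (real \<Rightarrow> complex) \<Rightarrow> real \<Rightarrow> complex" where
  "mollify_hat \<sigma> h w = fourier_L1 h w * complex_of_real (exp (- 2 * (pi * \<sigma> * w)\<^sup>2))"

lemma fourier_L1_bound:
  assumes "integrable lebesgue h"
  shows "cmod (fourier_L1 h w) \<le> (LINT x|lebesgue. cmod (h x))"
proof -
  have "cmod (fourier_L1 h w) \<le> (LINT x|lebesgue. cmod (h x * cis (- 2 * pi * x * w)))"
    unfolding fourier_L1_def by (rule integral_norm_bound)
  then show ?thesis by (simp add: norm_mult)
qed

lemma fourier_L1_measurable: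
  assumes "integrable lebesgue h"
  shows "fourier_L1 h \<in> borel_measurable lebesgue"
proof -
  have [measurable]: "h \<in> borel_measurable lebesgue" using assms by simp
  have "(\<lambda>(w, t). h t * cis (- 2 * pi * t * w)) \<in> borel_measurable (lebesgue \<Otimes>\<^sub>M lebesgue)"
    unfolding case_prod_beta by measurable
  then show ?thesis unfolding fourier_L1_def[abs_def]
    using lebesgue.borel_measurable_lebesgue_integral by fastforce
qed

lemma mollify_kernel_measurable:
  fixes h :: "real \<Rightarrow> complex" and \<sigma> :: real
  assumes "continuous_on UNIV h"
  shows "(\<lambda>p. h (snd p - \<sigma> * fst p)) \<in> borel_measurable (lebesgue \<Otimes>\<^sub>M lebesgue)"
proof -
  have "(\<lambda>p::real \<times> real. snd p - \<sigma> * fst p) \<in> lebesgue \<Otimes>\<^sub>M lebesgue \<rightarrow>\<^sub>M (borel :: real measure)"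
    by measurable
  then show ?thesis using borel_measurable_continuous_onI[OF assms] by (rule measurable_compose)
qed

lemma integrable_reflect_shift:
  fixes h :: "real \<Rightarrow> complex"
  shows "integrable lebesgue h \<Longrightarrow> integrable lebesgue (\<lambda>x. h (x - a))"
  using integrable_lebesgue_affine[of h "- a"] by simp

text \<open>Licence for the exchanges of integrals that follow: by translation invariance the inner
  integral of the modulus is a constant multiple of the normal density.\<close>

lemma mollify_integrable_prod:
  assumes h: "Cc h"
  shows "integrable (lebesgue \<Otimes>\<^sub>M lebesgue) (\<lambda>(t, x). complex_of_real (std_normal_density t) * h (x - \<sigma> * t))"
proof (rule lebesgue_pair.Fubini_integrable)
  have c: "continuous_on UNIV h" using h by (simp add: Cc_def)
  have hi: "integrable lebesgue h" using h by (intro bcs_integrable Cc_bcs)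
  note [measurable] = mollify_kernel_measurable[OF c, of \<sigma>]
  have [measurable]: "std_normal_density \<in> borel_measurable lebesgue" by (simp add: measurable_completion)
  show "(\<lambda>(t, x). complex_of_real (std_normal_density t) * h (x - \<sigma> * t)) \<in> borel_measurable (lebesgue \<Otimes>\<^sub>M lebesgue)"
    unfolding case_prod_beta by measurable
  have "(LINT x|lebesgue. cmod (h (x - \<sigma> * t))) = (LINT x|lebesgue. cmod (h x))" for t
    using integral_lebesgue_shift[of "\<lambda>x. cmod (h x)" "- \<sigma> * t"] by simp
  then show "integrable lebesgue (\<lambda>t. LINT x|lebesgue. norm (case (t, x) of (t, x) \<Rightarrow> complex_of_real (std_normal_density t) * h (x - \<sigma> * t)))"
    using integrable_gaussian by (simp add: norm_mult)
  show "AE t in lebesgue. integrable lebesgue (\<lambda>x. case (t, x) of (t, x) \<Rightarrow> complex_of_real (std_normal_density t) * h (x - \<sigma> * t))"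
    using integrable_reflect_shift[OF hi] by simp
qed

lemma mollify_integrable:
  assumes h: "Cc h"
  shows "integrable lebesgue (mollify \<sigma> h)"
  using lebesgue_pair.integrable_snd[OF mollify_integrable_prod[OF h, of \<sigma>]]
  by (simp add: mollify_def[abs_def])

lemma mollify_bound:
  assumes h: "Cc h" and K: "\<And>x. cmod (h x) \<le> K"
  shows "cmod (mollify \<sigma> h x) \<le> K"
proof -
  have c: "continuous_on UNIV h" using h by (simp add: Cc_def)
  have "continuous_on UNIV (\<lambda>t. h (x - \<sigma> * t))"
    by (intro continuous_on_compose2[OF c] continuous_intros) auto
  then have [measurable]: "(\<lambda>t. h (x - \<sigma> * t)) \<in> borel_measurable lebesgue"
    by (rule continuous_borel_measurable_lebesgue)
  have "cmod (mollify \<sigma> h x) \<le> (LINT t|lebesgue. std_normal_density t * K)"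
    unfolding mollify_def
  proof (rule order_trans[OF integral_norm_bound], rule Bochner_Integration.integral_mono)
    show le: "cmod (std_normal_density t * h (x - \<sigma> * t)) \<le> std_normal_density t * K" for t
      using K by (auto simp: norm_mult intro!: mult_left_mono)
    show i: "integrable lebesgue (\<lambda>t. std_normal_density t * K)" using integrable_gaussian by simp
    have [measurable]: "std_normal_density \<in> borel_measurable lebesgue" by (simp add: measurable_completion)
    show "integrable lebesgue (\<lambda>t. cmod (std_normal_density t * h (x - \<sigma> * t)))"
    proof (rule Bochner_Integration.integrable_bound[OF i])
      show "AE t in lebesgue. norm (cmod (std_normal_density t * h (x - \<sigma> * t))) \<le> norm (std_normal_density t * K)"
        using le by (intro AE_I2) (smt (verit) norm_ge_zero real_norm_def)
    qed measurable
  qed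
  also have "\<dots> = K" by (simp add: integral_gaussian)
  finally show ?thesis .
qed

text \<open>Translating \<open>x\<close> by \<open>\<sigma> t\<close> separates the double integral
  into \<open>fourier_L1 h w\<close> and a Gaussian characteristic function.\<close>

lemma mollify_fourier:
  assumes h: "Cc h"
  shows "fourier_L1 (mollify \<sigma> h) w = mollify_hat \<sigma> h w"
proof -
  have c: "continuous_on UNIV h" using h by (simp add: Cc_def)
  have hi: "integrable lebesgue h" using h by (intro bcs_integrable Cc_bcs)
  let ?F = "\<lambda>t x. complex_of_real (std_normal_density t) * h (x - \<sigma> * t) * cis (- 2 * pi * x * w)"
  have int: "integrable (lebesgue \<Otimes>\<^sub>M lebesgue) (\<lambda>(t, x). ?F t x)"
  proof (rule Bochner_Integration.integrable_bound[OF mollify_integrable_prod[OF h, of \<sigma>]])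
    note [measurable] = mollify_kernel_measurable[OF c, of \<sigma>]
    have [measurable]: "std_normal_density \<in> borel_measurable lebesgue" by (simp add: measurable_completion)
    show "(\<lambda>(t, x). ?F t x) \<in> borel_measurable (lebesgue \<Otimes>\<^sub>M lebesgue)"
      unfolding case_prod_beta by measurable
  qed (auto simp: norm_mult)
  have "fourier_L1 (mollify \<sigma> h) w = (LINT x|lebesgue. LINT t|lebesgue. ?F t x)"
    unfolding fourier_L1_def mollify_def by simp
  also have "\<dots> = (LINT t|lebesgue. LINT x|lebesgue. ?F t x)"
    using lebesgue_pair.Fubini_integral[OF int] by simp
  also have "(\<lambda>t. LINT x|lebesgue. ?F t x) = (\<lambda>t. fourier_L1 h w * (std_normal_density t * cis ((- 2 * pi * \<sigma> * w) * t)))"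
  proof
    fix t
    have "(LINT x|lebesgue. ?F t x) = (LINT x|lebesgue. ?F t (x + \<sigma> * t))"
      by (rule integral_lebesgue_shift[symmetric])
    also have "(\<lambda>x. ?F t (x + \<sigma> * t)) = (\<lambda>x. (std_normal_density t * cis ((- 2 * pi * \<sigma> * w) * t)) * (h x * cis (- 2 * pi * x * w)))"
      by (rule ext) (simp add: algebra_simps cis_mult)
    finally show "(LINT x|lebesgue. ?F t x) = fourier_L1 h w * (std_normal_density t * cis ((- 2 * pi * \<sigma> * w) * t))"
      unfolding fourier_L1_def by simp
  qed
  also have "(LINT t|lebesgue. fourier_L1 h w * (std_normal_density t * cis ((- 2 * pi * \<sigma> * w) * t))) =
      fourier_L1 h w * complex_of_real (exp (- (- 2 * pi * \<sigma> * w)\<^sup>2 / 2))"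
    by (simp only: integral_mult_right_zero gaussian_fourier)
  also have "- (- 2 * pi * \<sigma> * w)\<^sup>2 / 2 = - 2 * (pi * \<sigma> * w)\<^sup>2" by (simp add: power2_eq_square)
  finally show ?thesis by (simp add: mollify_hat_def)
qed

lemma mollify_hat_integrable:
  assumes h: "Cc h" and s: "\<sigma> > 0"
  shows "integrable lebesgue (mollify_hat \<sigma> h)"
proof (rule Bochner_Integration.integrable_bound)
  have hi: "integrable lebesgue h" using h by (intro bcs_integrable Cc_bcs)
  note [measurable] = fourier_L1_measurable[OF hi]
  show "integrable lebesgue (\<lambda>w. (LINT x|lebesgue. cmod (h x)) * exp (- 2 * (pi * \<sigma> * w)\<^sup>2))"
    using integrable_gaussian_hat[OF s] by simp
  show "mollify_hat \<sigma> h \<in> borel_measurable lebesgue"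
    unfolding mollify_hat_def[abs_def] by measurable
  show "AE w in lebesgue. norm (mollify_hat \<sigma> h w) \<le> norm ((LINT x|lebesgue. cmod (h x)) * exp (- 2 * (pi * \<sigma> * w)\<^sup>2))"
    using fourier_L1_bound[OF hi] by (intro AE_I2) (auto simp: mollify_hat_def norm_mult intro!: mult_right_mono)
qed

text \<open>Inserting the integral for \<open>fourier_L1 h\<close> and exchanging the order leaves
  the Gaussian integral at \<open>x - y\<close>, which is the kernel of the convolution.\<close>

lemma mollify_inverse:
  assumes h: "Cc h" and s: "\<sigma> > 0"
  shows "mollify \<sigma> h x = fourier_L1 (mollify_hat \<sigma> h) (- x)"
proof -
  have hi: "integrable lebesgue h" using h by (intro bcs_integrable Cc_bcs)
  let ?E = "\<lambda>w. complex_of_real (exp (- 2 * (pi * \<sigma> * w)\<^sup>2))"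
  have E: "integrable lebesgue ?E" using integrable_gaussian_hat[OF s] by (rule integrable_of_real)
  have "fourier_L1 (mollify_hat \<sigma> h) (- x) =
      (LINT w|lebesgue. (LINT y|lebesgue. h y * cis (2 * pi * (x - y) * w)) * ?E w)"
    unfolding fourier_L1_def mollify_hat_def
  proof (intro Bochner_Integration.integral_cong refl)
    fix w
    have "(LINT y|lebesgue. h y * cis (- 2 * pi * y * w)) * ?E w * cis (- 2 * pi * w * - x) =
        (LINT y|lebesgue. h y * cis (- 2 * pi * y * w) * cis (- 2 * pi * w * - x)) * ?E w"
      by simp
    also have "(\<lambda>y. h y * cis (- 2 * pi * y * w) * cis (- 2 * pi * w * - x)) = (\<lambda>y. h y * cis (2 * pi * (x - y) * w))"
      by (rule ext) (simp add: mult.assoc cis_mult algebra_simps)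
    finally show "(LINT y|lebesgue. h y * cis (- 2 * pi * y * w)) * ?E w * cis (- 2 * pi * w * - x) =
        (LINT y|lebesgue. h y * cis (2 * pi * (x - y) * w)) * ?E w" .
  qed
  also have "\<dots> = (LINT y|lebesgue. h y * (LINT w|lebesgue. cis (2 * pi * (x - y) * w) * ?E w))"
    by (rule Fubini_kernel[OF hi E, symmetric])
      (auto simp: case_prod_beta intro!: borel_measurable_continuous_onI continuous_intros)
  also have "\<dots> = (LINT y|lebesgue. h y * complex_of_real (std_normal_density ((x - y) / \<sigma>) / \<sigma>))"
    by (simp only: gaussian_inverse[OF s])
  \<comment> \<open>Substitution \<open>y = x - \<sigma> t\<close>.\<close>
  also have "\<dots> = \<sigma> *\<^sub>R (LINT t|lebesgue. h (x - \<sigma> * t) * complex_of_real (std_normal_density t / \<sigma>))"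
    by (subst lebesgue_integral_real_affine[where c="- \<sigma>" and t=x]) (use s in simp_all)
  also have "\<dots> = (LINT t|lebesgue. \<sigma> *\<^sub>R (h (x - \<sigma> * t) * complex_of_real (std_normal_density t / \<sigma>)))"
    by (rule integral_scaleR_right[symmetric])
  also have "\<dots> = mollify \<sigma> h x"
    unfolding mollify_def using s by (intro Bochner_Integration.integral_cong) (auto simp: scaleR_conv_of_real)
  finally show ?thesis by simp
qed

lemma fourier_pair_mollify:
  assumes h: "Cc h" and s: "\<sigma> > 0"
  shows "fourier_pair (mollify \<sigma> h) (mollify_hat \<sigma> h)"
proof -
  obtain K where K: "\<And>x. cmod (h x) \<le> K" using Cc_bcs[OF h] by (rule bcsE) blast
  have hi: "integrable lebesgue h" using h by (intro bcs_integrable Cc_bcs)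
  have "cmod (mollify_hat \<sigma> h w) \<le> (LINT x|lebesgue. cmod (h x)) * 1" for w
    unfolding mollify_hat_def norm_mult using fourier_L1_bound[OF hi] by (intro mult_mono) auto
  note L2 = bounded_integrable_L2[OF mollify_hat_integrable[OF h s] this]
    bounded_integrable_L2[OF mollify_integrable[OF h] mollify_bound[OF h K]]
  show ?thesis
    unfolding fourier_pair_def
    by (intro conjI allI L2 mollify_integrable[OF h] mollify_hat_integrable[OF h s]
      mollify_inverse[OF h s] mollify_fourier[OF h, symmetric])
qed

text \<open>Continuity gives pointwise convergence; the bound \<open>B\<close> on the shifts keeps
  all supports inside one interval, where a constant dominates.\<close>

lemma continuous_shift_L1:
  assumes h: "Cc h" and lim: "a \<longlonglongrightarrow> 0" and bd: "\<And>k. \<bar>a k\<bar> \<le> B"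
  shows "(\<lambda>k::nat. LINT x|lebesgue. cmod (h (x - a k) - h x)) \<longlonglongrightarrow> 0"
proof -
  have c: "continuous_on UNIV h" using h by (simp add: Cc_def)
  obtain K R where K: "\<And>x. cmod (h x) \<le> K" and R: "\<And>x. \<bar>x\<bar> > R \<Longrightarrow> h x = 0"
    using Cc_bcs[OF h] by (rule bcsE) blast
  have cc: "continuous_on UNIV (\<lambda>x. cmod (h (x - a k) - h x))" for k
    by (intro continuous_intros continuous_on_compose2[OF c]) auto
  have "(\<lambda>k::nat. LINT x|lebesgue. cmod (h (x - a k) - h x)) \<longlonglongrightarrow> (LINT x|(lebesgue :: real measure). 0)"
  proof (rule integral_dominated_convergence[where w="\<lambda>x. (2 * K) * indicat_real {- (R + B)..R + B} x"])
    show "(\<lambda>x. cmod (h (x - a k) - h x)) \<in> borel_measurable lebesgue" for k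
      by (rule continuous_borel_measurable_lebesgue[OF cc])
    show "AE x in lebesgue. (\<lambda>k. cmod (h (x - a k) - h x)) \<longlonglongrightarrow> 0"
    proof (intro AE_I2)
      fix x :: real
      have "(\<lambda>k. x - a k) \<longlonglongrightarrow> x - 0" by (intro tendsto_intros lim)
      then have "(\<lambda>k. h (x - a k)) \<longlonglongrightarrow> h x"
        by (intro continuous_on_tendsto_compose[OF c]) auto
      then have "(\<lambda>k. cmod (h (x - a k) - h x)) \<longlonglongrightarrow> cmod (h x - h x)" by (intro tendsto_intros)
      then show "(\<lambda>k. cmod (h (x - a k) - h x)) \<longlonglongrightarrow> 0" by simp
    qed
    show "AE x in lebesgue. norm (cmod (h (x - a k) - h x)) \<le> (2 * K) * indicat_real {- (R + B)..R + B} x" for k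
    proof (intro AE_I2)
      fix x :: real
      show "norm (cmod (h (x - a k) - h x)) \<le> (2 * K) * indicat_real {- (R + B)..R + B} x"
      proof (cases "\<bar>x\<bar> \<le> R + B")
        case True
        then show ?thesis
          using norm_triangle_ineq4[of "h (x - a k)" "h x"] K[of x] K[of "x - a k"] by (auto simp: indicator_def)
      next
        case False
        then have "\<bar>x\<bar> > R" "\<bar>x - a k\<bar> > R" using bd[of k] by linarith+
        then show ?thesis using False R by (auto simp: indicator_def)
      qed
    qed
  qed (rule borel_measurable_const integrable_interval)+
  then show ?thesis by simp
qed

text \<open>\<open>h\<close> and its mollification are both bounded by \<open>K\<close>, so the
  squared error is at most \<open>2 K\<close> times the error. The L2 distance thus reduces to a
  Gaussian average of L1 moduli of continuity, to which Fubini applies.\<close>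

lemma mollify_dist:
  assumes h: "Cc h" and K: "\<And>x. cmod (h x) \<le> K"
  shows "(LINT x|lebesgue. (cmod (h x - mollify \<sigma> h x))\<^sup>2) \<le>
    2 * K * (LINT t|lebesgue. std_normal_density t * (LINT x|lebesgue. cmod (h (x - \<sigma> * t) - h x)))"
proof -
  have c: "continuous_on UNIV h" using h by (simp add: Cc_def)
  have hi: "integrable lebesgue h" using h by (intro bcs_integrable Cc_bcs)
  have [measurable]: "std_normal_density \<in> borel_measurable lebesgue" by (simp add: measurable_completion)
  have [measurable]: "h \<in> borel_measurable lebesgue" using hi by simp
  have K0: "K \<ge> 0" using K[of 0] norm_ge_zero[of "h 0"] by linarith
  let ?F = "\<lambda>t x. std_normal_density t * cmod (h (x - \<sigma> * t) - h x)"
  have int: "integrable (lebesgue \<Otimes>\<^sub>M lebesgue) (\<lambda>(t, x). ?F t x)"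
  proof -
    have "integrable (lebesgue \<Otimes>\<^sub>M lebesgue) (\<lambda>(t, x). complex_of_real (std_normal_density t) * h (x - 0 * t))"
      by (rule mollify_integrable_prod[OF h])
    from Bochner_Integration.integrable_diff[OF mollify_integrable_prod[OF h, of \<sigma>] this]
    have "integrable (lebesgue \<Otimes>\<^sub>M lebesgue) (\<lambda>(t, x). complex_of_real (std_normal_density t) * (h (x - \<sigma> * t) - h x))"
      unfolding case_prod_beta by (simp only: right_diff_distrib mult_zero_left diff_zero)
    from integrable_norm[OF this] show ?thesis by (simp add: case_prod_unfold norm_mult)
  qed
  have snd: "integrable lebesgue (\<lambda>x. LINT t|lebesgue. ?F t x)"
    using lebesgue_pair.integrable_snd[OF int] by simp
  have ct: "continuous_on UNIV (\<lambda>t. h (x - \<sigma> * t))" for x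
    by (intro continuous_on_compose2[OF c] continuous_intros) auto
  have m1 [measurable]: "(\<lambda>t. h (x - \<sigma> * t)) \<in> borel_measurable lebesgue" for x
    using ct by (rule continuous_borel_measurable_lebesgue)
  have i1: "integrable lebesgue (\<lambda>t. complex_of_real (std_normal_density t) * h (x - \<sigma> * t))" for x
  proof (rule Bochner_Integration.integrable_bound)
    show "integrable lebesgue (\<lambda>t. std_normal_density t * K)" using integrable_gaussian by simp
    show "AE t in lebesgue. norm (complex_of_real (std_normal_density t) * h (x - \<sigma> * t)) \<le> norm (std_normal_density t * K)"
      using K K0 by (intro AE_I2) (auto simp: norm_mult intro!: mult_left_mono)
  qed measurable
  have i2: "integrable lebesgue (\<lambda>t. complex_of_real (std_normal_density t) * h x)" for x
    using integrable_gaussian by (intro integrable_mult_left integrable_of_real)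
  have pt: "cmod (h x - mollify \<sigma> h x) \<le> (LINT t|lebesgue. ?F t x)" for x
  proof -
    have "h x = (LINT t|lebesgue. complex_of_real (std_normal_density t) * h x)"
      by (simp add: integral_gaussian)
    then have "mollify \<sigma> h x - h x = (LINT t|lebesgue. complex_of_real (std_normal_density t) * h (x - \<sigma> * t)
        - complex_of_real (std_normal_density t) * h x)"
      unfolding mollify_def using Bochner_Integration.integral_diff[OF i1[of x] i2[of x]] by simp
    also have "\<dots> = (LINT t|lebesgue. complex_of_real (std_normal_density t) * (h (x - \<sigma> * t) - h x))"
      by (simp add: right_diff_distrib)
    also have "cmod \<dots> \<le> (LINT t|lebesgue. cmod (complex_of_real (std_normal_density t) * (h (x - \<sigma> * t) - h x)))"
      by (rule integral_norm_bound)
    finally show ?thesis by (simp add: norm_mult norm_minus_commute)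
  qed
  have "(LINT x|lebesgue. (cmod (h x - mollify \<sigma> h x))\<^sup>2) \<le> (LINT x|lebesgue. (2 * K) * (LINT t|lebesgue. ?F t x))"
  proof (rule Bochner_Integration.integral_mono)
    have "h \<in> L2" using h by (intro bcs_L2 Cc_bcs)
    moreover have "mollify \<sigma> h \<in> L2"
      by (rule bounded_integrable_L2[OF mollify_integrable[OF h] mollify_bound[OF h K]])
    ultimately show "integrable lebesgue (\<lambda>x. (cmod (h x - mollify \<sigma> h x))\<^sup>2)"
      by (intro L2_integrable L2_diff)
    show "integrable lebesgue (\<lambda>x. (2 * K) * (LINT t|lebesgue. ?F t x))" using snd by simp
    fix x
    have "cmod (h x - mollify \<sigma> h x) \<le> 2 * K"
      using norm_triangle_ineq4[of "h x" "mollify \<sigma> h x"] K[of x] mollify_bound[OF h K, of \<sigma> x] by linarith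
    then have "cmod (h x - mollify \<sigma> h x) * cmod (h x - mollify \<sigma> h x) \<le> (2 * K) * (LINT t|lebesgue. ?F t x)"
      using pt[of x] K0 by (intro mult_mono) auto
    then show "(cmod (h x - mollify \<sigma> h x))\<^sup>2 \<le> (2 * K) * (LINT t|lebesgue. ?F t x)"
      by (simp add: power2_eq_square)
  qed
  also have "\<dots> = 2 * K * (LINT x|lebesgue. LINT t|lebesgue. ?F t x)" by simp
  also have "(LINT x|lebesgue. LINT t|lebesgue. ?F t x) = (LINT t|lebesgue. LINT x|lebesgue. ?F t x)"
    using lebesgue_pair.Fubini_integral[OF int] by simp
  finally show ?thesis by simp
qed

text \<open>The L1 modulus \<open>\<Phi>\<close> of \<open>h\<close> tends to 0 at 0 and never
  exceeds \<open>2 N\<close>, so its Gaussian averages at shrinking scales tend to 0.\<close>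

lemma mollify_dense:
  assumes h: "Cc h" and e: "\<epsilon> > 0"
  shows "\<exists>\<sigma>>0. norm_L2 (\<lambda>x. h x - mollify \<sigma> h x) < \<epsilon>"
proof -
  have hi: "integrable lebesgue h" using h by (intro bcs_integrable Cc_bcs)
  obtain K where K: "\<And>x. cmod (h x) \<le> K" using Cc_bcs[OF h] by (rule bcsE) blast
  define \<sigma> where "\<sigma> k = 1 / real (Suc k)" for k
  define \<Phi> where "\<Phi> s = (LINT x|lebesgue. cmod (h (x - s) - h x))" for s
  define N where "N = (LINT x|lebesgue. cmod (h x))"
  have \<Phi>N: "\<bar>\<Phi> s\<bar> \<le> 2 * N" for s
  proof -
    have i: "integrable lebesgue (\<lambda>x. cmod (h (x - s)))" using integrable_reflect_shift[OF hi] by simp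
    have "\<Phi> s \<le> (LINT x|lebesgue. cmod (h (x - s)) + cmod (h x))"
      unfolding \<Phi>_def using hi integrable_reflect_shift[OF hi, of s]
      by (intro Bochner_Integration.integral_mono) (auto intro: norm_triangle_ineq4)
    also have "\<dots> = (LINT x|lebesgue. cmod (h (x - s))) + N"
      unfolding N_def by (rule Bochner_Integration.integral_add[OF i]) (use hi in simp)
    also have "(LINT x|lebesgue. cmod (h (x - s))) = N"
      unfolding N_def using integral_lebesgue_shift[of "\<lambda>x. cmod (h x)" "- s"] by simp
    finally have "\<Phi> s \<le> 2 * N" by simp
    moreover have "\<Phi> s \<ge> 0" unfolding \<Phi>_def by simp
    ultimately show ?thesis by simp
  qed
  have \<sigma>: "\<sigma> k > 0" "\<sigma> k \<le> 1" for k by (auto simp: \<sigma>_def)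
  have lim\<sigma>: "\<sigma> \<longlonglongrightarrow> 0" unfolding \<sigma>_def by (rule LIMSEQ_Suc[OF lim_1_over_n])
  have lim\<Phi>: "(\<lambda>k. \<Phi> (\<sigma> k * t)) \<longlonglongrightarrow> 0" for t
    unfolding \<Phi>_def
  proof (rule continuous_shift_L1[OF h])
    show "(\<lambda>k. \<sigma> k * t) \<longlonglongrightarrow> 0" using tendsto_mult_left_zero[OF lim\<sigma>] by blast
    show "\<bar>\<sigma> k * t\<bar> \<le> \<bar>t\<bar>" for k
      using \<sigma>[of k] mult_right_mono[of "\<sigma> k" 1 "\<bar>t\<bar>"] by (simp add: abs_mult)
  qed
  have [measurable]: "std_normal_density \<in> borel_measurable lebesgue" by (simp add: measurable_completion)
  have "h \<in> borel_measurable borel" using h by (auto simp: Cc_def intro: borel_measurable_continuous_onI)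
  then have [measurable]: "h \<in> borel_measurable borel" .
  have [measurable]: "(\<lambda>t. \<Phi> (\<sigma> k * t)) \<in> borel_measurable lebesgue" for k
  proof -
    have "(\<lambda>(t, x). cmod (h (x - \<sigma> k * t) - h x)) \<in> borel_measurable (lebesgue \<Otimes>\<^sub>M lebesgue)"
      unfolding case_prod_beta by measurable
    then show ?thesis unfolding \<Phi>_def
      using lebesgue.borel_measurable_lebesgue_integral by fastforce
  qed
  have "(\<lambda>k. LINT t|lebesgue. std_normal_density t * \<Phi> (\<sigma> k * t)) \<longlonglongrightarrow> (LINT t|(lebesgue :: real measure). 0)"
  proof (rule integral_dominated_convergence[where w="\<lambda>t. std_normal_density t * (2 * N)"])
    show "AE t in lebesgue. (\<lambda>k. std_normal_density t * \<Phi> (\<sigma> k * t)) \<longlonglongrightarrow> 0"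
      using lim\<Phi> by (intro AE_I2 tendsto_mult_right_zero)
    show "AE t in lebesgue. norm (std_normal_density t * \<Phi> (\<sigma> k * t)) \<le> std_normal_density t * (2 * N)" for k
      using \<Phi>N by (intro AE_I2) (auto simp: abs_mult intro!: mult_left_mono)
    show "integrable lebesgue (\<lambda>t. std_normal_density t * (2 * N))" using integrable_gaussian by simp
  qed measurable
  then have "(\<lambda>k. 2 * K * (LINT t|lebesgue. std_normal_density t * \<Phi> (\<sigma> k * t))) \<longlonglongrightarrow> 0"
    by (intro tendsto_mult_right_zero) simp
  then have "(\<lambda>k. LINT x|lebesgue. (cmod (h x - mollify (\<sigma> k) h x))\<^sup>2) \<longlonglongrightarrow> 0"
    by (rule Lim_null_comparison[rotated])
      (use mollify_dist[OF h K] in \<open>simp add: \<Phi>_def\<close>)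
  then have "\<exists>k. norm_L2 (\<lambda>x. h x - mollify (\<sigma> k) h x) < \<epsilon>" using e by (rule norm_L2_tendsto_zeroI)
  then show ?thesis using \<sigma> by blast
qed

section \<open>Density of Fourier pairs and transfer of tightness\<close>

lemma fourier_pair_dense_left:
  assumes f: "f \<in> L2" and e: "\<epsilon> > 0"
  shows "\<exists>u v. fourier_pair u v \<and> norm_L2 (\<lambda>x. f x - u x) < \<epsilon>"
proof -
  obtain h where h: "Cc h" "norm_L2 (\<lambda>x. f x - h x) < \<epsilon> / 2" using dense_Cc[OF f, of "\<epsilon> / 2"] e by auto
  obtain \<sigma> where s: "\<sigma> > 0" "norm_L2 (\<lambda>x. h x - mollify \<sigma> h x) < \<epsilon> / 2"
    using mollify_dense[OF h(1), of "\<epsilon> / 2"] e by auto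
  have g: "fourier_pair (mollify \<sigma> h) (mollify_hat \<sigma> h)" by (rule fourier_pair_mollify[OF h(1) s(1)])
  have "norm_L2 (\<lambda>x. f x - mollify \<sigma> h x) \<le> norm_L2 (\<lambda>x. f x - h x) + norm_L2 (\<lambda>x. h x - mollify \<sigma> h x)"
    using f h(1) fourier_pair_L2[OF g] by (intro norm_L2_triangle_diff) (auto intro: bcs_L2 Cc_bcs)
  then show ?thesis using g h s by (intro exI conjI) auto
qed

lemma fourier_pair_dense_right:
  assumes f: "f \<in> L2" and e: "\<epsilon> > 0"
  shows "\<exists>u v. fourier_pair u v \<and> norm_L2 (\<lambda>x. f x - v x) < \<epsilon>"
proof -
  obtain u v where uv: "fourier_pair u v" "norm_L2 (\<lambda>x. cnj (f x) - u x) < \<epsilon>"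
    using fourier_pair_dense_left[OF L2_cnj[OF f] e] by blast
  have "norm_L2 (\<lambda>x. f x - cnj (u x)) = norm_L2 (\<lambda>x. cnj (f x) - u x)"
    by (subst norm_L2_cnj[symmetric]) simp
  then show ?thesis using fourier_pair_cnj[OF uv(1)] uv(2) by (intro exI[of _ "\<lambda>x. cnj (v x)"] exI[of _ "\<lambda>x. cnj (u x)"]) simp
qed

text \<open>On a Fourier pair the frame identity for \<open>f\<close> against \<open>e\<close> and
  the one for \<open>g\<close> against \<open>eh\<close> have equal terms and equal norms. First and
  second components are each dense, so \<open>tight_frame_dense\<close> gives either
  direction.\<close>

lemma tight_frame_fourier:
  fixes e eh :: "'i::countable \<Rightarrow> real \<Rightarrow> complex"
  assumes e: "\<And>i. e i \<in> L2" and eh: "\<And>i. eh i \<in> L2"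
    and eq: "\<And>f g i. fourier_pair f g \<Longrightarrow> inner_L2 f (e i) = inner_L2 g (eh i)"
  shows "tight_frame A e \<longleftrightarrow> tight_frame A eh"
proof
  assume t: "tight_frame A e"
  show "tight_frame A eh"
  proof (rule tight_frame_dense[where D="{g. \<exists>f. fourier_pair f g}"])
    show "A > 0" using t by (simp add: tight_frame_def)
    show "\<exists>h. h \<in> {g. \<exists>f. fourier_pair f g} \<and> h \<in> L2 \<and> norm_L2 (\<lambda>x. f x - h x) < \<epsilon>" if "f \<in> L2" "\<epsilon> > 0" for f \<epsilon>
      using fourier_pair_dense_right[OF that] fourier_pair_L2 by blast
    fix g assume "g \<in> {g. \<exists>f. fourier_pair f g}"
    then obtain f where f: "fourier_pair f g" by blast
    show "((\<lambda>i. (cmod (inner_L2 g (eh i)))\<^sup>2) has_sum A * (norm_L2 g)\<^sup>2) UNIV"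
      using t fourier_pair_L2(1)[OF f] unfolding tight_frame_def eq[OF f, symmetric] fourier_pair_norm[OF f, symmetric] by blast
  qed (rule eh)
next
  assume t: "tight_frame A eh"
  show "tight_frame A e"
  proof (rule tight_frame_dense[where D="{f. \<exists>g. fourier_pair f g}"])
    show "A > 0" using t by (simp add: tight_frame_def)
    show "\<exists>h. h \<in> {f. \<exists>g. fourier_pair f g} \<and> h \<in> L2 \<and> norm_L2 (\<lambda>x. f x - h x) < \<epsilon>" if "f \<in> L2" "\<epsilon> > 0" for f \<epsilon>
      using fourier_pair_dense_left[OF that] fourier_pair_L2 by blast
    fix f assume "f \<in> {f. \<exists>g. fourier_pair f g}"
    then obtain g where f: "fourier_pair f g" by blast
    show "((\<lambda>i. (cmod (inner_L2 f (e i)))\<^sup>2) has_sum A * (norm_L2 f)\<^sup>2) UNIV"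
      using t fourier_pair_L2(2)[OF f] unfolding tight_frame_def eq[OF f] fourier_pair_norm[OF f] by blast
  qed (rule e)
qed

section \<open>Parseval for Fourier series and periodization\<close>

lemma inner_sum_r:
  assumes "\<And>i. i \<in> I \<Longrightarrow> e i \<in> L2" "h \<in> L2"
  shows "inner_L2 h (\<lambda>x. \<Sum>i\<in>I. e i x) = (\<Sum>i\<in>I. inner_L2 h (e i))"
  by (subst (1 2) inner_cnj[symmetric]) (simp add: inner_sum_l assms)

text \<open>Stated for arbitrary coefficients: the choice \<open>c i = inner_L2 f (e i)\<close>
  gives Bessel's inequality and the error of the partial sum, while any other choice only adds the
  last sum. It serves Parseval here and completeness in
  \<open>parseval_orthonormal_iff\<close>.\<close>

lemma orthonormal_dist:
  assumes e: "\<And>i. e i \<in> L2" and on: "\<And>i j. inner_L2 (e i) (e j) = (if i = j then 1 else 0)"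
    and f: "f \<in> L2" and I: "finite I"
  shows "(norm_L2 (\<lambda>x. f x - (\<Sum>i\<in>I. c i * e i x)))\<^sup>2 =
    (norm_L2 f)\<^sup>2 - (\<Sum>i\<in>I. (cmod (inner_L2 f (e i)))\<^sup>2) + (\<Sum>i\<in>I. (cmod (inner_L2 f (e i) - c i))\<^sup>2)"
proof -
  define p where "p = (\<lambda>x. \<Sum>i\<in>I. c i * e i x)"
  have ce: "(\<lambda>x. c i * e i x) \<in> L2" for i using e by (rule L2_scale)
  have p: "p \<in> L2" unfolding p_def by (intro L2_sum ce)
  have fp: "inner_L2 f p = (\<Sum>i\<in>I. cnj (c i) * inner_L2 f (e i))"
    unfolding p_def by (subst inner_sum_r[OF ce f]) (simp add: inner_scale_r)
  have ep: "inner_L2 (e i) p = cnj (c i)" if "i \<in> I" for i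
  proof -
    have "inner_L2 (e i) p = (\<Sum>j\<in>I. cnj (c j) * inner_L2 (e i) (e j))"
      unfolding p_def by (subst inner_sum_r[OF ce e]) (simp add: inner_scale_r)
    also have "\<dots> = cnj (c i)" using that I by (simp add: on if_distrib sum.delta' cong: if_cong)
    finally show ?thesis .
  qed
  have pp: "inner_L2 p p = (\<Sum>i\<in>I. c i * cnj (c i))"
    by (subst p_def, subst inner_sum_l[OF ce p]) (simp add: inner_scale_l ep)
  have "complex_of_real ((norm_L2 (\<lambda>x. f x - p x))\<^sup>2) = inner_L2 (\<lambda>x. f x - p x) (\<lambda>x. f x - p x)"
    by (simp only: inner_self)
  also have "\<dots> = inner_L2 f f - inner_L2 f p - cnj (inner_L2 f p) + inner_L2 p p"
    unfolding inner_diff_l[OF f p L2_diff[OF f p]] inner_diff_r[OF f p f] inner_diff_r[OF f p p] inner_cnj by simp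
  also have "\<dots> = inner_L2 f f - (\<Sum>i\<in>I. inner_L2 f (e i) * cnj (inner_L2 f (e i)))
     + (\<Sum>i\<in>I. (inner_L2 f (e i) - c i) * cnj (inner_L2 f (e i) - c i))"
    unfolding fp pp by (simp add: algebra_simps sum.distrib sum_subtractf)
  also have "\<dots> = complex_of_real ((norm_L2 f)\<^sup>2 - (\<Sum>i\<in>I. (cmod (inner_L2 f (e i)))\<^sup>2) + (\<Sum>i\<in>I. (cmod (inner_L2 f (e i) - c i))\<^sup>2))"
    by (simp add: inner_self complex_norm_square[symmetric] del: complex_cnj_diff)
  finally show ?thesis unfolding p_def of_real_eq_iff .
qed

text \<open>No combination over \<open>I\<close> beats the one with the Fourier coefficients, so an
  error below \<open>sqrt \<delta>\<close> for some coefficients leaves less than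
  \<open>\<delta>\<close> missing in the Bessel sum.\<close>

lemma orthonormal_parseval:
  assumes e: "\<And>i. e i \<in> L2" and on: "\<And>i j. inner_L2 (e i) (e j) = (if i = j then 1 else 0)"
    and f: "f \<in> L2"
    and dense: "\<And>\<epsilon>. \<epsilon> > 0 \<Longrightarrow> \<exists>I c. finite I \<and> norm_L2 (\<lambda>x. f x - (\<Sum>i\<in>I. c i * e i x)) < \<epsilon>"
  shows "((\<lambda>i. (cmod (inner_L2 f (e i)))\<^sup>2) has_sum (norm_L2 f)\<^sup>2) UNIV"
proof (rule has_sum_nonnegI)
  fix I :: "'a set" assume I: "finite I"
  have "(norm_L2 (\<lambda>x. f x - (\<Sum>i\<in>I. inner_L2 f (e i) * e i x)))\<^sup>2 =
    (norm_L2 f)\<^sup>2 - (\<Sum>i\<in>I. (cmod (inner_L2 f (e i)))\<^sup>2)"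
    using orthonormal_dist[OF e on f I, of "\<lambda>i. inner_L2 f (e i)"] by simp
  then show "(\<Sum>i\<in>I. (cmod (inner_L2 f (e i)))\<^sup>2) \<le> (norm_L2 f)\<^sup>2"
    using zero_le_power2[of "norm_L2 (\<lambda>x. f x - (\<Sum>i\<in>I. inner_L2 f (e i) * e i x))"] by linarith
next
  fix \<delta> :: real assume d: "\<delta> > 0"
  then obtain I c where I: "finite I" "norm_L2 (\<lambda>x. f x - (\<Sum>i\<in>I. c i * e i x)) < sqrt \<delta>"
    using dense[of "sqrt \<delta>"] by auto
  then have "(norm_L2 (\<lambda>x. f x - (\<Sum>i\<in>I. c i * e i x)))\<^sup>2 \<le> (sqrt \<delta>)\<^sup>2"
    by (intro power_mono) (auto simp: norm_L2_nonneg)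
  moreover have "(\<Sum>i\<in>I. (cmod (inner_L2 f (e i) - c i))\<^sup>2) \<ge> 0" by (intro sum_nonneg) auto
  ultimately have "(norm_L2 f)\<^sup>2 - \<delta> \<le> (\<Sum>i\<in>I. (cmod (inner_L2 f (e i)))\<^sup>2)"
    using d by (simp add: orthonormal_dist[OF e on f I(1)])
  then show "\<exists>I. finite I \<and> (norm_L2 f)\<^sup>2 - \<delta> \<le> (\<Sum>i\<in>I. (cmod (inner_L2 f (e i)))\<^sup>2)"
    using I(1) by blast
qed simp

section \<open>Trigonometric polynomials\<close>

inductive trig :: "(real \<Rightarrow> complex) \<Rightarrow> bool" where
  trig_cis: "trig (\<lambda>x. c * cis (of_int j * x))"
| trig_add: "trig f \<Longrightarrow> trig g \<Longrightarrow> trig (\<lambda>x. f x + g x)"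

lemma trig_const: "trig (\<lambda>x. c)"
  using trig_cis[of c 0] by simp

lemma trig_mult_cis: "trig g \<Longrightarrow> trig (\<lambda>x. c * cis (of_int j * x) * g x)"
proof (induction rule: trig.induct)
  case (trig_cis d k)
  have "(\<lambda>x. c * cis (of_int j * x) * (d * cis (of_int k * x))) = (\<lambda>x. (c * d) * cis (of_int (j + k) * x))"
    by (rule ext) (simp add: cis_mult distrib_right flip: mult.assoc cis_mult)
  then show ?case using trig.trig_cis by metis
next
  case (trig_add f g)
  then show ?case using trig.trig_add[OF trig_add.IH] by (simp add: distrib_left)
qed

lemma trig_mult: "trig f \<Longrightarrow> trig g \<Longrightarrow> trig (\<lambda>x. f x * g x)"
proof (induction rule: trig.induct)
  case (trig_cis c j)
  then show ?case by (rule trig_mult_cis)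
next
  case (trig_add f h)
  then show ?case using trig.trig_add[OF trig_add.IH(1) trig_add.IH(2)] by (simp add: distrib_right)
qed

text \<open>A real linear functional of the plane becomes on the circle a combination of cosine and
  sine, hence of \<open>cis x\<close> and \<open>cis (- x)\<close>; the other cases are closure
  properties of \<open>trig\<close>.\<close>

lemma trig_real_polynomial:
  fixes r :: "complex \<Rightarrow> real"
  assumes "real_polynomial_function r"
  shows "trig (\<lambda>x. complex_of_real (r (cis x)))"
  using assms
proof induction
  case (linear f)
  then interpret bounded_linear f .
  have "f (cis x) = cos x * f 1 + sin x * f \<i>" for x
  proof -
    have "cis x = cos x *\<^sub>R 1 + sin x *\<^sub>R \<i>" by (simp add: complex_eq_iff)
    then show ?thesis by (simp add: add scaleR)
  qed
  then have "complex_of_real (f (cis x)) = of_real (cos x) * of_real (f 1) + of_real (sin x) * of_real (f \<i>)" for x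
    by simp
  moreover have "complex_of_real (cos x) = (cis x + cis (- x)) / 2" "complex_of_real (sin x) = (cis x - cis (- x)) * (- \<i> / 2)" for x
    by (simp_all add: complex_eq_iff)
  ultimately have "complex_of_real (f (cis x)) = (cis x + cis (- x)) / 2 * of_real (f 1) + (cis x - cis (- x)) * (- \<i> / 2) * of_real (f \<i>)" for x
    by (simp only:)
  then have "(\<lambda>x. complex_of_real (f (cis x))) = (\<lambda>x. (of_real (f 1) / 2 + of_real (f \<i>) * (- \<i> / 2)) * cis (of_int 1 * x)
     + (of_real (f 1) / 2 - of_real (f \<i>) * (- \<i> / 2)) * cis (of_int (-1) * x))"
    by (intro ext) (simp add: field_simps)
  then show ?case by (simp only:) (rule trig_add[OF trig_cis trig_cis])
next
  case (const c)
  then show ?case by (rule trig_const)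
next
  case (add f g)
  then show ?case using trig_add[OF add.IH] by simp
next
  case (mult f g)
  then show ?case using trig_mult[OF mult.IH] by simp
qed

lemma trig_polynomial:
  fixes g :: "complex \<Rightarrow> complex"
  assumes "polynomial_function g"
  shows "trig (\<lambda>x. g (cis x))"
proof -
  have "real_polynomial_function (Re \<circ> g)" "real_polynomial_function (Im \<circ> g)"
    using assms bounded_linear_Re bounded_linear_Im unfolding polynomial_function_def by blast+
  from trig_real_polynomial[OF this(1)] trig_mult[OF trig_const[of "\<i>"] trig_real_polynomial[OF this(2)]]
  have "trig (\<lambda>x. complex_of_real ((Re \<circ> g) (cis x)) + \<i> * complex_of_real ((Im \<circ> g) (cis x)))"
    by (rule trig_add)
  also have "(\<lambda>x. complex_of_real ((Re \<circ> g) (cis x)) + \<i> * complex_of_real ((Im \<circ> g) (cis x))) = (\<lambda>x. g (cis x))"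
    by (rule ext) (simp add: complex_eq_iff)
  finally show ?thesis .
qed

lemma trig_repr:
  assumes "trig f"
  shows "\<exists>I c. finite I \<and> (\<forall>x. f x = (\<Sum>j\<in>I. c j * cis (of_int j * x)))"
  using assms
proof induction
  case (trig_cis c j)
  show ?case by (intro exI[of _ "{j}"] exI[of _ "\<lambda>_. c"]) simp
next
  case (trig_add f g)
  then obtain I c J d where I: "finite I" "\<And>x. f x = (\<Sum>j\<in>I. c j * cis (of_int j * x))"
    and J: "finite J" "\<And>x. g x = (\<Sum>j\<in>J. d j * cis (of_int j * x))" by blast
  have "f x + g x = (\<Sum>j\<in>I \<union> J. ((if j \<in> I then c j else 0) + (if j \<in> J then d j else 0)) * cis (of_int j * x))" for x
  proof -
    have "f x = (\<Sum>j\<in>I \<union> J. (if j \<in> I then c j else 0) * cis (of_int j * x))"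
      unfolding I(2) using I(1) J(1) by (intro sum.mono_neutral_cong_left) auto
    moreover have "g x = (\<Sum>j\<in>I \<union> J. (if j \<in> J then d j else 0) * cis (of_int j * x))"
      unfolding J(2) using I(1) J(1) by (intro sum.mono_neutral_cong_left) auto
    ultimately show ?thesis by (simp add: distrib_right sum.distrib)
  qed
  then show ?case using I(1) J(1) by (intro exI[of _ "I \<union> J"] exI) auto
qed

text \<open>A loop factors continuously through the unit circle, where Stone-Weierstrass supplies a
  polynomial; restricted to the circle it is a trigonometric polynomial. The range excludes 1
  because \<open>Arg2pi\<close> has values in \<open>[0, 2 pi)\<close>.\<close>

lemma trig_uniform_approx:
  fixes p :: "real \<Rightarrow> complex"
  assumes p: "continuous_on {0..1} p" "p 0 = p 1" and e: "\<epsilon> > 0"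
  shows "\<exists>q. trig q \<and> (\<forall>s\<in>{0..<1}. cmod (p s - q (2 * pi * s)) < \<epsilon>)"
proof -
  \<comment> \<open>The trivial homotopy serves to extract the continuity, across the cut of the
    argument, of \<open>p\<close> composed with the normalised argument.\<close>
  have "homotopic_loops UNIV p p"
    using p by (simp add: homotopic_loops_refl path_def pathstart_def pathfinish_def)
  from homotopic_loops_imp_homotopic_circlemaps[OF this]
  have "continuous_on (sphere 0 1) (p \<circ> (\<lambda>z. (Arg2pi z / (2 * pi))))"
    using homotopic_with_imp_continuous by blast
  from Stone_Weierstrass_polynomial_function[OF compact_sphere this e]
  obtain g where g: "polynomial_function g"
    "\<And>z. z \<in> sphere 0 1 \<Longrightarrow> cmod ((p \<circ> (\<lambda>z. (Arg2pi z / (2 * pi)))) z - g z) < \<epsilon>" by blast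
  have "cmod (p s - g (cis (2 * pi * s))) < \<epsilon>" if s: "s \<in> {0..<1}" for s
  proof -
    have "Arg2pi (cis (2 * pi * s)) = 2 * pi * s"
      by (rule Arg2pi_unique[of 1]) (use s in \<open>auto simp: cis_conv_exp\<close>)
    then show ?thesis using g(2)[of "cis (2 * pi * s)"] by simp
  qed
  then show ?thesis using trig_polynomial[OF g(1)] by blast
qed

section \<open>Fourier series on one period\<close>

definition fexp :: "real \<Rightarrow> int \<Rightarrow> real \<Rightarrow> complex" where
  "fexp T j w = of_real (indicat_real {0..<T} w / sqrt T) * cis (2 * pi * of_int j * w / T)"

lemma fexp_bcs: assumes "T > 0" shows "bcs (fexp T j)"
proof -
  have "(\<lambda>w. indicat_real {0..<T} w) \<in> borel_measurable lebesgue" by (simp add: measurable_completion)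
  then have "fexp T j \<in> borel_measurable lebesgue"
    unfolding fexp_def[abs_def] by measurable
  moreover have "cmod (fexp T j x) \<le> 1 / sqrt T" for x
    using assms by (auto simp: fexp_def norm_mult norm_divide indicator_def)
  moreover have "fexp T j x = 0" if "\<bar>x\<bar> > T" for x using that by (auto simp: fexp_def indicator_def)
  ultimately show ?thesis unfolding bcs_def by blast
qed

lemma integral_cis_period:
  assumes T: "T > 0"
  shows "(LINT w|lebesgue. of_real (indicat_real {0..<T} w) * cis (2 * pi * of_int m * w / T)) = (if m = 0 then of_real T else 0)"
proof -
  let ?c = "\<lambda>w::real. cis (2 * pi * of_int m * w / T)"
  have ct: "continuous_on UNIV ?c" using T by (intro continuous_intros) auto
  have mm: "(\<lambda>w. indicat_real {0..T} w *\<^sub>R ?c w) \<in> borel_measurable lborel"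
    using borel_measurable_continuous_onI[OF ct] by simp
  \<comment> \<open>The fundamental theorem of calculus wants the closed interval; the extra
    endpoint has measure 0.\<close>
  have "AE w in lborel. w \<noteq> T" by (rule AE_lborel_singleton)
  then have ae: "AE w in lebesgue. w \<noteq> T" by (rule AE_completion)
  have "(LINT w|lebesgue. of_real (indicat_real {0..<T} w) * ?c w) = (LINT w|lebesgue. indicat_real {0..T} w *\<^sub>R ?c w)"
  proof (rule integral_cong_AE)
    show "(\<lambda>w. of_real (indicat_real {0..<T} w) * ?c w) \<in> borel_measurable lebesgue"
      using borel_measurable_continuous_onI[OF ct] by (intro measurable_completion) simp
    show "(\<lambda>w. indicat_real {0..T} w *\<^sub>R ?c w) \<in> borel_measurable lebesgue"
      using mm by (rule measurable_completion)
    show "AE w in lebesgue. of_real (indicat_real {0..<T} w) * ?c w = indicat_real {0..T} w *\<^sub>R ?c w"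
      using ae by eventually_elim (auto simp: indicator_def)
  qed
  also have "\<dots> = (LINT w|lborel. indicat_real {0..T} w *\<^sub>R ?c w)"
    using mm by (rule integral_completion)
  also have "\<dots> = (if m = 0 then of_real T else 0)"
  proof (cases "m = 0")
    case True
    then show ?thesis using T by (simp add: scaleR_conv_of_real)
  next
    case False
    let ?a = "2 * pi * of_int m / T :: real"
    have a: "?a \<noteq> 0" using False T by simp
    have "(LINT w|lborel. indicat_real {0..T} w *\<^sub>R ?c w) = cis (?a * T) / (\<i> * of_real ?a) - cis (?a * 0) / (\<i> * of_real ?a)"
    proof (rule integral_FTC_Icc)
      show "continuous_on {0..T} ?c" using ct continuous_on_subset by blast
      fix w
      have "((\<lambda>z. exp (\<i> * of_real ?a * z) / (\<i> * of_real ?a)) has_field_derivative exp (\<i> * of_real ?a * of_real w)) (at (of_real w))"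
        using a by (auto intro!: derivative_eq_intros)
      then have "((\<lambda>w. exp (\<i> * of_real ?a * of_real w) / (\<i> * of_real ?a)) has_vector_derivative exp (\<i> * of_real ?a * of_real w)) (at w within {0..T})"
        by (rule has_vector_derivative_real_field)
      then show "((\<lambda>w. cis (?a * w) / (\<i> * of_real ?a)) has_vector_derivative ?c w) (at w within {0..T})"
        by (simp add: cis_conv_exp mult_ac)
    qed (use T in simp)
    also have "?a * T = 2 * pi * of_int m" using T by simp
    also have "cis (2 * pi * of_int m) = 1" by (rule cis_multiple_2pi) simp
    finally show ?thesis using False by simp
  qed
  finally show ?thesis .
qed

lemma fexp_orthonormal:
  assumes T: "T > 0"
  shows "inner_L2 (fexp T i) (fexp T j) = (if i = j then 1 else 0)"
proof -
  have "fexp T i w * cnj (fexp T j w) = (1 / of_real T) * (of_real (indicat_real {0..<T} w) * cis (2 * pi * of_int (i - j) * w / T))" for w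
  proof -
    have "cis (2 * pi * of_int i * w / T) * cis (- (2 * pi * of_int j * w / T)) = cis (2 * pi * of_int (i - j) * w / T)"
      unfolding cis_mult by (rule arg_cong[of _ _ cis]) (simp add: algebra_simps diff_divide_distrib)
    moreover have "complex_of_real (sqrt T) * complex_of_real (sqrt T) = of_real T"
      using T by (simp flip: of_real_mult)
    ultimately show ?thesis
      by (simp add: fexp_def cis_cnj indicator_def)
  qed
  then have "inner_L2 (fexp T i) (fexp T j) = (1 / of_real T) * (LINT w|lebesgue. of_real (indicat_real {0..<T} w) * cis (2 * pi * of_int (i - j) * w / T))"
    unfolding inner_L2_def by (simp only: integral_mult_right_zero)
  then show ?thesis using T by (simp only: integral_cis_period[OF T]) simp
qed

text \<open>The obstacle is the endpoints: a continuous approximation \<open>h\<close> of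
  \<open>f\<close> need not take equal values at 0 and \<open>T\<close>. Multiplying by
  \<open>chi k\<close>, which vanishes at both, gives a loop that \<open>trig_uniform_approx\<close>
  handles. Each of the three steps, from \<open>f\<close> to the cut off \<open>h\<close>, to
  \<open>u k\<close>, to \<open>v\<close>, costs less than a third of
  \<open>\<epsilon>\<close>.\<close>

lemma fourier_series_dense:
  assumes T: "T > 0" and f: "bcs f" and supp: "\<And>w. w \<notin> {0..<T} \<Longrightarrow> f w = 0" and e: "\<epsilon> > 0"
  shows "\<exists>I c. finite I \<and> norm_L2 (\<lambda>x. f x - (\<Sum>j\<in>I. c j * fexp T j x)) < \<epsilon>"
proof -
  have fL: "f \<in> L2" using f by (rule bcs_L2)
  have [measurable]: "f \<in> borel_measurable lebesgue" using fL by (rule L2_measurable)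
  have ind [measurable]: "indicat_real {0..<T} \<in> borel_measurable lebesgue" by (simp add: measurable_completion)
  let ?ind = "\<lambda>w. complex_of_real (indicat_real {0..<T} w)"
  have indb: "cmod (?ind w) \<le> 1" for w by (simp add: indicator_def)
  have indm: "?ind \<in> borel_measurable lebesgue" by measurable
  obtain h where h: "Cc h" and fh: "norm_L2 (\<lambda>x. f x - h x) < \<epsilon> / 3" using dense_Cc[OF fL, of "\<epsilon> / 3"] e by auto
  have hc: "continuous_on UNIV h" using h by (simp add: Cc_def)
  have hL: "h \<in> L2" using h by (intro bcs_L2 Cc_bcs)
  obtain K where K: "\<And>x. cmod (h x) \<le> K" using Cc_bcs[OF h] by (rule bcsE) blast
  have [measurable]: "h \<in> borel_measurable lebesgue" using hL by (rule L2_measurable)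
  \<comment> \<open>A trapezoid that is 0 at both ends and rises with slope \<open>k\<close>. At
    each interior point it equals 1 for large \<open>k\<close>, so convergence fails at most at the
    point 0 of \<open>[0, T)\<close>.\<close>
  define chi where "chi k x = min 1 (max 0 (real k * min x (T - x)))" for k :: nat and x :: real
  have chi: "0 \<le> chi k x" "chi k x \<le> 1" for k x by (auto simp: chi_def)
  have chic: "continuous_on UNIV (chi k)" for k unfolding chi_def by (intro continuous_intros)
  have [measurable]: "chi k \<in> borel_measurable lebesgue" for k by (rule continuous_borel_measurable_lebesgue[OF chic])
  define u where "u k x = ?ind x * (of_real (chi k x) * h x)" for k x
  have uL: "u k \<in> L2" for k
  proof -
    have "(\<lambda>x. of_real (chi k x) * h x) \<in> L2"
      by (rule L2_bounded_mult[where K=1, OF hL]) (use chi in auto)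
    then show ?thesis unfolding u_def by (rule L2_bounded_mult[OF _ indm indb])
  qed
  have hL1: "(\<lambda>x. ?ind x * h x) \<in> L2" by (rule L2_bounded_mult[OF hL indm indb])
  have "(\<lambda>k. LINT x|lebesgue. (cmod (?ind x * h x - u k x))\<^sup>2) \<longlonglongrightarrow> (LINT x|(lebesgue :: real measure). 0)"
  proof (rule integral_dominated_convergence[where w="\<lambda>x. (cmod (h x))\<^sup>2"])
    show "integrable lebesgue (\<lambda>x. (cmod (h x))\<^sup>2)" using hL by (rule L2_integrable)
    show "(\<lambda>x. (cmod (?ind x * h x - u k x))\<^sup>2) \<in> borel_measurable lebesgue" for k
      unfolding u_def by measurable
    have "AE x in lborel. x \<noteq> (0::real)" by (rule AE_lborel_singleton)
    then have "AE x in lebesgue. x \<noteq> (0::real)" by (rule AE_completion)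
    then show "AE x in lebesgue. (\<lambda>k. (cmod (?ind x * h x - u k x))\<^sup>2) \<longlonglongrightarrow> 0"
    proof eventually_elim
      case (elim x)
      show ?case
      proof (cases "x \<in> {0..<T}")
        case False
        then show ?thesis by (simp add: u_def)
      next
        case True
        then have m: "min x (T - x) > 0" using elim by auto
        obtain N where N: "real N \<ge> 1 / min x (T - x)" using real_arch_simple by blast
        have "chi k x = 1" if "k \<ge> N" for k
        proof -
          have "real k \<ge> 1 / min x (T - x)" using N that by linarith
          then have "real k * min x (T - x) \<ge> 1" using m by (simp only: pos_divide_le_eq)
          then show ?thesis unfolding chi_def by linarith
        qed
        then have "\<forall>\<^sub>F k in sequentially. (cmod (?ind x * h x - u k x))\<^sup>2 = 0"
          unfolding eventually_sequentially by (intro exI[of _ N]) (simp add: u_def)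
        then show ?thesis by (rule tendsto_eventually)
      qed
    qed
    show "AE x in lebesgue. norm ((cmod (?ind x * h x - u k x))\<^sup>2) \<le> (cmod (h x))\<^sup>2" for k
    proof (intro AE_I2)
      fix x
      have "?ind x * h x - u k x = of_real (indicat_real {0..<T} x * (1 - chi k x)) * h x"
        by (simp add: u_def algebra_simps)
      also have "cmod \<dots> \<le> 1 * cmod (h x)"
        unfolding norm_mult norm_of_real using chi[of k x] by (intro mult_right_mono) (auto simp: indicator_def)
      finally show "norm ((cmod (?ind x * h x - u k x))\<^sup>2) \<le> (cmod (h x))\<^sup>2"
        by (simp add: power_mono)
    qed
  qed simp
  then obtain k where k: "norm_L2 (\<lambda>x. ?ind x * h x - u k x) < \<epsilon> / 3"
    using norm_L2_tendsto_zeroI[of "\<lambda>k x. ?ind x * h x - u k x" "\<epsilon> / 3"] e by auto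
  have "norm_L2 (\<lambda>x. f x - ?ind x * h x) \<le> norm_L2 (\<lambda>x. f x - h x)"
    unfolding norm_L2_def
  proof (intro real_sqrt_le_mono Bochner_Integration.integral_mono)
    show "integrable lebesgue (\<lambda>x. (cmod (f x - ?ind x * h x))\<^sup>2)" by (intro L2_integrable L2_diff fL hL1)
    show "integrable lebesgue (\<lambda>x. (cmod (f x - h x))\<^sup>2)" by (intro L2_integrable L2_diff fL hL)
    show "(cmod (f x - ?ind x * h x))\<^sup>2 \<le> (cmod (f x - h x))\<^sup>2" for x
      using supp[of x] by (cases "x \<in> {0..<T}") auto
  qed
  with fh have fh1: "norm_L2 (\<lambda>x. f x - ?ind x * h x) < \<epsilon> / 3" by simp
  define p where "p s = of_real (chi k (s * T)) * h (s * T)" for s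
  have "continuous_on {0..1} p" unfolding p_def
    by (intro continuous_intros continuous_on_compose2[OF hc] continuous_on_compose2[OF chic]) auto
  moreover have "p 0 = p 1" using T by (simp add: p_def chi_def)
  \<comment> \<open>A uniform error of this size on an interval of length \<open>T\<close> has L2
    norm at most \<open>\<epsilon> / 4\<close>.\<close>
  moreover have "\<epsilon> / (4 * sqrt T) > 0" using e T by simp
  ultimately obtain q where q: "trig q" "\<And>s. s \<in> {0..<1} \<Longrightarrow> cmod (p s - q (2 * pi * s)) < \<epsilon> / (4 * sqrt T)"
    using trig_uniform_approx by blast
  from trig_repr[OF q(1)] obtain I c where I: "finite I" "\<And>x. q x = (\<Sum>j\<in>I. c j * cis (of_int j * x))" by blast
  define v where "v = (\<lambda>x. \<Sum>j\<in>I. (c j * sqrt T) * fexp T j x)"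
  have vL: "v \<in> L2" unfolding v_def by (intro L2_sum L2_scale bcs_L2 fexp_bcs T)
  have v: "v x = ?ind x * q (2 * pi * (x / T))" for x
    using T by (simp add: v_def I(2) fexp_def sum_distrib_left mult_ac)
  have uv: "cmod (u k x - v x) \<le> \<epsilon> / (4 * sqrt T) * indicat_real {0..<T} x" for x
  proof (cases "x \<in> {0..<T}")
    case True
    then have "cmod (p (x / T) - q (2 * pi * (x / T))) < \<epsilon> / (4 * sqrt T)"
      using T by (intro q(2)) auto
    then show ?thesis using True T by (simp add: u_def v p_def)
  qed (simp add: u_def v)
  have iT: "integrable lebesgue (indicat_real {0..<T})"
    using T by (intro integrable_real_indicator) auto
  have "(norm_L2 (\<lambda>x. u k x - v x))\<^sup>2 \<le> (LINT x|lebesgue. (\<epsilon> / (4 * sqrt T))\<^sup>2 * indicat_real {0..<T} x)"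
    unfolding norm_L2_sq
  proof (rule Bochner_Integration.integral_mono)
    show "integrable lebesgue (\<lambda>x. (cmod (u k x - v x))\<^sup>2)" by (intro L2_integrable L2_diff uL vL)
    show "integrable lebesgue (\<lambda>x. (\<epsilon> / (4 * sqrt T))\<^sup>2 * indicat_real {0..<T} x)" using iT by simp
    fix x
    have "(cmod (u k x - v x))\<^sup>2 \<le> (\<epsilon> / (4 * sqrt T) * indicat_real {0..<T} x)\<^sup>2"
      by (intro power_mono uv) auto
    then show "(cmod (u k x - v x))\<^sup>2 \<le> (\<epsilon> / (4 * sqrt T))\<^sup>2 * indicat_real {0..<T} x"
      by (cases "x \<in> {0..<T}") auto
  qed
  also have "\<dots> = (\<epsilon> / 4)\<^sup>2"
  proof -
    have m: "(LINT x|lebesgue. indicat_real {0..<T} x) = T" using T by simp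
    have "(\<epsilon> / (4 * sqrt T))\<^sup>2 = (\<epsilon> / 4)\<^sup>2 / (sqrt T)\<^sup>2"
      unfolding power_divide[symmetric] by (simp only: divide_divide_eq_left)
    then have "(\<epsilon> / (4 * sqrt T))\<^sup>2 * T = (\<epsilon> / 4)\<^sup>2" using T by simp
    then show ?thesis by (simp only: integral_mult_right_zero m)
  qed
  finally have "norm_L2 (\<lambda>x. u k x - v x) \<le> \<epsilon> / 4"
    by (rule power2_le_imp_le) (use e in simp)
  moreover have "norm_L2 (\<lambda>x. f x - v x) \<le> norm_L2 (\<lambda>x. f x - ?ind x * h x) + norm_L2 (\<lambda>x. ?ind x * h x - v x)"
    by (intro norm_L2_triangle_diff fL vL hL1)
  moreover have "norm_L2 (\<lambda>x. ?ind x * h x - v x) \<le> norm_L2 (\<lambda>x. ?ind x * h x - u k x) + norm_L2 (\<lambda>x. u k x - v x)"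
    by (intro norm_L2_triangle_diff uL vL hL1)
  ultimately have "norm_L2 (\<lambda>x. f x - v x) < \<epsilon>" using fh1 k e by linarith
  then show ?thesis unfolding v_def using I(1) by (intro exI conjI)
qed

lemma fourier_series_parseval:
  assumes T: "T > 0" and f: "bcs f" and supp: "\<And>w. w \<notin> {0..<T} \<Longrightarrow> f w = 0"
  shows "((\<lambda>j. (cmod (inner_L2 f (fexp T j)))\<^sup>2) has_sum (norm_L2 f)\<^sup>2) UNIV"
  by (intro orthonormal_parseval bcs_L2 fexp_bcs T f fexp_orthonormal fourier_series_dense supp)

section \<open>Periodization\<close>

definition per :: "real \<Rightarrow> (real \<Rightarrow> complex) \<Rightarrow> real \<Rightarrow> complex" where
  "per T p w = (\<Sum>\<^sub>\<infinity>l\<in>(UNIV :: int set). p (w + of_int l * T))"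

text \<open>The sum in \<open>per\<close> runs over all of \<open>int\<close>, which makes
  periodicity a shift of the index. Under bounded support a term survives only if
  \<open>|l| T \<le> R + S\<close>, because \<open>|w + l T| \<le> R\<close> and
  \<open>|w| \<le> S\<close>.\<close>

lemma per_finite:
  assumes T: "T > 0" and R: "\<And>x. \<bar>x\<bar> > R \<Longrightarrow> p x = 0" and w: "\<bar>w\<bar> \<le> S" and L: "of_int L * T \<ge> R + S"
  shows "per T p w = (\<Sum>l\<in>{-L..L}. p (w + of_int l * T))"
proof -
  have "per T p w = (\<Sum>\<^sub>\<infinity>l\<in>{-L..L}. p (w + of_int l * T))"
    unfolding per_def
  proof (rule infsum_cong_neutral)
    fix l assume l: "l \<in> UNIV - {-L..L}"
    have "\<bar>w + of_int l * T\<bar> > R"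
    proof (cases "l > L")
      case True
      then have "of_int l * T > of_int L * T" using T by simp
      then show ?thesis using w L by linarith
    next
      case False
      then have "l < - L" using l by auto
      then have "of_int l * T < of_int (- L) * T" using T by (simp only: mult_less_cancel_right_pos of_int_less_iff)
      then show ?thesis using w L by simp
    qed
    then show "p (w + of_int l * T) = 0" by (rule R)
  qed auto
  then show ?thesis by simp
qed

lemma per_periodic: "per T p (w + of_int k * T) = per T p w"
  unfolding per_def
  by (rule infsum_reindex_bij_witness[of UNIV "\<lambda>l. l - k" "\<lambda>l. l + k"]) (auto simp: algebra_simps)

text \<open>The translates of \<open>[0, T)\<close> tile the line; the one that contains
  \<open>w\<close> has index \<open>floor (w / T)\<close>, and the size of \<open>L\<close> puts
  this index in range.\<close>

lemma indicator_intervals_sum: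
  fixes T w R :: real and L :: int
  assumes T: "T > 0" and w: "\<bar>w\<bar> \<le> R" and L: "of_int L * T \<ge> R + T"
  shows "(\<Sum>l\<in>{-L..L}. indicat_real {0..<T} (w - of_int l * T)) = 1"
proof -
  define m where "m = \<lfloor>w / T\<rfloor>"
  have iff: "w - of_int l * T \<in> {0..<T} \<longleftrightarrow> l = m" for l
  proof -
    have "w - of_int l * T \<in> {0..<T} \<longleftrightarrow> of_int l \<le> w / T \<and> w / T < of_int l + 1"
      using T by (auto simp: field_simps)
    also have "\<dots> \<longleftrightarrow> \<lfloor>w / T\<rfloor> = l" by (simp add: floor_eq_iff)
    finally show ?thesis by (auto simp: m_def)
  qed
  have "of_int m * T \<le> w" "w < of_int m * T + T" using iff[of m] by auto
  then have "of_int m * T \<le> of_int L * T" "- (of_int L * T) \<le> of_int m * T" using w L T by linarith+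
  then have "of_int m * T \<le> of_int L * T" "of_int (- L) * T \<le> of_int m * T" by simp_all
  then have "m \<in> {-L..L}" using T by (simp only: mult_le_cancel_right_pos of_int_le_iff atLeastAtMost_iff)
  then have "(\<Sum>l\<in>{-L..L}. if l = m then 1 else 0) = (1 :: real)" by (subst sum.delta) auto
  then show ?thesis unfolding indicator_def iff of_bool_def .
qed

lemma bcs_shift:
  assumes "bcs p" shows "bcs (\<lambda>x. p (x + a))"
proof -
  from assms obtain K R where K: "\<And>x. cmod (p x) \<le> K" "\<And>x. \<bar>x\<bar> > R \<Longrightarrow> p x = 0"
    by (rule bcsE) blast
  have "(\<lambda>x. p (x + a)) \<in> borel_measurable lebesgue"
    using integrable_lebesgue_affine[OF bcs_integrable[OF assms], of a] by simp
  moreover have "p (x + a) = 0" if "\<bar>x\<bar> > R + \<bar>a\<bar>" for x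
    using that by (intro K(2)) linarith
  ultimately show ?thesis unfolding bcs_def using K(1) by blast
qed

lemma bcs_bounded_mult:
  assumes p: "bcs p" and q: "q \<in> borel_measurable lebesgue" "\<And>x. cmod (q x) \<le> K"
  shows "bcs (\<lambda>x. p x * q x)"
proof -
  from p obtain M R where M: "M > 0" "p \<in> borel_measurable lebesgue" "\<And>x. cmod (p x) \<le> M" "\<And>x. \<bar>x\<bar> > R \<Longrightarrow> p x = 0"
    by (rule bcsE) blast
  have [measurable]: "p \<in> borel_measurable lebesgue" "q \<in> borel_measurable lebesgue" by fact+
  have "(\<lambda>x. p x * q x) \<in> borel_measurable lebesgue" by measurable
  moreover have "cmod (p x * q x) \<le> M * K" for x
    unfolding norm_mult using M q by (intro mult_mono) auto
  ultimately show ?thesis unfolding bcs_def using M(4) by (metis mult_zero_left)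
qed

lemma bcs_sum:
  assumes I: "finite I" and p: "\<And>i. i \<in> I \<Longrightarrow> bcs (p i)"
  shows "bcs (\<lambda>x. \<Sum>i\<in>I. p i x)"
  using I p
proof (induction I rule: finite_induct)
  case empty
  show ?case by (auto simp: bcs_def)
next
  case (insert i I)
  obtain K R where K: "p i \<in> borel_measurable lebesgue" "\<And>x. cmod (p i x) \<le> K" "\<And>x. \<bar>x\<bar> > R \<Longrightarrow> p i x = 0"
    using insert(4)[of i, OF insertI1] by (rule bcsE) blast
  have "bcs (\<lambda>x. \<Sum>i\<in>I. p i x)" using insert by simp
  then obtain K' R' where K': "(\<lambda>x. \<Sum>i\<in>I. p i x) \<in> borel_measurable lebesgue" "\<And>x. cmod (\<Sum>i\<in>I. p i x) \<le> K'" "\<And>x. \<bar>x\<bar> > R' \<Longrightarrow> (\<Sum>i\<in>I. p i x) = 0"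
    by (rule bcsE) blast
  note [measurable] = K(1) K'(1)
  have "(\<lambda>x. p i x + (\<Sum>i\<in>I. p i x)) \<in> borel_measurable lebesgue" by measurable
  moreover have "cmod (p i x + (\<Sum>i\<in>I. p i x)) \<le> K + K'" for x
    using norm_triangle_ineq[of "p i x" "\<Sum>i\<in>I. p i x"] K(2)[of x] K'(2)[of x] by linarith
  moreover have "p i x + (\<Sum>i\<in>I. p i x) = 0" if "\<bar>x\<bar> > max R R'" for x
    using that K(3) K'(3) by simp
  ultimately have "bcs (\<lambda>x. p i x + (\<Sum>i\<in>I. p i x))" unfolding bcs_def by blast
  then show ?case using insert(1,2) by simp
qed

text \<open>The finite sum is pulled out of the integral and each term is translated back; the
  period intervals, translated the other way, add up to 1 on the support of
  \<open>q\<close>.\<close>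

lemma per_unfold:
  assumes T: "T > 0" and q: "bcs q"
  shows "(LINT w|lebesgue. of_real (indicat_real {0..<T} w) * per T q w) = (LINT w|lebesgue. q w)"
proof -
  obtain K R where R0: "R > 0" and qm: "q \<in> borel_measurable lebesgue" and R: "\<And>x. \<bar>x\<bar> > R \<Longrightarrow> q x = 0"
    using q by (rule bcsE) blast
  obtain L0 where "real L0 \<ge> (R + T) / T" using real_arch_simple by blast
  then have L: "of_int (int L0) * T \<ge> R + T" using T by (simp add: field_simps)
  define L where "L = int L0"
  note L = L[folded L_def]
  let ?ind = "\<lambda>w. complex_of_real (indicat_real {0..<T} w)"
  have [measurable]: "indicat_real {0..<T} \<in> borel_measurable lebesgue" by (simp add: measurable_completion)
  have indm: "?ind \<in> borel_measurable lebesgue" by measurable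
  have indb: "cmod (?ind w) \<le> 1" for w by (simp add: indicator_def)
  have i1: "integrable lebesgue (\<lambda>w. q (w + of_int l * T) * ?ind w)" for l
    by (intro bcs_integrable bcs_bounded_mult[OF bcs_shift[OF q] indm indb])
  have i2: "integrable lebesgue (\<lambda>w. q w * ?ind (w - of_int l * T))" for l
    using integrable_lebesgue_affine[OF i1[of l], of "- of_int l * T"] by simp
  have "(LINT w|lebesgue. ?ind w * per T q w) = (LINT w|lebesgue. (\<Sum>l\<in>{-L..L}. q (w + of_int l * T) * ?ind w))"
  proof (rule Bochner_Integration.integral_cong)
    fix w
    show "?ind w * per T q w = (\<Sum>l\<in>{-L..L}. q (w + of_int l * T) * ?ind w)"
    proof (cases "w \<in> {0..<T}")
      case True
      then have "per T q w = (\<Sum>l\<in>{-L..L}. q (w + of_int l * T))"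
        using T R L by (intro per_finite[where R=R and S=T]) auto
      then show ?thesis using True by simp
    qed auto
  qed simp
  also have "\<dots> = (\<Sum>l\<in>{-L..L}. (LINT w|lebesgue. q (w + of_int l * T) * ?ind w))"
    by (rule Bochner_Integration.integral_sum) (rule i1)
  also have "\<dots> = (\<Sum>l\<in>{-L..L}. (LINT w|lebesgue. q w * ?ind (w - of_int l * T)))"
  proof (rule sum.cong)
    fix l
    show "(LINT w|lebesgue. q (w + of_int l * T) * ?ind w) = (LINT w|lebesgue. q w * ?ind (w - of_int l * T))"
      using integral_lebesgue_shift[of "\<lambda>w. q w * ?ind (w - of_int l * T)" "of_int l * T"] by simp
  qed simp
  also have "\<dots> = (LINT w|lebesgue. (\<Sum>l\<in>{-L..L}. q w * ?ind (w - of_int l * T)))"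
    by (rule Bochner_Integration.integral_sum[symmetric]) (rule i2)
  also have "\<dots> = (LINT w|lebesgue. q w)"
  proof (rule Bochner_Integration.integral_cong)
    fix w
    show "(\<Sum>l\<in>{-L..L}. q w * ?ind (w - of_int l * T)) = q w"
    proof (cases "\<bar>w\<bar> > R")
      case False
      then have "(\<Sum>l\<in>{-L..L}. indicat_real {0..<T} (w - of_int l * T)) = 1"
        by (intro indicator_intervals_sum[OF T _ L]) simp
      then have "complex_of_real (\<Sum>l\<in>{-L..L}. indicat_real {0..<T} (w - of_int l * T)) = 1" by simp
      then show ?thesis by (simp add: sum_distrib_left[symmetric])
    qed (simp add: R)
  qed simp
  finally show ?thesis .
qed

text \<open>Up to \<open>sqrt T\<close> the integrals are the Fourier coefficients, on one period,
  of the periodization of \<open>p\<close>. Parseval turns their sum into its energy, which unfolds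
  to the line once more. The product of \<open>p w\<close> and \<open>p (w + l T)\<close> vanishes
  unless \<open>|l| T \<le> 2 R\<close>, whence the condition on \<open>L\<close>.\<close>

lemma periodization_parseval:
  assumes T: "T > 0" and p: "bcs p" and R: "\<And>x. \<bar>x\<bar> > R \<Longrightarrow> p x = 0" and L: "of_int L * T \<ge> 2 * R" and R0: "R \<ge> 0"
  shows "((\<lambda>j::int. (cmod (LINT w|lebesgue. p w * cis (2 * pi * of_int j * w / T)))\<^sup>2) has_sum
    T * (LINT w|lebesgue. Re (p w * cnj (\<Sum>l\<in>{-L..L}. p (w + of_int l * T))))) UNIV"
proof -
  let ?ind = "\<lambda>w. complex_of_real (indicat_real {0..<T} w)"
  have [measurable]: "indicat_real {0..<T} \<in> borel_measurable lebesgue" by (simp add: measurable_completion)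
  have indm: "?ind \<in> borel_measurable lebesgue" by measurable
  have indb: "cmod (?ind w) \<le> 1" for w by (simp add: indicator_def)
  define P where "P w = ?ind w * per T p w" for w
  obtain L0 where "real L0 \<ge> (R + T) / T" using real_arch_simple by blast
  then have L0: "of_int (int L0) * T \<ge> R + T" using T by (simp add: field_simps)
  have Peq: "P = (\<lambda>w. (\<Sum>l\<in>{-int L0..int L0}. p (w + of_int l * T)) * ?ind w)"
  proof
    fix w
    show "P w = (\<Sum>l\<in>{-int L0..int L0}. p (w + of_int l * T)) * ?ind w"
      unfolding P_def
    proof (cases "w \<in> {0..<T}")
      case True
      then show "?ind w * per T p w = (\<Sum>l\<in>{-int L0..int L0}. p (w + of_int l * T)) * ?ind w"
        by (subst per_finite[where R=R and S=T and L="int L0"]) (use T L0 R in auto)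
    qed auto
  qed
  have Pb: "bcs P"
    unfolding Peq by (intro bcs_bounded_mult[OF _ indm indb] bcs_sum bcs_shift p) simp
  have supp: "w \<notin> {0..<T} \<Longrightarrow> P w = 0" for w by (simp add: P_def)
  \<comment> \<open>\<open>inner_L2\<close> conjugates the exponential, so index \<open>j\<close>
    meets frequency \<open>- j\<close>; the sum over \<open>j\<close> is reflected at the
    end.\<close>
  have coeff: "inner_L2 P (fexp T j) = (LINT w|lebesgue. p w * cis (2 * pi * of_int (- j) * w / T)) / of_real (sqrt T)" for j
  proof -
    let ?c = "\<lambda>w. cis (2 * pi * of_int (- j) * w / T)"
    have cm: "?c \<in> borel_measurable lebesgue" using T by (intro continuous_borel_measurable_lebesgue continuous_intros) auto
    have cper: "?c (w + of_int l * T) = ?c w" for w l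
    proof -
      have "?c (w + of_int l * T) = cis (2 * pi * of_int (- j) * w / T + 2 * pi * of_int (- j * l))"
        using T by (intro arg_cong[of _ _ cis]) (simp add: field_simps)
      also have "\<dots> = ?c w * cis (2 * pi * of_int (- j * l))" by (simp only: cis_mult)
      also have "cis (2 * pi * of_int (- j * l)) = 1" by (intro cis_multiple_2pi) auto
      finally show ?thesis by simp
    qed
    have "per T (\<lambda>w. p w * ?c w) w = per T p w * ?c w" for w
      unfolding per_def by (simp only: cper infsum_cmult_left')
    then have "(LINT w|lebesgue. p w * ?c w) = (LINT w|lebesgue. ?ind w * (per T p w * ?c w))"
      using per_unfold[OF T bcs_bounded_mult[OF p cm, of 1]] by simp
    also have "\<dots> = (LINT w|lebesgue. of_real (sqrt T) * (P w * cnj (fexp T j w)))"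
      using T by (intro Bochner_Integration.integral_cong) (auto simp: P_def fexp_def cis_cnj indicator_def)
    also have "\<dots> = of_real (sqrt T) * inner_L2 P (fexp T j)"
      unfolding inner_L2_def by simp
    finally show ?thesis using T by simp
  qed
  define q where "q w = p w * cnj (\<Sum>l\<in>{-L..L}. p (w + of_int l * T))" for w
  have qper: "q w = p w * cnj (per T p w)" for w
  proof (cases "\<bar>w\<bar> > R")
    case False
    then have "per T p w = (\<Sum>l\<in>{-L..L}. p (w + of_int l * T))"
      using T L by (intro per_finite[where R=R and S=R] R) auto
    then show ?thesis by (simp add: q_def)
  qed (simp add: q_def R)
  have qb: "bcs q"
  proof -
    have "bcs (\<lambda>w. \<Sum>l\<in>{-L..L}. p (w + of_int l * T))" by (intro bcs_sum bcs_shift p) simp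
    then obtain K where "(\<lambda>w. \<Sum>l\<in>{-L..L}. p (w + of_int l * T)) \<in> borel_measurable lebesgue"
      "\<And>w. cmod (\<Sum>l\<in>{-L..L}. p (w + of_int l * T)) \<le> K" by (rule bcsE) blast
    then show ?thesis unfolding q_def
      by (intro bcs_bounded_mult[OF p, of _ K] borel_measurable_cnj) (simp_all add: flip: cnj_sum)
  qed
  \<comment> \<open>\<open>per T p\<close> is periodic and factors out of the second periodization,
    which leaves the squared modulus of \<open>per T p\<close>.\<close>
  have perq: "per T q w = per T p w * cnj (per T p w)" for w
    unfolding per_def[of T q] qper per_periodic by (simp add: infsum_cmult_left' per_def)
  have "complex_of_real ((norm_L2 P)\<^sup>2) = (LINT w|lebesgue. ?ind w * per T q w)"
    unfolding inner_self[symmetric] inner_L2_def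
    by (intro Bochner_Integration.integral_cong) (auto simp: P_def perq indicator_def)
  also have "\<dots> = (LINT w|lebesgue. q w)" by (rule per_unfold[OF T qb])
  finally have "Re (complex_of_real ((norm_L2 P)\<^sup>2)) = Re (LINT w|lebesgue. q w)" by (rule arg_cong)
  then have nP: "(norm_L2 P)\<^sup>2 = (LINT w|lebesgue. Re (q w))"
    using bcs_integrable[OF qb] by simp
  have "((\<lambda>j. (cmod (inner_L2 P (fexp T j)))\<^sup>2) has_sum (norm_L2 P)\<^sup>2) UNIV"
    by (rule fourier_series_parseval[OF T Pb supp])
  then have "((\<lambda>j. T * (cmod (inner_L2 P (fexp T j)))\<^sup>2) has_sum T * (norm_L2 P)\<^sup>2) UNIV"
    by (rule has_sum_cmult_right)
  moreover have "T * (cmod (inner_L2 P (fexp T j)))\<^sup>2 = (cmod (LINT w|lebesgue. p w * cis (2 * pi * of_int (- j) * w / T)))\<^sup>2" for j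
    unfolding coeff norm_divide power_divide using T by simp
  ultimately have "((\<lambda>j. (cmod (LINT w|lebesgue. p w * cis (2 * pi * of_int (- j) * w / T)))\<^sup>2) has_sum T * (norm_L2 P)\<^sup>2) UNIV"
    by simp
  also have "?this \<longleftrightarrow> ((\<lambda>j. (cmod (LINT w|lebesgue. p w * cis (2 * pi * of_int j * w / T)))\<^sup>2) has_sum T * (norm_L2 P)\<^sup>2) UNIV"
    by (rule has_sum_reindex_bij_witness[of _ uminus uminus]) auto
  finally show ?thesis unfolding nP q_def .
qed

section \<open>Frame sums as quadratic forms\<close>

lemma summable_on_int:
  fixes f :: "int \<Rightarrow> real"
  assumes "(\<lambda>n. f (int n)) summable_on UNIV" "(\<lambda>n. f (- int n)) summable_on UNIV"
  shows "f summable_on UNIV"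
proof -
  have "f summable_on range int" "f summable_on range (\<lambda>n. - int n)"
    using assms by (subst summable_on_reindex; simp add: inj_on_def o_def)+
  then have "f summable_on range int \<union> range (\<lambda>n. - int n)" by (rule summable_on_union)
  also have "range int \<union> range (\<lambda>n. - int n) = UNIV"
  proof -
    have "m \<in> range int \<union> range (\<lambda>n. - int n)" for m :: int
      by (cases m rule: int_cases2) auto
    then show ?thesis by blast
  qed
  finally show ?thesis .
qed

text \<open>Pairs the modulations \<open>m\<close> and \<open>- m\<close>, as a Wilson function with
  \<open>m > 0\<close> does. The index 0 must be counted once, hence the parametrisation of the
  negative half by \<open>Suc\<close>.\<close>

lemma has_sum_int_fold:
  fixes f :: "int \<Rightarrow> real"
  assumes "(f has_sum S) UNIV"
  shows "((\<lambda>m::nat. if m = 0 then f 0 else f (int m) + f (- int m)) has_sum S) UNIV"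
proof -
  have sm: "f summable_on UNIV" using assms by (rule has_sum_imp_summable)
  define a where "a = infsum f (range int)"
  define b where "b = infsum f (range (\<lambda>n. - int (Suc n)))"
  have a: "(f has_sum a) (range int)" unfolding a_def
    by (rule has_sum_infsum) (rule summable_on_subset[OF sm], simp)
  have b: "(f has_sum b) (range (\<lambda>n. - int (Suc n)))" unfolding b_def
    by (rule has_sum_infsum) (rule summable_on_subset[OF sm], simp)
  have U: "range int \<union> range (\<lambda>n. - int (Suc n)) = UNIV"
  proof -
    have "m \<in> range int \<union> range (\<lambda>n. - int (Suc n))" for m :: int
      by (cases m rule: int_cases) auto
    then show ?thesis by blast
  qed
  have "(f has_sum (a + b)) (range int \<union> range (\<lambda>n. - int (Suc n)))"
    by (rule has_sum_Un_disjoint[OF a b]) auto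
  then have S: "S = a + b" unfolding U using assms has_sum_unique by blast
  have a': "((\<lambda>m. f (int m)) has_sum a) UNIV"
    using a by (subst (asm) has_sum_reindex) (auto simp: inj_on_def o_def)
  have "((\<lambda>m. f (- int (Suc m))) has_sum b) UNIV"
    using b by (subst (asm) has_sum_reindex) (auto simp: inj_on_def o_def)
  also have "?this \<longleftrightarrow> ((\<lambda>m. f (- int m)) has_sum b) {0<..}"
    by (rule has_sum_reindex_bij_witness[of _ "\<lambda>m. m - 1" Suc]) auto
  also have "\<dots> \<longleftrightarrow> ((\<lambda>m. if m = 0 then 0 else f (- int m)) has_sum b) UNIV"
    by (rule has_sum_cong_neutral) auto
  finally have "((\<lambda>m. f (int m) + (if m = 0 then 0 else f (- int m))) has_sum a + b) UNIV"
    by (intro has_sum_add a')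
  also have "(\<lambda>m. f (int m) + (if m = 0 then 0 else f (- int m))) = (\<lambda>m. if m = 0 then f 0 else f (int m) + f (- int m))"
    by auto
  finally show ?thesis unfolding S .
qed

lemma has_sum_int_parity:
  fixes f :: "int \<Rightarrow> real"
  assumes "((\<lambda>j. f (2 * j)) has_sum a) UNIV" "((\<lambda>j. f (2 * j + 1)) has_sum b) UNIV"
  shows "(f has_sum (a + b)) UNIV"
proof -
  have "(f has_sum a) (range (\<lambda>j. 2 * j))" "(f has_sum b) (range (\<lambda>j. 2 * j + 1))"
    using assms by (subst has_sum_reindex; simp add: inj_on_def o_def)+
  then have "(f has_sum (a + b)) (range (\<lambda>j. 2 * j) \<union> range (\<lambda>j. 2 * j + 1))"
    by (rule has_sum_Un_disjoint) (auto, presburger)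
  also have "range (\<lambda>j. 2 * j) \<union> range (\<lambda>j. 2 * j + 1) = (UNIV :: int set)"
  proof -
    have "m \<in> range (\<lambda>j. 2 * j) \<union> range (\<lambda>j. 2 * j + 1)" for m :: int
      by (cases "even m") (auto elim: evenE oddE)
    then show ?thesis by blast
  qed
  finally show ?thesis .
qed

lemma has_sum_sum:
  fixes f :: "'i \<Rightarrow> 'j \<Rightarrow> 'a :: topological_comm_monoid_add"
  assumes "finite I" "\<And>i. i \<in> I \<Longrightarrow> (f i has_sum s i) A"
  shows "((\<lambda>j. \<Sum>i\<in>I. f i j) has_sum (\<Sum>i\<in>I. s i)) A"
  using assms by (induction I rule: finite_induct) (auto intro: has_sum_add)

text \<open>The product majorant makes the integrals of the norms summable. Enumerating the integers
  by \<open>int_decode\<close> gives access to termwise integration of series, and absolute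
  convergence makes the outcome independent of the enumeration.\<close>

lemma has_sum_integral:
  fixes u :: "int \<Rightarrow> 'a \<Rightarrow> 'b :: {banach, second_countable_topology}"
  assumes u: "\<And>i. u i \<in> borel_measurable M"
    and le: "\<And>i x. norm (u i x) \<le> b i * v x" and b: "b summable_on UNIV"
    and v: "integrable M v"
  shows "((\<lambda>i. LINT x|M. u i x) has_sum (LINT x|M. (\<Sum>\<^sub>\<infinity>i. u i x))) UNIV"
    and "integrable M (\<lambda>x. \<Sum>\<^sub>\<infinity>i. u i x)"
proof -
  have bij: "bij int_decode" by (rule bij_int_decode)
  have b0: "0 \<le> b i * v x" for i x using norm_ge_zero le order_trans by blast
  have ab: "(\<lambda>i. \<bar>b i\<bar>) summable_on UNIV" using b summable_on_iff_abs_summable_on_real by auto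
  have le': "norm (u i x) \<le> \<bar>b i\<bar> * \<bar>v x\<bar>" for i x
    using le[of i x] by (metis abs_mult abs_ge_self order_trans)
  have iu: "integrable M (u i)" for i
    by (rule Bochner_Integration.integrable_bound[OF integrable_mult_right[OF v, of "b i"] u])
      (use le b0 in \<open>auto simp: abs_of_nonneg\<close>)
  have ab': "summable (\<lambda>k. \<bar>b (int_decode k)\<bar>)"
  proof -
    have "(\<lambda>k. \<bar>b (int_decode k)\<bar>) summable_on UNIV"
      using ab summable_on_reindex_bij_betw[OF bij, of "\<lambda>i. \<bar>b i\<bar>"] by simp
    then show ?thesis by (rule summable_on_imp_summable)
  qed
  have su: "summable (\<lambda>k. norm (u (int_decode k) x))" for x
    by (rule summable_comparison_test[OF _ summable_mult2[OF ab', of "\<bar>v x\<bar>"]]) (use le' in auto)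
  have si: "summable (\<lambda>k. LINT x|M. norm (u (int_decode k) x))"
  proof (rule summable_comparison_test[OF _ summable_mult2[OF ab', of "LINT x|M. \<bar>v x\<bar>"]], intro exI allI impI)
    fix k
    have "(LINT x|M. norm (u (int_decode k) x)) \<le> (LINT x|M. \<bar>b (int_decode k)\<bar> * \<bar>v x\<bar>)"
      using iu v le' by (intro Bochner_Integration.integral_mono) auto
    then show "norm (LINT x|M. norm (u (int_decode k) x)) \<le> \<bar>b (int_decode k)\<bar> * (LINT x|M. \<bar>v x\<bar>)"
      by simp
  qed
  have inf: "(\<Sum>\<^sub>\<infinity>i. u i x) = (\<Sum>k. u (int_decode k) x)" for x
  proof -
    have "((\<lambda>k. u (int_decode k) x) has_sum (\<Sum>k. u (int_decode k) x)) UNIV"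
      by (rule norm_summable_imp_has_sum[OF su summable_sums[OF summable_norm_cancel[OF su]]])
    then have "((\<lambda>i. u i x) has_sum (\<Sum>k. u (int_decode k) x)) UNIV"
      using has_sum_reindex_bij_betw[OF bij, of "\<lambda>i. u i x"] by simp
    then show ?thesis by (rule infsumI)
  qed
  show "integrable M (\<lambda>x. \<Sum>\<^sub>\<infinity>i. u i x)"
    unfolding inf using iu su si by (intro integrable_suminf) auto
  have "(\<lambda>k. LINT x|M. u (int_decode k) x) sums (LINT x|M. (\<Sum>\<^sub>\<infinity>i. u i x))"
    unfolding inf using iu su si by (intro sums_integral) auto
  moreover have "summable (\<lambda>k. norm (LINT x|M. u (int_decode k) x))"
    by (rule summable_comparison_test[OF _ si]) auto
  ultimately have "((\<lambda>k. LINT x|M. u (int_decode k) x) has_sum (LINT x|M. (\<Sum>\<^sub>\<infinity>i. u i x))) UNIV"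
    by (intro norm_summable_imp_has_sum)
  then show "((\<lambda>i. LINT x|M. u i x) has_sum (LINT x|M. (\<Sum>\<^sub>\<infinity>i. u i x))) UNIV"
    using has_sum_reindex_bij_betw[OF bij, of "\<lambda>i. LINT x|M. u i x"] by simp
qed

section \<open>Windows with polynomial decay and their lattice correlations\<close>

locale decaying =
  fixes h :: "real \<Rightarrow> real" and C \<epsilon> :: real
  assumes meas: "h \<in> borel_measurable lebesgue"
    and eps: "\<epsilon> > 0"
    and decay: "\<And>x. \<bar>h x\<bar> \<le> C * (1 + \<bar>x\<bar>) powr (- 1 - \<epsilon>)"
begin

lemma C_nonneg: "C \<ge> 0"
  using decay[of 0] by simp

lemma h_le: "\<bar>h x\<bar> \<le> C"
proof -
  have "(1 + \<bar>x\<bar>) powr (- 1 - \<epsilon>) \<le> 1 powr (- 1 - \<epsilon>)"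
    using eps by (intro powr_mono2') auto
  then have "C * (1 + \<bar>x\<bar>) powr (- 1 - \<epsilon>) \<le> C * 1"
    using C_nonneg by (intro mult_left_mono) auto
  then show ?thesis using decay[of x] by simp
qed

text \<open>A summable majorant for the integer translates of \<open>h\<close>, uniform for
  \<open>|w| \<le> R\<close>. The factor in \<open>R\<close> comes from
  \<open>1 + |m| \<le> (1 + |w - m|) (1 + R)\<close>.\<close>

definition maj :: "real \<Rightarrow> int \<Rightarrow> real" where
  "maj R m = C * (1 + \<bar>R\<bar>) powr (1 + \<epsilon>) * (1 + \<bar>real_of_int m\<bar>) powr (- 1 - \<epsilon>)"

lemma maj_nonneg: "maj R m \<ge> 0"
  using C_nonneg by (simp add: maj_def)

lemma maj_summable: "maj R summable_on UNIV"
proof -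
  have "summable (\<lambda>n. real n powr (- 1 - \<epsilon>))"
    using eps by (simp add: summable_real_powr_iff)
  then have "summable (\<lambda>n. real (Suc n) powr (- 1 - \<epsilon>))" by (subst summable_Suc_iff)
  then have "(\<lambda>n. real (Suc n) powr (- 1 - \<epsilon>)) summable_on UNIV"
    by (subst summable_on_UNIV_nonneg_real_iff) auto
  then have "(\<lambda>m::int. (1 + \<bar>real_of_int m\<bar>) powr (- 1 - \<epsilon>)) summable_on UNIV"
    by (intro summable_on_int) auto
  then show ?thesis unfolding maj_def[abs_def] by (rule summable_on_cmult_right)
qed

lemma h_maj:
  assumes "\<bar>w\<bar> \<le> R"
  shows "\<bar>h (w - of_int m)\<bar> \<le> maj R m"
proof -
  have R: "R \<ge> 0" using assms by linarith
  have "1 + \<bar>real_of_int m\<bar> \<le> 1 + \<bar>w - of_int m\<bar> + R" using assms by linarith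
  also have "\<dots> \<le> (1 + \<bar>w - of_int m\<bar>) * (1 + R)"
    using R by (simp add: algebra_simps)
  finally have le: "(1 + \<bar>real_of_int m\<bar>) / (1 + R) \<le> 1 + \<bar>w - of_int m\<bar>"
    using R by (simp add: field_simps)
  have "(1 + \<bar>w - of_int m\<bar>) powr (- 1 - \<epsilon>) \<le> ((1 + \<bar>real_of_int m\<bar>) / (1 + R)) powr (- 1 - \<epsilon>)"
    using le R eps by (intro powr_mono2') auto
  also have "\<dots> = (1 + \<bar>real_of_int m\<bar>) powr (- 1 - \<epsilon>) / (1 + R) powr (- (1 + \<epsilon>))"
    using R by (simp add: powr_divide)
  also have "\<dots> = (1 + R) powr (1 + \<epsilon>) * (1 + \<bar>real_of_int m\<bar>) powr (- 1 - \<epsilon>)"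
    by (subst powr_minus) (simp add: divide_inverse mult.commute)
  finally have "C * (1 + \<bar>w - of_int m\<bar>) powr (- 1 - \<epsilon>) \<le> C * ((1 + R) powr (1 + \<epsilon>) * (1 + \<bar>real_of_int m\<bar>) powr (- 1 - \<epsilon>))"
    using C_nonneg by (rule mult_left_mono)
  then show ?thesis using decay[of "w - of_int m"] R by (simp add: maj_def mult.assoc)
qed

lemma h_shift_summable: "(\<lambda>m::int. h (w - of_int m) * h (w + a - of_int m)) summable_on UNIV"
proof -
  have "(\<lambda>m. norm (h (w - of_int m) * h (w + a - of_int m))) summable_on UNIV"
  proof (rule Infinite_Sum.abs_summable_on_comparison_test')
    show "(\<lambda>m. maj \<bar>w\<bar> m * C) summable_on UNIV" by (intro summable_on_cmult_left maj_summable)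
    show "norm (h (w - of_int m) * h (w + a - of_int m)) \<le> maj \<bar>w\<bar> m * C" for m
      unfolding real_norm_def abs_mult by (intro mult_mono h_maj h_le maj_nonneg) auto
  qed
  then show ?thesis by (rule abs_summable_summable)
qed

definition corr :: "real \<Rightarrow> real \<Rightarrow> real" where
  "corr a w = (\<Sum>\<^sub>\<infinity>m\<in>(UNIV :: int set). h (w - of_int m) * h (w + a - of_int m))"

lemma corr_has_sum: "((\<lambda>m::int. h (w - of_int m) * h (w + a - of_int m)) has_sum corr a w) UNIV"
  unfolding corr_def using h_shift_summable by (rule has_sum_infsum)

end

text \<open>Tonelli for unconditional sums. The shift index \<open>j\<close> is summed first,
  because for fixed modulation that sum is evaluated by Parseval.\<close>

lemma has_sum_pairs_nonneg:
  fixes f :: "'a \<times> 'b \<Rightarrow> real"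
  assumes nn: "\<And>j m. f (j, m) \<ge> 0"
    and inner: "\<And>m. ((\<lambda>j. f (j, m)) has_sum a m) UNIV" and outer: "(a has_sum S) UNIV"
  shows "(f has_sum S) UNIV"
proof -
  define F where "F = (\<lambda>(m, j). f (j, m))"
  have inn: "((\<lambda>j. F (m, j)) has_sum a m) UNIV" for m using inner by (simp add: F_def)
  have "F summable_on (UNIV \<times> UNIV)"
    by (rule summable_on_SigmaI[where g=a]) (use inn outer nn in \<open>auto simp: F_def dest: has_sum_imp_summable\<close>)
  then have "(F has_sum S) (UNIV \<times> UNIV)"
    by (intro has_sum_SigmaI[where g=a]) (use inn outer in auto)
  then show ?thesis
    by (subst UNIV_Times_UNIV[symmetric], subst has_sum_swap) (simp add: F_def)
qed

lemma bcs_lattice_bound: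
  assumes K: "\<And>x. cmod (g x) \<le> K"
  shows "\<bar>Re (g w * cnj (g v))\<bar> \<le> K * K"
proof -
  have "\<bar>Re (g w * cnj (g v))\<bar> \<le> cmod (g w * cnj (g v))" by (rule abs_Re_le_cmod)
  also have "\<dots> = cmod (g w) * cmod (g v)" by (simp add: norm_mult)
  also have "\<dots> \<le> K * K" using K norm_ge_zero order_trans by (intro mult_mono) (blast+)
  finally show ?thesis .
qed

lemma measurable_shift:
  fixes f :: "real \<Rightarrow> 'a :: euclidean_space"
  assumes "f \<in> borel_measurable lebesgue"
  shows "(\<lambda>x. f (x + a)) \<in> borel_measurable lebesgue"
proof -
  have "(\<lambda>x::real. a + 1 * x) \<in> lebesgue \<rightarrow>\<^sub>M lebesgue"
    using lebesgue_affine_measurable[where c="\<lambda>_::real. 1" and t=a] by simp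
  from measurable_compose[OF this assms] show ?thesis by (simp add: add.commute)
qed

text \<open>The frequency \<open>\<theta>\<close> is \<open>0\<close>, or half the frequency of the period; the latter produces the sign
  \<open>cos (\<theta> l T) = (-1)\<^sup>l\<close> and accounts for the odd time shifts of the Wilson system.\<close>

lemma single_window_sum:
  fixes e :: "real \<Rightarrow> real"
  assumes T: "T > 0" and g: "bcs g" and R: "\<And>x. \<bar>x\<bar> > R \<Longrightarrow> g x = 0" and R0: "R \<ge> 0" and L: "of_int L * T \<ge> 2 * R"
    and em: "e \<in> borel_measurable lebesgue" and eK: "\<And>x. \<bar>e x\<bar> \<le> K"
    and th: "\<And>l::int. sin (\<theta> * (of_int l * T)) = 0"
  shows "((\<lambda>j::int. (cmod (LINT w|lebesgue. g w * (of_real (e w) * cis (\<theta> * w)) * cis (2 * pi * of_int j * w / T)))\<^sup>2) has_sum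
    T * (LINT w|lebesgue. (\<Sum>l\<in>{-L..L}. Re (g w * cnj (g (w + of_int l * T))) * (cos (\<theta> * (of_int l * T)) * (e w * e (w + of_int l * T)))))) UNIV"
proof -
  let ?q = "\<lambda>w. of_real (e w) * cis (\<theta> * w)"
  have [measurable]: "e \<in> borel_measurable lebesgue" by (rule em)
  have qm: "?q \<in> borel_measurable lebesgue" by measurable
  have p: "bcs (\<lambda>w. g w * ?q w)"
    by (rule bcs_bounded_mult[OF g qm, of K]) (use eK in \<open>simp add: norm_mult\<close>)
  have "Re ((g w * ?q w) * cnj (\<Sum>l\<in>{-L..L}. g (w + of_int l * T) * ?q (w + of_int l * T))) =
    (\<Sum>l\<in>{-L..L}. Re (g w * cnj (g (w + of_int l * T))) * (cos (\<theta> * (of_int l * T)) * (e w * e (w + of_int l * T))))" for w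
  proof -
    have "Re ((g w * ?q w) * cnj (g (w + of_int l * T) * ?q (w + of_int l * T))) =
      Re (g w * cnj (g (w + of_int l * T))) * (cos (\<theta> * (of_int l * T)) * (e w * e (w + of_int l * T)))" for l
    proof -
      \<comment> \<open>The phase of the window cancels up to the lattice shift, and the vanishing
        sine leaves a real factor.\<close>
      have "cis (\<theta> * w) * cnj (cis (\<theta> * (w + of_int l * T))) = cis (- (\<theta> * (of_int l * T)))"
        unfolding cis_cnj cis_mult by (simp add: algebra_simps)
      also have "\<dots> = of_real (cos (\<theta> * (of_int l * T)))"
        using th[of l] by (simp add: complex_eq_iff)
      finally have c: "cis (\<theta> * w) * cnj (cis (\<theta> * (w + of_int l * T))) = of_real (cos (\<theta> * (of_int l * T)))" .
      have "(g w * ?q w) * cnj (g (w + of_int l * T) * ?q (w + of_int l * T)) =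
        (g w * cnj (g (w + of_int l * T))) * (cis (\<theta> * w) * cnj (cis (\<theta> * (w + of_int l * T)))) * of_real (e w * e (w + of_int l * T))"
        by (simp add: mult_ac)
      also have "\<dots> = (g w * cnj (g (w + of_int l * T))) * of_real (cos (\<theta> * (of_int l * T)) * (e w * e (w + of_int l * T)))"
        unfolding c by simp
      also have "Re \<dots> = Re (g w * cnj (g (w + of_int l * T))) * (cos (\<theta> * (of_int l * T)) * (e w * e (w + of_int l * T)))"
        by (simp only: times_complex.sel Re_complex_of_real Im_complex_of_real mult_zero_right diff_zero)
      finally show ?thesis .
    qed
    then show ?thesis by (simp only: cnj_sum sum_distrib_left Re_sum)
  qed
  then show ?thesis
    using periodization_parseval[OF T p _ L R0] R by simp
qed

context decaying
begin

lemma corr_measurable: "corr a \<in> borel_measurable lebesgue"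
proof -
  have bij: "bij int_decode" by (rule bij_int_decode)
  have hm: "(\<lambda>w. h (w + c)) \<in> borel_measurable lebesgue" for c by (rule measurable_shift[OF meas])
  have "corr a = (\<lambda>w. \<Sum>k. h (w - of_int (int_decode k)) * h (w + a - of_int (int_decode k)))"
  proof
    fix w
    have "((\<lambda>k. h (w - of_int (int_decode k)) * h (w + a - of_int (int_decode k))) has_sum corr a w) UNIV"
      using corr_has_sum has_sum_reindex_bij_betw[OF bij, of "\<lambda>m. h (w - of_int m) * h (w + a - of_int m)"] by simp
    from has_sum_imp_sums[OF this]
    show "corr a w = (\<Sum>k. h (w - of_int (int_decode k)) * h (w + a - of_int (int_decode k)))" by (simp add: sums_iff)
  qed
  moreover have "(\<lambda>w. h (w - of_int (int_decode k)) * h (w + a - of_int (int_decode k))) \<in> borel_measurable lebesgue" for k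
    using hm[of "- of_int (int_decode k)"] hm[of "a - of_int (int_decode k)"] by (simp add: algebra_simps)
  ultimately show ?thesis by (simp only:) (rule borel_measurable_suminf)
qed

text \<open>Dominated exchange of the sum over modulations with the integral. The kernel
  \<open>\<kappa>\<close> is kept abstract because it is the plain product for the Gabor system and
  \<open>wkernel\<close> for the Wilson system; its bound is asked for on \<open>[-R, R]\<close>,
  where \<open>g\<close> lives.\<close>

lemma window_sum:
  assumes g: "bcs g" and R: "\<And>x. \<bar>x\<bar> > R \<Longrightarrow> g x = 0"
    and km: "\<And>m l. \<kappa> m l \<in> borel_measurable lebesgue"
    and kb: "\<And>m l w. \<bar>w\<bar> \<le> R \<Longrightarrow> \<bar>\<kappa> m l w\<bar> \<le> maj R m * C"
    and ks: "\<And>l w. ((\<lambda>m::int. \<kappa> m l w) has_sum S l w) UNIV"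
  shows "((\<lambda>m. LINT w|lebesgue. (\<Sum>l\<in>{-L..L}. Re (g w * cnj (g (w + of_int l * T))) * \<kappa> m l w)) has_sum
     (LINT w|lebesgue. (\<Sum>l\<in>{-L..L}. Re (g w * cnj (g (w + of_int l * T))) * S l w))) UNIV"
    and "integrable lebesgue (\<lambda>w. \<Sum>l\<in>{-L..L}. Re (g w * cnj (g (w + of_int l * T))) * \<kappa> m l w)"
proof -
  obtain K where K: "\<And>x. cmod (g x) \<le> K" using g by (rule bcsE) blast
  define A where "A = real (card {-L..L}) * (K * K * C)"
  let ?u = "\<lambda>m w. \<Sum>l\<in>{-L..L}. Re (g w * cnj (g (w + of_int l * T))) * \<kappa> m l w"
  have gm [measurable]: "g \<in> borel_measurable lebesgue" using g by (auto simp: bcs_def)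
  have [measurable]: "(\<lambda>w. g (w + c)) \<in> borel_measurable lebesgue" for c by (rule measurable_shift[OF gm])
  note [measurable] = km
  have um: "?u m \<in> borel_measurable lebesgue" for m by measurable
  have le: "norm (?u m w) \<le> maj R m * (A * indicat_real {-R..R} w)" for m w
  proof (cases "\<bar>w\<bar> \<le> R")
    case True
    have "\<bar>Re (g w * cnj (g (w + of_int l * T))) * \<kappa> m l w\<bar> \<le> (K * K) * (maj R m * C)" for l
      unfolding abs_mult using kb[OF True] bcs_lattice_bound[of g K, OF K] maj_nonneg C_nonneg
      by (intro mult_mono) auto
    then have "norm (?u m w) \<le> (\<Sum>l\<in>{-L..L}. (K * K) * (maj R m * C))"
      unfolding real_norm_def by (intro order_trans[OF sum_abs] sum_mono)
    also have "\<dots> = maj R m * A" by (simp add: A_def mult_ac)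
    also have "\<dots> = maj R m * (A * indicat_real {-R..R} w)" using True by (simp add: indicator_def abs_le_iff)
    finally show ?thesis .
  next
    case False
    then have "g w = 0" using R[of w] by simp
    moreover have "w \<notin> {-R..R}" using False by auto
    ultimately show ?thesis by simp
  qed
  have inf: "(\<Sum>\<^sub>\<infinity>m. ?u m w) = (\<Sum>l\<in>{-L..L}. Re (g w * cnj (g (w + of_int l * T))) * S l w)" for w
    by (intro infsumI has_sum_sum has_sum_cmult_right ks) simp
  from has_sum_integral(1)[OF um le maj_summable integrable_interval]
  show "((\<lambda>m. LINT w|lebesgue. ?u m w) has_sum
     (LINT w|lebesgue. (\<Sum>l\<in>{-L..L}. Re (g w * cnj (g (w + of_int l * T))) * S l w))) UNIV"
    unfolding inf .
  show "integrable lebesgue (?u m)"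
  proof (rule Bochner_Integration.integrable_bound[OF _ um])
    show "integrable lebesgue (\<lambda>w. maj R m * (A * indicat_real {-R..R} w))"
      by (intro integrable_mult_right integrable_interval)
    show "AE w in lebesgue. norm (?u m w) \<le> norm (maj R m * (A * indicat_real {-R..R} w))"
      unfolding real_norm_def[of "maj R m * _"] by (intro AE_I2 order_trans[OF le abs_ge_self])
  qed
qed

section \<open>Frame sums of the Gabor system\<close>

definition quad :: "real \<Rightarrow> int \<Rightarrow> (real \<Rightarrow> complex) \<Rightarrow> real" where
  "quad T L g = (LINT w|lebesgue. (\<Sum>l\<in>{-L..L}. Re (g w * cnj (g (w + of_int l * T))) * corr (of_int l * T) w))"

text \<open>Transform of the Gabor function with \<open>\<alpha> = 1\<close>: the translation by
  \<open>\<beta> j\<close> becomes an exponential, and the modulation by \<open>m\<close> then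
  translates everything, whence \<open>w - m\<close> in the phase as well.\<close>

definition gabor_hat :: "real \<Rightarrow> int \<Rightarrow> int \<Rightarrow> real \<Rightarrow> complex" where
  "gabor_hat \<beta> j m w = of_real (h (w - of_int m)) * cis (- 2 * pi * \<beta> * of_int j * (w - of_int m))"

lemma gabor_quad:
  assumes b: "\<beta> > 0" and g: "bcs g" and R: "\<And>x. \<bar>x\<bar> > R \<Longrightarrow> g x = 0" and R0: "R \<ge> 0"
    and L: "of_int L * (1 / \<beta>) \<ge> 2 * R"
  shows "((\<lambda>(j, m). (cmod (inner_L2 g (gabor_hat \<beta> j m)))\<^sup>2) has_sum (1 / \<beta>) * quad (1 / \<beta>) L g) UNIV"
proof (rule has_sum_pairs_nonneg)
  let ?T = "1 / \<beta>"
  let ?I = "\<lambda>m. LINT w|lebesgue. (\<Sum>l\<in>{-L..L}. Re (g w * cnj (g (w + of_int l * ?T))) * (h (w - of_int m) * h (w + of_int l * ?T - of_int m)))"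
  show "((\<lambda>m. ?T * ?I m) has_sum ?T * quad ?T L g) UNIV"
    unfolding quad_def
  proof (rule has_sum_cmult_right, rule window_sum(1)[OF g R])
    fix m l :: int
    show "(\<lambda>w. h (w - of_int m) * h (w + of_int l * ?T - of_int m)) \<in> borel_measurable lebesgue"
      using measurable_shift[OF meas, of "- of_int m"] measurable_shift[OF meas, of "of_int l * ?T - of_int m"]
      by (simp add: algebra_simps)
    fix w assume "\<bar>w\<bar> \<le> R"
    then show "\<bar>h (w - of_int m) * h (w + of_int l * ?T - of_int m)\<bar> \<le> maj R m * C"
      unfolding abs_mult by (intro mult_mono h_maj h_le maj_nonneg) auto
  next
    fix l :: int and w
    show "((\<lambda>m. h (w - of_int m) * h (w + of_int l * ?T - of_int m)) has_sum corr (of_int l * ?T) w) UNIV"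
      by (rule corr_has_sum)
  qed
  fix m :: int
  have "((\<lambda>j::int. (cmod (LINT w|lebesgue. g w * (of_real (h (w - of_int m)) * cis (0 * w)) * cis (2 * pi * of_int j * w / ?T)))\<^sup>2) has_sum
    ?T * (LINT w|lebesgue. (\<Sum>l\<in>{-L..L}. Re (g w * cnj (g (w + of_int l * ?T))) * (cos (0 * (of_int l * ?T)) * (h (w - of_int m) * h (w + of_int l * ?T - of_int m)))))) UNIV"
  proof (rule single_window_sum[OF _ g R R0 L])
    show "(\<lambda>w. h (w - of_int m)) \<in> borel_measurable lebesgue"
      using measurable_shift[OF meas, of "- of_int m"] by simp
  qed (use b h_le in auto)
  moreover have "cmod (LINT w|lebesgue. g w * (of_real (h (w - of_int m)) * cis (0 * w)) * cis (2 * pi * of_int j * w / ?T)) =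
      cmod (inner_L2 g (gabor_hat \<beta> j m))" for j
  proof -
    \<comment> \<open>The phase that depends on \<open>j\<close> and \<open>m\<close> alone has
      modulus 1 and drops out of the squared coefficients.\<close>
    have "g w * cnj (gabor_hat \<beta> j m w) = cis (- 2 * pi * \<beta> * of_int j * of_int m) *
       (g w * (of_real (h (w - of_int m)) * cis (0 * w)) * cis (2 * pi * of_int j * w / ?T))" for w
    proof -
      have "cis (- (- 2 * pi * \<beta> * of_int j * (w - of_int m))) =
          cis (- 2 * pi * \<beta> * of_int j * of_int m) * cis (2 * pi * of_int j * w / ?T)"
        unfolding cis_mult by (simp add: algebra_simps)
      then show ?thesis by (simp add: gabor_hat_def cis_cnj mult_ac)
    qed
    then show ?thesis
      unfolding inner_L2_def by (simp only: integral_mult_right_zero norm_mult norm_cis mult_1_left)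
  qed
  ultimately show "((\<lambda>j. case (j, m) of (j, m) \<Rightarrow> (cmod (inner_L2 g (gabor_hat \<beta> j m)))\<^sup>2) has_sum ?T * ?I m) UNIV"
    by simp
qed auto

section \<open>Frame sums of the Wilson system\<close>

definition wilson_hat :: "real \<Rightarrow> int \<Rightarrow> nat \<Rightarrow> real \<Rightarrow> complex" where
  "wilson_hat \<beta> j m w =
    (if m = 0 then of_real (sqrt (2 * \<beta>)) * gabor_hat \<beta> (2 * j) 0 w
     else of_real (sqrt \<beta>) * (cis (- 2 * pi * \<beta> * of_int j * real m) * gabor_hat \<beta> j (int m) w
       + (-1) powi (j + int m) * cis (2 * pi * \<beta> * of_int j * real m) * gabor_hat \<beta> j (- int m) w))"

lemma wilson_hat_0: "wilson_hat \<beta> j 0 w = of_real (sqrt (2 * \<beta>)) * (of_real (h w) * cis (- 2 * pi * \<beta> * of_int (2 * j) * w))"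
  by (simp add: wilson_hat_def gabor_hat_def)

text \<open>The phases built into \<open>wilson_X\<close> and \<open>wilson_Y\<close> cancel those
  produced by translating the exponentials. What remains is one exponential times a real window,
  \<open>h (w - m)\<close> plus or minus \<open>h (w + m)\<close>, the situation of
  \<open>single_window_sum\<close>.\<close>

lemma wilson_hat_pos:
  assumes "m \<noteq> 0"
  shows "wilson_hat \<beta> j m w = of_real (sqrt \<beta>) *
    (of_real (h (w - real m) + (if even (j + int m) then 1 else - 1) * h (w + real m)) * cis (- 2 * pi * \<beta> * of_int j * w))"
proof -
  have a: "cis (- 2 * pi * \<beta> * of_int j * real m) * gabor_hat \<beta> j (int m) w = of_real (h (w - real m)) * cis (- 2 * pi * \<beta> * of_int j * w)"
  proof -
    have "cis (- 2 * pi * \<beta> * of_int j * real m) * cis (- 2 * pi * \<beta> * of_int j * (w - of_int (int m))) = cis (- 2 * pi * \<beta> * of_int j * w)"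
      unfolding cis_mult by (simp add: algebra_simps)
    then show ?thesis by (simp add: gabor_hat_def mult_ac)
  qed
  have b: "cis (2 * pi * \<beta> * of_int j * real m) * gabor_hat \<beta> j (- int m) w = of_real (h (w + real m)) * cis (- 2 * pi * \<beta> * of_int j * w)"
  proof -
    have "cis (2 * pi * \<beta> * of_int j * real m) * cis (- 2 * pi * \<beta> * of_int j * (w - of_int (- int m))) = cis (- 2 * pi * \<beta> * of_int j * w)"
      unfolding cis_mult by (simp add: algebra_simps)
    then show ?thesis by (simp add: gabor_hat_def mult_ac)
  qed
  have c: "(-1 :: complex) powi k = of_real (if even k then 1 else - 1)" for k :: int
    by (simp add: power_int_minus_left)
  have "wilson_hat \<beta> j m w = of_real (sqrt \<beta>) * (cis (- 2 * pi * \<beta> * of_int j * real m) * gabor_hat \<beta> j (int m) w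
       + (-1) powi (j + int m) * (cis (2 * pi * \<beta> * of_int j * real m) * gabor_hat \<beta> j (- int m) w))"
    using assms by (simp only: wilson_hat_def if_False mult.assoc)
  then show ?thesis unfolding a b c by (simp add: algebra_simps)
qed

text \<open>For odd \<open>l\<close> the cross terms of the positive and the negative modulations survive instead of
  the diagonal ones; the reflection \<open>m \<mapsto> - n l - m\<close> changes their sign, since \<open>n l\<close> is odd.\<close>

definition wkernel :: "nat \<Rightarrow> int \<Rightarrow> int \<Rightarrow> real \<Rightarrow> real" where
  "wkernel n m l w = (if even l then h (w - of_int m) * h (w + of_int l * real n - of_int m)
     else (if even m then 1 else - 1) * (h (w - of_int m) * h (w + of_int l * real n + of_int m)))"

lemma wkernel_has_sum:
  assumes n: "odd n"
  shows "((\<lambda>m. wkernel n m l w) has_sum (if even l then corr (of_int l * real n) w else 0)) UNIV"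
proof (cases "even l")
  case True
  then show ?thesis using corr_has_sum[of w "of_int l * real n"] by (simp add: wkernel_def)
next
  case False
  let ?f = "\<lambda>m. wkernel n m l w"
  have "(\<lambda>m. norm (?f m)) summable_on UNIV"
  proof (rule Infinite_Sum.abs_summable_on_comparison_test')
    show "(\<lambda>m. maj \<bar>w\<bar> m * C) summable_on UNIV" by (intro summable_on_cmult_left maj_summable)
    fix m
    have "norm (?f m) = \<bar>h (w - of_int m)\<bar> * \<bar>h (w + of_int l * real n + of_int m)\<bar>"
      using False by (simp add: wkernel_def abs_mult)
    also have "\<dots> \<le> maj \<bar>w\<bar> m * C" by (intro mult_mono h_maj h_le maj_nonneg) auto
    finally show "norm (?f m) \<le> maj \<bar>w\<bar> m * C" .
  qed
  then have "?f summable_on UNIV" by (rule abs_summable_summable)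
  then obtain s where s: "(?f has_sum s) UNIV" by (auto simp: summable_on_def)
  have anti: "?f (- l * int n - m) = - ?f m" for m
  proof -
    have "even (- l * int n - m) \<longleftrightarrow> odd m" using False n by simp
    moreover have "w - of_int (- l * int n - m) = w + of_int l * real n + of_int m"
      "w + of_int l * real n + of_int (- l * int n - m) = w - of_int m"
      by simp_all
    ultimately show ?thesis using False unfolding wkernel_def by (simp only: if_False) (simp add: mult_ac)
  qed
  have "(?f has_sum s) UNIV \<longleftrightarrow> ((\<lambda>m. - ?f m) has_sum s) UNIV"
    by (rule has_sum_reindex_bij_witness[of _ "\<lambda>m. - l * int n - m" "\<lambda>m. - l * int n - m"]) (simp_all add: anti[simplified])
  then have "((\<lambda>m. - ?f m) has_sum s) UNIV" using s by simp
  moreover have "((\<lambda>m. - ?f m) has_sum (- s)) UNIV" using s by (simp add: has_sum_uminus)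
  ultimately have "s = - s" by (rule has_sum_unique)
  then have "s = 0" by simp
  then show ?thesis using s False by simp
qed

lemma sin_half_period:
  assumes "n > 0" "\<beta> = 1 / (2 * real n)"
  shows "sin (2 * pi * \<beta> * (of_int l * real n)) = 0"
    "cos (2 * pi * \<beta> * (of_int l * real n)) = (if even l then 1 else - 1)"
proof -
  have e: "2 * pi * \<beta> * (of_int l * real n) = pi * of_int l" using assms by simp
  show "sin (2 * pi * \<beta> * (of_int l * real n)) = 0" unfolding e by simp
  show "cos (2 * pi * \<beta> * (of_int l * real n)) = (if even l then 1 else - 1)" unfolding e by simp
qed

text \<open>The sign in the window depends on the parity of the shift, so the parities are treated
  separately. Within one parity the exponentials have frequencies \<open>j / n\<close>: Fourier
  series of period \<open>n\<close>, half the period \<open>2 n\<close> of the Gabor system.\<close>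

lemma wilson_hat_even_coeff:
  assumes n: "n > 0" and b: "\<beta> = 1 / (2 * real n)" and m: "m \<noteq> 0"
  shows "inner_L2 g (wilson_hat \<beta> (2 * j) m) = of_real (sqrt \<beta>) *
    (LINT w|lebesgue. g w * (of_real (h (w - real m) + (if even m then 1 else - 1) * h (w + real m)) * cis (0 * w)) * cis (2 * pi * of_int j * w / real n))"
proof -
  have "g w * cnj (wilson_hat \<beta> (2 * j) m w) = of_real (sqrt \<beta>) *
    (g w * (of_real (h (w - real m) + (if even m then 1 else - 1) * h (w + real m)) * cis (0 * w)) * cis (2 * pi * of_int j * w / real n))" for w
  proof -
    have "cnj (cis (- 2 * pi * \<beta> * of_int (2 * j) * w)) = cis (2 * pi * of_int j * w / real n)"
      using n unfolding cis_cnj b by (intro arg_cong[of _ _ cis]) simp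
    then show ?thesis unfolding wilson_hat_pos[OF m] complex_cnj_mult complex_cnj_complex_of_real by simp
  qed
  then show ?thesis unfolding inner_L2_def by (simp only: integral_mult_right_zero)
qed

text \<open>An odd shift leaves a surplus phase \<open>cis (2 * pi * \<beta> * w)\<close>; counted
  as part of the window it becomes the half frequency \<open>\<theta>\<close> of
  \<open>single_window_sum\<close>.\<close>

lemma wilson_hat_odd_coeff:
  assumes n: "n > 0" and b: "\<beta> = 1 / (2 * real n)" and m: "m \<noteq> 0"
  shows "inner_L2 g (wilson_hat \<beta> (2 * j + 1) m) = of_real (sqrt \<beta>) *
    (LINT w|lebesgue. g w * (of_real (h (w - real m) - (if even m then 1 else - 1) * h (w + real m)) * cis (2 * pi * \<beta> * w)) * cis (2 * pi * of_int j * w / real n))"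
proof -
  have "g w * cnj (wilson_hat \<beta> (2 * j + 1) m w) = of_real (sqrt \<beta>) *
    (g w * (of_real (h (w - real m) - (if even m then 1 else - 1) * h (w + real m)) * cis (2 * pi * \<beta> * w)) * cis (2 * pi * of_int j * w / real n))" for w
  proof -
    have "cnj (cis (- 2 * pi * \<beta> * of_int (2 * j + 1) * w)) = cis (2 * pi * \<beta> * w) * cis (2 * pi * of_int j * w / real n)"
      using n unfolding cis_cnj cis_mult b by (intro arg_cong[of _ _ cis]) (simp add: field_simps)
    then show ?thesis unfolding wilson_hat_pos[OF m] complex_cnj_mult complex_cnj_complex_of_real by simp
  qed
  then show ?thesis unfolding inner_L2_def by (simp only: integral_mult_right_zero)
qed

text \<open>For \<open>m = 0\<close> only translates by \<open>2 j\<close> occur, so a single family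
  already runs through all exponentials of period \<open>n\<close>.\<close>

lemma wilson_hat_zero_coeff:
  assumes n: "n > 0" and b: "\<beta> = 1 / (2 * real n)"
  shows "inner_L2 g (wilson_hat \<beta> j 0) = of_real (sqrt (2 * \<beta>)) *
    (LINT w|lebesgue. g w * (of_real (h w) * cis (0 * w)) * cis (2 * pi * of_int j * w / real n))"
proof -
  have "g w * cnj (wilson_hat \<beta> j 0 w) = of_real (sqrt (2 * \<beta>)) *
    (g w * (of_real (h w) * cis (0 * w)) * cis (2 * pi * of_int j * w / real n))" for w
  proof -
    have "cnj (cis (- 2 * pi * \<beta> * of_int (2 * j) * w)) = cis (2 * pi * of_int j * w / real n)"
      using n unfolding cis_cnj b by (intro arg_cong[of _ _ cis]) simp
    then show ?thesis unfolding wilson_hat_0 complex_cnj_mult complex_cnj_complex_of_real by simp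
  qed
  then show ?thesis unfolding inner_L2_def by (simp only: integral_mult_right_zero)
qed

text \<open>Even shifts contribute with window sign \<open>s\<close>, odd ones with
  \<open>- s\<close> and the alternating factor in \<open>l\<close>. For even \<open>l\<close> the
  cross terms cancel, for odd \<open>l\<close> the diagonal ones, and what remains is counted
  twice.\<close>

lemma wkernel_fold:
  fixes m :: nat
  defines "s \<equiv> (if even m then 1 else - 1)"
  shows "(h (w - real m) + s * h (w + real m)) * (h (w + of_int l * real n - real m) + s * h (w + of_int l * real n + real m))
     + (if even l then 1 else - 1) * ((h (w - real m) - s * h (w + real m)) * (h (w + of_int l * real n - real m) - s * h (w + of_int l * real n + real m)))
   = 2 * (wkernel n (int m) l w + wkernel n (- int m) l w)"
proof -
  have s: "s * s = 1" "(if even (int m) then 1 else - 1) = s" "(if even (- int m) then 1 else - 1) = s" by (auto simp: s_def)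
  show ?thesis
  proof (cases "even l")
    case True
    then show ?thesis using s(1) by (simp add: wkernel_def algebra_simps)
  next
    case False
    have w: "wkernel n (int m) l w = s * (h (w - real m) * h (w + of_int l * real n + real m))"
      "wkernel n (- int m) l w = s * (h (w + real m) * h (w + of_int l * real n - real m))"
      using False unfolding wkernel_def s(2,3) by simp_all
    show ?thesis unfolding w using False by (simp add: algebra_simps)
  qed
qed

lemma wilson_quad:
  assumes n: "odd n" and b: "\<beta> = 1 / (2 * real n)" and g: "bcs g"
    and R: "\<And>x. \<bar>x\<bar> > R \<Longrightarrow> g x = 0" and R0: "R \<ge> 0" and L: "of_int L * (2 * real n) \<ge> 2 * R"
  shows "((\<lambda>(j, m). (cmod (inner_L2 g (wilson_hat \<beta> j m)))\<^sup>2) has_sum quad (2 * real n) L g) UNIV"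
proof (rule has_sum_pairs_nonneg)
  have n0: "n > 0" using n by (cases n) auto
  have b0: "\<beta> > 0" using b n0 by simp
  have bn: "\<beta> * real n = 1 / 2" using b n0 by simp
  let ?G = "\<lambda>w l. Re (g w * cnj (g (w + of_int l * real n)))"
  let ?W = "\<lambda>c e. LINT w|lebesgue. (\<Sum>l\<in>{-(2*L)..2*L}. ?G w l * (c l * (e w * e (w + of_int l * real n))))"
  let ?Z = "\<lambda>\<theta> e j. cmod (LINT w|lebesgue. g w * (of_real (e w) * cis (\<theta> * w)) * cis (2 * pi * of_int j * w / real n))"
  let ?c0 = "\<lambda>l::int. cos (0 * (of_int l * real n))"
  let ?c1 = "\<lambda>l::int. cos (2 * pi * \<beta> * (of_int l * real n))"
  define I where "I m = (LINT w|lebesgue. (\<Sum>l\<in>{-(2*L)..2*L}. ?G w l * wkernel n m l w))" for m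
  have hm: "(\<lambda>w. h (w + c)) \<in> borel_measurable lebesgue" for c by (rule measurable_shift[OF meas])
  have km: "wkernel n m l \<in> borel_measurable lebesgue" for m l
    using hm[of "- of_int m"] hm[of "of_int l * real n - of_int m"] hm[of "of_int l * real n + of_int m"]
    unfolding wkernel_def[abs_def] by (cases "even l") (auto simp: algebra_simps)
  have kb: "\<bar>wkernel n m l w\<bar> \<le> maj R m * C" if "\<bar>w\<bar> \<le> R" for m l w
  proof -
    have "\<bar>h (w - of_int m)\<bar> * \<bar>h v\<bar> \<le> maj R m * C" for v
      using that by (intro mult_mono h_maj h_le maj_nonneg) auto
    then show ?thesis unfolding wkernel_def by (auto simp: abs_mult)
  qed
  \<comment> \<open>\<open>2 L\<close> steps of length \<open>n\<close> reach as far as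
    \<open>L\<close> steps of length \<open>2 n\<close>.\<close>
  note ws = window_sum[OF g R km kb wkernel_has_sum[OF n], where T="real n" and L="2 * L"]
  have "(I has_sum (LINT w|lebesgue. (\<Sum>l\<in>{-(2*L)..2*L}. ?G w l * (if even l then corr (of_int l * real n) w else 0)))) UNIV"
    unfolding I_def by (rule ws(1))
  \<comment> \<open>Only even indices survived the sum over \<open>m\<close>; halving them turns
    steps of \<open>n\<close> into steps of \<open>2 n\<close>, and the Gabor form appears.\<close>
  also have "(\<lambda>w. \<Sum>l\<in>{-(2*L)..2*L}. ?G w l * (if even l then corr (of_int l * real n) w else 0)) =
      (\<lambda>w. \<Sum>l\<in>{-L..L}. Re (g w * cnj (g (w + of_int l * (2 * real n)))) * corr (of_int l * (2 * real n)) w)"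
  proof
    fix w
    have "(\<Sum>l\<in>{-(2*L)..2*L}. ?G w l * (if even l then corr (of_int l * real n) w else 0)) =
       (\<Sum>l\<in>(\<lambda>l. 2 * l) ` {-L..L}. ?G w l * corr (of_int l * real n) w)"
    proof (rule sum.mono_neutral_cong_right)
      show "\<forall>i\<in>{-(2*L)..2*L} - (\<lambda>l. 2 * l) ` {-L..L}. ?G w i * (if even i then corr (of_int i * real n) w else 0) = 0"
        by (auto elim!: evenE)
    qed auto
    also have "\<dots> = (\<Sum>l\<in>{-L..L}. Re (g w * cnj (g (w + of_int l * (2 * real n)))) * corr (of_int l * (2 * real n)) w)"
      by (subst sum.reindex) (auto simp: inj_on_def mult_ac)
    finally show "(\<Sum>l\<in>{-(2*L)..2*L}. ?G w l * (if even l then corr (of_int l * real n) w else 0)) =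
      (\<Sum>l\<in>{-L..L}. Re (g w * cnj (g (w + of_int l * (2 * real n)))) * corr (of_int l * (2 * real n)) w)" .
  qed
  finally have "(I has_sum quad (2 * real n) L g) UNIV" by (simp only: quad_def)
  then show "((\<lambda>m. if m = 0 then I 0 else I (int m) + I (- int m)) has_sum quad (2 * real n) L g) UNIV"
    by (rule has_sum_int_fold)
  fix m :: nat
  have L2: "of_int (2 * L) * real n \<ge> 2 * R" using L by (simp add: mult_ac)
  have n0': "real n > 0" using n0 by simp
  show "((\<lambda>j. case (j, m) of (j, m) \<Rightarrow> (cmod (inner_L2 g (wilson_hat \<beta> j m)))\<^sup>2) has_sum (if m = 0 then I 0 else I (int m) + I (- int m))) UNIV"
  proof (cases "m = 0")
    case True
    have "((\<lambda>j::int. (?Z 0 h j)\<^sup>2) has_sum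
      real n * (?W ?c0 h)) UNIV"
      by (rule single_window_sum[OF n0' g R R0 L2 meas h_le]) auto
    then have "((\<lambda>j::int. (2 * \<beta>) * (?Z 0 h j)\<^sup>2) has_sum
      (2 * \<beta>) * (real n * (?W ?c0 h))) UNIV"
      by (rule has_sum_cmult_right)
    moreover have "?W ?c0 h = I 0"
      unfolding I_def by (intro Bochner_Integration.integral_cong sum.cong) (auto simp: wkernel_def)
    \<comment> \<open>The normalisation \<open>sqrt (2 * \<beta>)\<close> of the functions with
      \<open>m = 0\<close> cancels the period exactly, as \<open>2 \<beta> n = 1\<close>.\<close>
    moreover have "(2 * \<beta>) * (real n * I 0) = I 0" using bn by (simp add: mult.assoc[symmetric])
    moreover have "(2 * \<beta>) * (?Z 0 h j)\<^sup>2 =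
        (cmod (inner_L2 g (wilson_hat \<beta> j m)))\<^sup>2" for j
      unfolding True wilson_hat_zero_coeff[OF n0 b] norm_mult power_mult_distrib using b0 by simp
    ultimately show ?thesis by (simp only: True prod.case simp_thms if_True)
  next
    case False
    define s where "s = (if even m then 1 else - 1 :: real)"
    have s1: "\<bar>s\<bar> = 1" by (simp add: s_def)
    let ?p = "\<lambda>w. h (w - real m) + s * h (w + real m)"
    let ?q = "\<lambda>w. h (w - real m) - s * h (w + real m)"
    have pm: "?p \<in> borel_measurable lebesgue" "?q \<in> borel_measurable lebesgue"
      using hm[of "- real m"] hm[of "real m"] by auto
    have sh: "\<bar>s * h x\<bar> \<le> C" for x using h_le[of x] by (simp add: abs_mult s1)
    have pK: "\<bar>?p x\<bar> \<le> C + C" "\<bar>?q x\<bar> \<le> C + C" for x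
      using h_le[of "x - real m"] sh[of "x + real m"] by linarith+
    let ?A = "?W ?c0 ?p"
    let ?B = "?W ?c1 ?q"
    have "((\<lambda>j::int. (?Z 0 ?p j)\<^sup>2) has_sum real n * ?A) UNIV"
      by (rule single_window_sum[OF n0' g R R0 L2 pm(1) pK(1)]) auto
    then have "((\<lambda>j::int. \<beta> * (?Z 0 ?p j)\<^sup>2) has_sum \<beta> * (real n * ?A)) UNIV"
      by (rule has_sum_cmult_right)
    moreover have "\<beta> * (?Z 0 ?p j)\<^sup>2 =
        (cmod (inner_L2 g (wilson_hat \<beta> (2 * j) m)))\<^sup>2" for j
      unfolding wilson_hat_even_coeff[OF n0 b False] norm_mult power_mult_distrib s_def using b0 by simp
    ultimately have A: "((\<lambda>j. (cmod (inner_L2 g (wilson_hat \<beta> (2 * j) m)))\<^sup>2) has_sum \<beta> * (real n * ?A)) UNIV" by simp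
    have "((\<lambda>j::int. (?Z (2 * pi * \<beta>) ?q j)\<^sup>2) has_sum real n * ?B) UNIV"
      by (rule single_window_sum[OF n0' g R R0 L2 pm(2) pK(2) sin_half_period(1)[OF n0 b]])
    then have "((\<lambda>j::int. \<beta> * (?Z (2 * pi * \<beta>) ?q j)\<^sup>2) has_sum \<beta> * (real n * ?B)) UNIV"
      by (rule has_sum_cmult_right)
    moreover have "\<beta> * (?Z (2 * pi * \<beta>) ?q j)\<^sup>2 =
        (cmod (inner_L2 g (wilson_hat \<beta> (2 * j + 1) m)))\<^sup>2" for j
      unfolding wilson_hat_odd_coeff[OF n0 b False] norm_mult power_mult_distrib s_def using b0 by simp
    ultimately have B: "((\<lambda>j. (cmod (inner_L2 g (wilson_hat \<beta> (2 * j + 1) m)))\<^sup>2) has_sum \<beta> * (real n * ?B)) UNIV" by simp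
    have "((\<lambda>j. (cmod (inner_L2 g (wilson_hat \<beta> j m)))\<^sup>2) has_sum \<beta> * (real n * ?A) + \<beta> * (real n * ?B)) UNIV"
      using A B by (rule has_sum_int_parity)
    \<comment> \<open>Here \<open>\<beta> n = 1 / 2\<close> absorbs the factor 2 of
      \<open>wkernel_fold\<close>.\<close>
    moreover have "\<beta> * (real n * ?A) + \<beta> * (real n * ?B) = I (int m) + I (- int m)"
    proof -
      have gm: "g \<in> borel_measurable lebesgue" using g by (auto simp: bcs_def)
      have int: "integrable lebesgue (\<lambda>w. \<Sum>l\<in>{-(2*L)..2*L}. ?G w l * (c l * (e w * e (w + of_int l * real n))))"
        if em: "e \<in> borel_measurable lebesgue" and eK: "\<And>x. \<bar>e x\<bar> \<le> C + C" for e :: "real \<Rightarrow> real" and c :: "int \<Rightarrow> real"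
      proof (rule Bochner_Integration.integrable_sum)
        fix l
        obtain K where K: "\<And>x. cmod (g x) \<le> K" using g by (rule bcsE) blast
        have [measurable]: "(\<lambda>w. g (w + c)) \<in> borel_measurable lebesgue" "(\<lambda>w. e (w + c)) \<in> borel_measurable lebesgue" for c
          by (rule measurable_shift[OF gm]) (rule measurable_shift[OF em])
        note [measurable] = gm em
        show "integrable lebesgue (\<lambda>w. ?G w l * (c l * (e w * e (w + of_int l * real n))))"
        proof (rule bounded_supp_integrable)
          show "norm (?G w l * (c l * (e w * e (w + of_int l * real n)))) \<le> (K * K) * (\<bar>c l\<bar> * ((C + C) * (C + C)))" for w
            unfolding real_norm_def abs_mult using bcs_lattice_bound[of g K, OF K] eK C_nonneg
            by (intro mult_mono) (auto simp: abs_mult[symmetric])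
          show "?G w l * (c l * (e w * e (w + of_int l * real n))) = 0" if "\<bar>w\<bar> > R" for w
            using R[OF that] by simp
        qed measurable
      qed
      have "\<beta> * (real n * a) + \<beta> * (real n * b) = (a + b) / 2" for a b
        unfolding mult.assoc[symmetric] bn by simp
      then have "\<beta> * (real n * ?A) + \<beta> * (real n * ?B) = (?A + ?B) / 2" .
      also have "?A + ?B = (LINT w|lebesgue. (\<Sum>l\<in>{-(2*L)..2*L}. ?G w l * (?c0 l * (?p w * ?p (w + of_int l * real n))))
          + (\<Sum>l\<in>{-(2*L)..2*L}. ?G w l * (?c1 l * (?q w * ?q (w + of_int l * real n)))))"
        by (rule Bochner_Integration.integral_add[symmetric, OF int[OF pm(1) pK(1)] int[OF pm(2) pK(2)]])
      also have "\<dots> = (LINT w|lebesgue. 2 * ((\<Sum>l\<in>{-(2*L)..2*L}. ?G w l * wkernel n (int m) l w) + (\<Sum>l\<in>{-(2*L)..2*L}. ?G w l * wkernel n (- int m) l w)))"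
      proof (rule Bochner_Integration.integral_cong[OF refl])
        fix w
        have "?G w l * (?c0 l * (?p w * ?p (w + of_int l * real n)))
           + ?G w l * (?c1 l * (?q w * ?q (w + of_int l * real n)))
           = 2 * (?G w l * wkernel n (int m) l w + ?G w l * wkernel n (- int m) l w)" for l
        proof -
          have "?G w l * (?c0 l * (?p w * ?p (w + of_int l * real n)))
             + ?G w l * (?c1 l * (?q w * ?q (w + of_int l * real n)))
             = ?G w l * (?p w * ?p (w + of_int l * real n) + (if even l then 1 else - 1) * (?q w * ?q (w + of_int l * real n)))"
            unfolding sin_half_period(2)[OF n0 b] mult_zero_left cos_zero mult_1_left by (rule distrib_left[symmetric])
          also have "\<dots> = ?G w l * (2 * (wkernel n (int m) l w + wkernel n (- int m) l w))"
            using wkernel_fold[of w m l n] unfolding s_def by (rule arg_cong)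
          finally show ?thesis by (simp only: distrib_left mult.left_commute)
        qed
        then show "(\<Sum>l\<in>{-(2*L)..2*L}. ?G w l * (?c0 l * (?p w * ?p (w + of_int l * real n))))
          + (\<Sum>l\<in>{-(2*L)..2*L}. ?G w l * (?c1 l * (?q w * ?q (w + of_int l * real n)))) =
          2 * ((\<Sum>l\<in>{-(2*L)..2*L}. ?G w l * wkernel n (int m) l w) + (\<Sum>l\<in>{-(2*L)..2*L}. ?G w l * wkernel n (- int m) l w))"
          by (simp only: sum.distrib[symmetric] sum_distrib_left)
      qed
      also have "\<dots> = 2 * (I (int m) + I (- int m))"
        unfolding I_def integral_mult_right_zero
        by (rule arg_cong[of _ _ "\<lambda>x. 2 * x"], rule Bochner_Integration.integral_add[OF ws(2) ws(2)])
      finally show ?thesis by simp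
    qed
    ultimately show ?thesis using False by simp
  qed
qed auto

end

section \<open>Tightness and correlations\<close>

text \<open>The test sets are those where \<open>f\<close> is positive or negative within one unit
  interval. Unit intervals are chosen because their subsets are disjoint from their translates by
  nonzero multiples of any \<open>T \<ge> 1\<close>.\<close>

lemma AE_zero_of_integrals:
  fixes f :: "real \<Rightarrow> real"
  assumes fm: "f \<in> borel_measurable lebesgue" and fb: "\<And>R. \<exists>K. \<forall>w. \<bar>w\<bar> \<le> R \<longrightarrow> \<bar>f w\<bar> \<le> K"
    and z: "\<And>(a::int) S. S \<in> sets lebesgue \<Longrightarrow> S \<subseteq> {of_int a..<of_int a + 1} \<Longrightarrow> (LINT w|lebesgue. indicat_real S w * f w) = 0"
  shows "AE w in lebesgue. f w = 0"
proof -
  note [measurable] = fm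
  have *: "AE w in lebesgue. w \<in> {of_int a..<of_int a + 1} \<longrightarrow> \<not> s * f w > 0" if s: "s \<noteq> 0" for a :: int and s :: real
  proof -
    define S where "S = {w \<in> space lebesgue. w \<in> {of_int a..<of_int a + 1} \<and> s * f w > 0}"
    have Sm [measurable]: "S \<in> sets lebesgue" unfolding S_def by measurable
    have Sa: "S \<subseteq> {of_int a..<of_int a + 1}" by (auto simp: S_def)
    obtain K where K: "\<And>w. \<bar>w\<bar> \<le> \<bar>of_int a\<bar> + 1 \<Longrightarrow> \<bar>f w\<bar> \<le> K" using fb[of "\<bar>of_int a\<bar> + 1"] by blast
    have Sb: "\<bar>w\<bar> \<le> \<bar>of_int a\<bar> + 1" if "w \<in> S" for w
    proof -
      have "w \<in> {of_int a..<of_int a + 1}" using Sa that by blast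
      then show ?thesis by simp linarith
    qed
    have K0: "K \<ge> 0" using K[of 0] by simp
    have "integrable lebesgue (\<lambda>w. indicat_real S w * f w)"
    proof (rule bounded_supp_integrable[where K=K and R="\<bar>of_int a\<bar> + 1"])
      show "norm (indicat_real S w * f w) \<le> K" for w using K[of w] Sb[of w] K0 by (cases "w \<in> S") auto
      show "indicat_real S w * f w = 0" if "\<bar>w\<bar> > \<bar>of_int a\<bar> + 1" for w using Sb[of w] that by (cases "w \<in> S") auto
    qed measurable
    then have int: "integrable lebesgue (\<lambda>w. s * (indicat_real S w * f w))" by simp
    have "(LINT w|lebesgue. s * (indicat_real S w * f w)) = 0" using z[OF Sm Sa] by simp
    then have "AE w in lebesgue. s * (indicat_real S w * f w) = 0"
      using integral_nonneg_eq_0_iff_AE[OF int] by (auto simp: S_def indicator_def)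
    then show ?thesis by eventually_elim (auto simp: S_def indicator_def)
  qed
  have "AE w in lebesgue. \<forall>a::int. (w \<in> {of_int a..<of_int a + 1} \<longrightarrow> \<not> 1 * f w > 0) \<and> (w \<in> {of_int a..<of_int a + 1} \<longrightarrow> \<not> - 1 * f w > 0)"
    unfolding AE_all_countable by (intro allI AE_conjI *) auto
  then show ?thesis
  proof eventually_elim
    case (elim w)
    then show ?case using elim[rule_format, of "\<lfloor>w\<rfloor>"] by auto
  qed
qed

context decaying
begin

lemma corr_bound: "\<exists>K. \<forall>w. \<bar>w\<bar> \<le> R \<longrightarrow> \<bar>corr a w\<bar> \<le> K"
proof (intro exI allI impI)
  fix w assume w: "\<bar>w\<bar> \<le> R"
  have sm: "(\<lambda>m. maj R m * C) summable_on UNIV" by (intro summable_on_cmult_left maj_summable)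
  have le: "norm (h (w - of_int m) * h (w + a - of_int m)) \<le> maj R m * C" for m
    unfolding real_norm_def abs_mult by (intro mult_mono h_maj h_le maj_nonneg w) auto
  have "norm (corr a w) \<le> (\<Sum>\<^sub>\<infinity>m. maj R m * C)"
    by (rule norm_infsum_le[OF corr_has_sum has_sum_infsum[OF sm]]) (rule le)
  then show "\<bar>corr a w\<bar> \<le> (\<Sum>\<^sub>\<infinity>m. maj R m * C)" by simp
qed

text \<open>Makes the two mixed terms, at \<open>l\<close> and at \<open>- l\<close>, of the
  quadratic form of two translated indicators coincide after a shift.\<close>

lemma corr_reflect: "corr (- a) (w + a) = corr a w"
  unfolding corr_def by (simp add: mult.commute add.commute)

lemma indicator_lattice_disjoint:
  fixes T w :: real and a k :: int
  assumes T: "T \<ge> 1" and S: "S \<subseteq> {of_int a..<of_int a + 1}"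
  shows "indicat_real S w * indicat_real S (w + of_int k * T) = (if k = 0 then indicat_real S w else 0)"
proof (cases "k = 0")
  case False
  have "\<not> (w \<in> S \<and> w + of_int k * T \<in> S)"
  proof
    assume "w \<in> S \<and> w + of_int k * T \<in> S"
    then have "w \<in> {of_int a..<of_int a + 1}" "w + of_int k * T \<in> {of_int a..<of_int a + 1}" using S by blast+
    then have "\<bar>of_int k * T\<bar> < 1" by simp linarith
    moreover have "\<bar>of_int k\<bar> \<ge> (1::real)" using False by linarith
    then have "1 * 1 \<le> \<bar>of_int k\<bar> * \<bar>T\<bar>" using T by (intro mult_mono) auto
    ultimately show False by (simp add: abs_mult)
  qed
  then show ?thesis using False by (auto simp: indicator_def)
qed (simp add: indicator_def)

text \<open>The converse is polarization: the indicator of \<open>S\<close> isolates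
  \<open>corr 0\<close>, and adding the indicator of its translate by \<open>l T\<close> brings in
  the correlations at \<open>l\<close> and \<open>- l\<close> as the only new kind of term. The
  frame enters through its quadratic form alone, so that the Gabor and the Wilson system share the
  proof with different \<open>A\<close>.\<close>

lemma tight_iff_corr:
  fixes e :: "'i::countable \<Rightarrow> real \<Rightarrow> complex"
  assumes A: "A > 0" and T: "T \<ge> 1" and e: "\<And>i. e i \<in> L2"
    and q: "\<And>g R L. bcs g \<Longrightarrow> (\<And>x. \<bar>x\<bar> > R \<Longrightarrow> g x = 0) \<Longrightarrow> R \<ge> 0 \<Longrightarrow> of_int L * T \<ge> 2 * R \<Longrightarrow>
      ((\<lambda>i. (cmod (inner_L2 g (e i)))\<^sup>2) has_sum A * quad T L g) UNIV"
  shows "tight_frame A e \<longleftrightarrow> (\<forall>l::int. AE w in lebesgue. corr (of_int l * T) w = (if l = 0 then 1 else 0))"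
    (is "_ \<longleftrightarrow> ?D")
proof
  have exL: "\<exists>L::int. of_int L * T \<ge> B" for B
  proof -
    obtain n where "real n \<ge> B / T" using real_arch_simple by blast
    then show ?thesis using T by (intro exI[of _ "int n"]) (simp add: field_simps)
  qed
  assume D: ?D
  let ?F = "\<lambda>g l w. Re (g w * cnj (g (w + of_int l * T))) * corr (of_int l * T) w"
  show "tight_frame A e"
  proof (rule tight_frame_dense[where D="{g. bcs g}"])
    show "\<exists>g. g \<in> {g. bcs g} \<and> g \<in> L2 \<and> norm_L2 (\<lambda>x. f x - g x) < \<epsilon>" if "f \<in> L2" "\<epsilon> > 0" for f \<epsilon>
      using dense_truncation[OF that] bcs_L2 by blast
    fix g assume "g \<in> {g. bcs g}"
    then have g: "bcs g" by simp
    obtain R where R: "R > 0" "\<And>x. \<bar>x\<bar> > R \<Longrightarrow> g x = 0" and gm: "g \<in> borel_measurable lebesgue" using g by (rule bcsE) blast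
    obtain L :: int where L: "of_int L * T \<ge> 2 * R" using exL by blast
    have "0 < of_int L * T" using L R(1) by linarith
    then have L0: "L \<ge> 0" using T by (simp add: zero_less_mult_iff)
    have [measurable]: "(\<lambda>w. g (w + c)) \<in> borel_measurable lebesgue" for c by (rule measurable_shift[OF gm])
    note [measurable] = gm corr_measurable
    have "AE w in lebesgue. \<forall>l::int. corr (of_int l * T) w = (if l = 0 then 1 else 0)"
      by (subst AE_all_countable) (rule D)
    then have "AE w in lebesgue. (\<Sum>l\<in>{-L..L}. ?F g l w) = (cmod (g w))\<^sup>2"
    proof eventually_elim
      case (elim w)
      have "(\<Sum>l\<in>{-L..L}. ?F g l w) =
          (\<Sum>l\<in>{-L..L}. if l = 0 then Re (g w * cnj (g w)) else 0)"
        using elim by (intro sum.cong) auto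
      also have "\<dots> = Re (g w * cnj (g w))" using L0 by (subst sum.delta) auto
      also have "\<dots> = (cmod (g w))\<^sup>2" by (simp add: cmod_power2) (simp add: power2_eq_square)
      finally show ?case .
    qed
    then have "quad T L g = (norm_L2 g)\<^sup>2"
      unfolding quad_def norm_L2_sq by (intro integral_cong_AE) measurable
    then show "((\<lambda>i. (cmod (inner_L2 g (e i)))\<^sup>2) has_sum A * (norm_L2 g)\<^sup>2) UNIV"
      using q[OF g R(2) _ L] R(1) by simp
  qed (use A e in auto)
next
  have exL: "\<exists>L::int. of_int L * T \<ge> B \<and> L \<ge> c" for B and c :: int
  proof -
    obtain n where n: "real n \<ge> max (B / T) (of_int c)" using real_arch_simple by blast
    then have "real n \<ge> B / T" "int n \<ge> c" by linarith+
    then show ?thesis using T by (intro exI[of _ "int n"]) (simp add: field_simps)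
  qed
  assume t: "tight_frame A e"
  let ?F = "\<lambda>g l w. Re (g w * cnj (g (w + of_int l * T))) * corr (of_int l * T) w"
  have Q: "quad T L g = (norm_L2 g)\<^sup>2" if g: "bcs g" "\<And>x. \<bar>x\<bar> > R \<Longrightarrow> g x = 0" "R \<ge> 0" "of_int L * T \<ge> 2 * R" for g R L
  proof -
    have "((\<lambda>i. (cmod (inner_L2 g (e i)))\<^sup>2) has_sum A * (norm_L2 g)\<^sup>2) UNIV"
      using t bcs_L2[OF g(1)] by (simp add: tight_frame_def)
    from has_sum_unique[OF q[OF g] this] show ?thesis using A by simp
  qed
  note [measurable] = corr_measurable
  have intS: "integrable lebesgue (\<lambda>w. indicat_real S w * corr c w)"
    if [measurable]: "S \<in> sets lebesgue" and S: "S \<subseteq> {-R..R}" for S R c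
  proof -
    obtain K where K: "\<And>w. \<bar>w\<bar> \<le> \<bar>R\<bar> \<Longrightarrow> \<bar>corr c w\<bar> \<le> K" using corr_bound[of "\<bar>R\<bar>" c] by blast
    have K0: "K \<ge> 0" using K[of 0] by simp
    have Sb: "\<bar>w\<bar> \<le> \<bar>R\<bar>" if "w \<in> S" for w
    proof -
      have "w \<in> {-R..R}" using S that by blast
      then show ?thesis by simp linarith
    qed
    show ?thesis
    proof (rule bounded_supp_integrable[where K=K and R="\<bar>R\<bar>"])
      show "norm (indicat_real S w * corr c w) \<le> K" for w using K[of w] Sb[of w] K0 by (cases "w \<in> S") auto
      show "indicat_real S w * corr c w = 0" if "\<bar>w\<bar> > \<bar>R\<bar>" for w using Sb[of w] that by (cases "w \<in> S") auto
    qed measurable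
  qed
  have intS1: "integrable lebesgue (indicat_real S)"
    if [measurable]: "S \<in> sets lebesgue" and S: "S \<subseteq> {-R..R}" for S and R :: real
  proof (rule bounded_supp_integrable[where K=1 and R="\<bar>R\<bar>"])
    show "indicat_real S x = 0" if "\<bar>x\<bar> > \<bar>R\<bar>" for x
    proof -
      have "x \<notin> {-R..R}" using that by auto
      then show ?thesis using S by (auto simp: indicator_def)
    qed
  qed (auto simp: indicator_def)
  have D0: "AE w in lebesgue. corr 0 w = 1"
  proof -
    have "AE w in lebesgue. corr 0 w - 1 = 0"
    proof (rule AE_zero_of_integrals)
      show "\<exists>K. \<forall>w. \<bar>w\<bar> \<le> R \<longrightarrow> \<bar>corr 0 w - 1\<bar> \<le> K" for R
      proof -
        obtain K where "\<And>w. \<bar>w\<bar> \<le> R \<Longrightarrow> \<bar>corr 0 w\<bar> \<le> K" using corr_bound[of R 0] by blast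
        then show ?thesis by (intro exI[of _ "K + 1"]) force
      qed
      fix a :: int and S :: "real set" assume S [measurable]: "S \<in> sets lebesgue" and Sa: "S \<subseteq> {of_int a..<of_int a + 1}"
      define R where "R = \<bar>real_of_int a\<bar> + 1"
      have SR: "S \<subseteq> {-R..R}"
      proof
        fix w assume "w \<in> S"
        then have "w \<in> {of_int a..<of_int a + 1}" using Sa by blast
        then show "w \<in> {-R..R}" unfolding R_def by simp linarith
      qed
      define g where "g w = complex_of_real (indicat_real S w)" for w
      have g0: "g x = 0" if "\<bar>x\<bar> > R" for x
      proof -
        have "x \<notin> {-R..R}" using that by auto
        then show ?thesis using SR by (auto simp: g_def indicator_def)
      qed
      have gm: "g \<in> borel_measurable lebesgue" unfolding g_def by measurable
      have "cmod (g x) \<le> 1" for x by (simp add: g_def indicator_def)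
      then have g: "bcs g" unfolding bcs_def using gm g0 by blast
      obtain L :: int where L: "of_int L * T \<ge> 2 * R" "L \<ge> 0" using exL by blast
      have "quad T L g = (LINT w|lebesgue. indicat_real S w * corr 0 w)"
        unfolding quad_def
      proof (rule Bochner_Integration.integral_cong[OF refl])
        fix w
        have "(\<Sum>l\<in>{-L..L}. ?F g l w) =
          (\<Sum>l\<in>{-L..L}. if l = 0 then indicat_real S w * corr 0 w else 0)"
        proof (rule sum.cong[OF refl])
          fix l
          have "Re (g w * cnj (g (w + of_int l * T))) = indicat_real S w * indicat_real S (w + of_int l * T)"
            by (simp add: g_def)
          then show "?F g l w = (if l = 0 then indicat_real S w * corr 0 w else 0)"
            unfolding indicator_lattice_disjoint[OF T Sa] by simp
        qed
        also have "\<dots> = indicat_real S w * corr 0 w" using L(2) by (subst sum.delta) auto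
        finally show "(\<Sum>l\<in>{-L..L}. ?F g l w) = indicat_real S w * corr 0 w" .
      qed
      moreover have "quad T L g = (norm_L2 g)\<^sup>2" using L by (intro Q[OF g g0]) (auto simp: R_def)
      moreover have "(norm_L2 g)\<^sup>2 = (LINT w|lebesgue. indicat_real S w)"
        unfolding norm_L2_sq by (intro Bochner_Integration.integral_cong refl) (simp add: g_def indicator_def)
      ultimately have "(LINT w|lebesgue. indicat_real S w * corr 0 w) = (LINT w|lebesgue. indicat_real S w)" by simp
      then show "(LINT w|lebesgue. indicat_real S w * (corr 0 w - 1)) = 0"
        using intS[OF S SR, of 0] intS1[OF S SR] by (simp add: right_diff_distrib)
    qed measurable
    then show ?thesis by eventually_elim simp
  qed
  show ?D
  proof
    fix l :: int
    show "AE w in lebesgue. corr (of_int l * T) w = (if l = 0 then 1 else 0)"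
    proof (cases "l = 0")
      case True
      then show ?thesis using D0 by simp
    next
      case l: False
      have "AE w in lebesgue. corr (of_int l * T) w = 0"
      proof (rule AE_zero_of_integrals)
        show "\<exists>K. \<forall>w. \<bar>w\<bar> \<le> R \<longrightarrow> \<bar>corr (of_int l * T) w\<bar> \<le> K" for R by (rule corr_bound)
        fix a :: int and S :: "real set" assume S [measurable]: "S \<in> sets lebesgue" and Sa: "S \<subseteq> {of_int a..<of_int a + 1}"
        define R where "R = \<bar>real_of_int a\<bar> + 1 + \<bar>of_int l * T\<bar>"
        have SR: "S \<subseteq> {-R..R}"
        proof
        fix w assume "w \<in> S"
        then have "w \<in> {of_int a..<of_int a + 1}" using Sa by blast
        then show "w \<in> {-R..R}" unfolding R_def by simp linarith
      qed
        let ?i = "indicat_real S"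
        let ?j = "\<lambda>w. indicat_real S (w - of_int l * T)"
        have im [measurable]: "?i \<in> borel_measurable lebesgue" by measurable
        have jm [measurable]: "?j \<in> borel_measurable lebesgue" using measurable_shift[OF im, of "- of_int l * T"] by simp
        define g where "g w = complex_of_real (?i w + ?j w)" for w
        have j0: "?j w = 0" if "\<bar>w\<bar> > R" for w
        proof -
          have "w - of_int l * T \<notin> {of_int a..<of_int a + 1}" using that unfolding R_def by simp linarith
          then show ?thesis using Sa by (auto simp: indicator_def)
        qed
        have i0: "?i w = 0" if "\<bar>w\<bar> > R" for w
        proof -
          have "w \<notin> {-R..R}" using that by auto
          then show ?thesis using SR by (auto simp: indicator_def)
        qed
        have g0: "g x = 0" if "\<bar>x\<bar> > R" for x using i0[OF that] j0[OF that] by (simp add: g_def)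
        have gm: "g \<in> borel_measurable lebesgue" unfolding g_def by measurable
        have "cmod (g x) \<le> 2" for x by (simp add: g_def indicator_def)
        then have g: "bcs g" unfolding bcs_def using gm g0 by blast
        \<comment> \<open>The second bound keeps the indices \<open>l\<close> and \<open>- l\<close>
          within the range of summation.\<close>
        obtain L :: int where L: "of_int L * T \<ge> 2 * R" "L \<ge> \<bar>l\<bar>" using exL by blast
        have dis: "?i w * ?i (w + of_int k * T) = (if k = 0 then ?i w else 0)" for w k
          by (rule indicator_lattice_disjoint[OF T Sa])
        have int1: "integrable lebesgue (\<lambda>w. ?i w * corr c w)" for c by (rule intS[OF S SR])
        have int2: "integrable lebesgue (\<lambda>w. ?j w * corr c w)" for c
        proof -
          obtain K where K: "\<And>w. \<bar>w\<bar> \<le> \<bar>R\<bar> \<Longrightarrow> \<bar>corr c w\<bar> \<le> K" using corr_bound[of "\<bar>R\<bar>" c] by blast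
          have K0: "K \<ge> 0" using K[of 0] by simp
          show ?thesis
          proof (rule bounded_supp_integrable)
            show "norm (?j w * corr c w) \<le> K" for w
              using K[of w] j0[of w] K0 by (cases "\<bar>w\<bar> > R") (auto simp: indicator_def)
            show "?j w * corr c w = 0" if "\<bar>w\<bar> > R" for w using j0[OF that] by simp
          qed measurable
        qed
        have intj: "integrable lebesgue ?j"
          using integrable_lebesgue_affine[OF intS1[OF S SR], of "- of_int l * T"] by simp
        have "quad T L g = (LINT w|lebesgue. (?i w * corr 0 w + ?j w * corr 0 w) + (?i w * corr (of_int l * T) w + ?j w * corr (- of_int l * T) w))"
          unfolding quad_def
        proof (rule Bochner_Integration.integral_cong[OF refl])
          fix w
          \<comment> \<open>Of the four products of indicators the two diagonal ones force
            \<open>k = 0\<close>, the mixed ones \<open>k = l\<close> and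
            \<open>k = - l\<close>.\<close>
          have "?F g k w =
             (if k = 0 then ?i w * corr 0 w + ?j w * corr 0 w else 0)
             + ((if k = l then ?i w * corr (of_int l * T) w else 0) + (if k = - l then ?j w * corr (- of_int l * T) w else 0))" for k
          proof -
            have "Re (g w * cnj (g (w + of_int k * T))) =
              ?i w * ?i (w + of_int k * T) + ?i w * ?i (w + of_int (k - l) * T)
              + ?j w * ?i ((w - of_int l * T) + of_int (k + l) * T) + ?j w * ?i ((w - of_int l * T) + of_int k * T)"
              by (simp add: g_def algebra_simps)
            then show ?thesis unfolding dis using l by (auto simp: distrib_right)
          qed
          then have "(\<Sum>k\<in>{-L..L}. ?F g k w) =
             (\<Sum>k\<in>{-L..L}. if k = 0 then ?i w * corr 0 w + ?j w * corr 0 w else 0)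
             + ((\<Sum>k\<in>{-L..L}. if k = l then ?i w * corr (of_int l * T) w else 0) + (\<Sum>k\<in>{-L..L}. if k = - l then ?j w * corr (- of_int l * T) w else 0))"
            by (simp only: sum.distrib)
          also have "\<dots> = (?i w * corr 0 w + ?j w * corr 0 w) + (?i w * corr (of_int l * T) w + ?j w * corr (- of_int l * T) w)"
            using L(2) by (subst (1 2 3) sum.delta) auto
          finally show "(\<Sum>k\<in>{-L..L}. ?F g k w) =
            (?i w * corr 0 w + ?j w * corr 0 w) + (?i w * corr (of_int l * T) w + ?j w * corr (- of_int l * T) w)" .
        qed
        also have "\<dots> = (LINT w|lebesgue. ?i w * corr 0 w + ?j w * corr 0 w) + ((LINT w|lebesgue. ?i w * corr (of_int l * T) w) + (LINT w|lebesgue. ?j w * corr (- of_int l * T) w))"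
          using int1 int2 by simp
        also have "(LINT w|lebesgue. ?j w * corr (- of_int l * T) w) = (LINT w|lebesgue. ?i w * corr (of_int l * T) w)"
          using integral_lebesgue_shift[of "\<lambda>w. ?j w * corr (- of_int l * T) w" "of_int l * T"] corr_reflect[of "of_int l * T"] by simp
        \<comment> \<open>The case \<open>l = 0\<close>, already settled, removes
          \<open>corr 0\<close> from the diagonal part, which then cancels against the squared
          norm.\<close>
        also have "(LINT w|lebesgue. ?i w * corr 0 w + ?j w * corr 0 w) = (LINT w|lebesgue. ?i w + ?j w)"
        proof (rule integral_cong_AE)
          show "AE w in lebesgue. ?i w * corr 0 w + ?j w * corr 0 w = ?i w + ?j w"
            using D0 by eventually_elim simp
        qed (intro borel_measurable_add borel_measurable_times im jm corr_measurable)+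
        finally have "quad T L g = (LINT w|lebesgue. ?i w + ?j w) + 2 * (LINT w|lebesgue. ?i w * corr (of_int l * T) w)" by simp
        moreover have "quad T L g = (norm_L2 g)\<^sup>2" using L by (intro Q[OF g g0]) (auto simp: R_def)
        moreover have "(norm_L2 g)\<^sup>2 = (LINT w|lebesgue. ?i w + ?j w)"
          unfolding norm_L2_sq
        proof (intro Bochner_Integration.integral_cong refl)
          fix w
          have "?i w * ?j w = 0"
            using dis[of "w - of_int l * T" l] l by (simp add: mult.commute)
          then have "(?i w + ?j w)\<^sup>2 = ?i w + ?j w"
            by (auto simp: indicator_def)
          then show "(cmod (g w))\<^sup>2 = ?i w + ?j w" unfolding g_def norm_of_real power2_abs .
        qed
        ultimately show "(LINT w|lebesgue. ?i w * corr (of_int l * T) w) = 0" by linarith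
      qed measurable
      then show ?thesis using l by simp
    qed
  qed
qed

end

section \<open>The Zak transform\<close>

lemma AE_lebesgue_affine:
  assumes c: "c \<noteq> 0" and Q: "AE x in (lebesgue :: real measure). Q x"
  shows "AE x in (lebesgue :: real measure). Q (t + c * x)"
proof -
  have m: "(\<lambda>x::real. t + c * x) \<in> lebesgue \<rightarrow>\<^sub>M lebesgue"
    using lebesgue_affine_measurable[where c="\<lambda>_::real. c" and t=t] c by simp
  have "AE x in density (distr lebesgue lebesgue (\<lambda>x. t + c * x)) (\<lambda>_. ennreal \<bar>c\<bar>). Q x"
    by (subst lebesgue_real_affine[OF c, of t, symmetric]) (rule Q)
  then have "AE x in distr lebesgue lebesgue (\<lambda>x. t + c * x). Q x"
    using c by (subst (asm) AE_density) auto
  then show ?thesis by (rule AE_distrD[OF m])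
qed

text \<open>\<open>lebesgue\<close> on the plane is the completion of the Borel product, not the
  product of two completions. The exceptional set is therefore enclosed in a Borel null set,
  sectioned there, and the completion is restored on the sections.\<close>

lemma AE_lebesgue_prod_swap:
  assumes "AE p in (lebesgue :: (real \<times> real) measure). P p"
  shows "AE y in (lebesgue :: real measure). AE x in (lebesgue :: real measure). P (x, y)"
proof -
  have "AE p in (lborel \<Otimes>\<^sub>M lborel :: (real \<times> real) measure). P p"
    using assms unfolding lborel_prod AE_completion_iff .
  then obtain N where N: "{p \<in> space (lborel \<Otimes>\<^sub>M lborel :: (real \<times> real) measure). \<not> P p} \<subseteq> N" "N \<in> null_sets (lborel \<Otimes>\<^sub>M lborel)"
    unfolding eventually_ae_filter by blast
  have Nm [measurable]: "N \<in> sets (lborel \<Otimes>\<^sub>M lborel)" using N(2) by auto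
  have "AE p in (lborel \<Otimes>\<^sub>M lborel). p \<notin> N" using N(2) by (rule AE_not_in)
  then have "AE x in lborel. AE y in lborel. (x, y) \<notin> N" by (rule lborel_pair.AE_pair)
  then have "AE y in lborel. AE x in lborel. (x, y) \<notin> N"
    by (subst (asm) lborel_pair.AE_commute) measurable
  then have "AE y in lborel. AE x in lborel. P (x, y)"
  proof eventually_elim
    case (elim y)
    then show ?case
    proof eventually_elim
      case (elim x)
      then show ?case using N(1) by (auto simp: space_pair_measure)
    qed
  qed
  then show ?thesis by (simp add: AE_completion_iff)
qed

lemma AE_lebesgue_prod_snd:
  assumes "AE y in (lebesgue :: real measure). Q y"
  shows "AE p in (lebesgue :: (real \<times> real) measure). Q (snd p)"
proof -
  have "AE y in lborel. Q y" using assms by (simp add: AE_completion_iff)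
  then obtain N where N: "{y \<in> space lborel. \<not> Q y} \<subseteq> N" "N \<in> null_sets lborel"
    unfolding eventually_ae_filter by blast
  have [measurable]: "N \<in> sets borel" using N(2) by auto
  have "AE x in lborel. AE y in lborel. snd (x :: real, y) \<notin> N"
    using AE_not_in[OF N(2)] by simp
  then have "AE p in (lborel \<Otimes>\<^sub>M lborel :: (real \<times> real) measure). snd p \<notin> N"
    by (intro lborel_pair.AE_pair_measure) measurable
  then have "AE p in (lborel \<Otimes>\<^sub>M lborel :: (real \<times> real) measure). Q (snd p)"
  proof eventually_elim
    case (elim p)
    then show ?case using N(1) by auto
  qed
  then show ?thesis unfolding lborel_prod AE_completion_iff .
qed

text \<open>Expanding the square gives an absolutely convergent double series over pairs of indices;
  collecting by their difference \<open>l\<close> exhibits the autocorrelation of \<open>a\<close>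
  as Fourier coefficients.\<close>

lemma norm_sq_fourier_series:
  fixes a :: "int \<Rightarrow> real"
  assumes a: "(\<lambda>k. \<bar>a k\<bar>) summable_on UNIV"
  shows "((\<lambda>(l, k). of_real (a k * a (k - l)) * cis (2 * pi * of_int l * x)) has_sum
    of_real ((cmod (\<Sum>\<^sub>\<infinity>k. of_real (a k) * cis (2 * pi * of_int k * x)))\<^sup>2)) UNIV"
proof -
  define c where "c k = of_real (a k) * cis (2 * pi * of_int k * x)" for k
  define A where "A = (\<Sum>\<^sub>\<infinity>k. c k)"
  have nc: "norm (c k) = \<bar>a k\<bar>" for k by (simp add: c_def norm_mult)
  have "(\<lambda>k. norm (c k)) summable_on UNIV" unfolding nc by (rule a)
  then have "c summable_on UNIV" by (rule abs_summable_summable)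
  then have c: "(c has_sum A) UNIV" unfolding A_def by (rule has_sum_infsum)
  then have c': "((\<lambda>k. cnj (c k)) has_sum cnj A) UNIV" by simp
  let ?f = "\<lambda>(k, k'). c k * cnj (c k')"
  obtain s where s: "((\<lambda>k. \<bar>a k\<bar>) has_sum s) UNIV" using a by (auto simp: summable_on_def)
  have "((\<lambda>(k, k'). \<bar>a k\<bar> * \<bar>a k'\<bar>) has_sum s * s) UNIV"
    by (rule has_sum_pairs_nonneg) (auto intro!: has_sum_cmult_left has_sum_cmult_right s)
  then have "(\<lambda>p. norm (?f p)) summable_on UNIV"
    unfolding case_prod_beta norm_mult complex_mod_cnj nc by (rule has_sum_imp_summable)
  then have "?f summable_on UNIV" by (rule abs_summable_summable)
  then have "(?f has_sum A * cnj A) (UNIV \<times> UNIV)"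
    by (intro has_sum_SigmaI[where g="\<lambda>k. c k * cnj A"])
      (auto intro!: has_sum_cmult_left has_sum_cmult_right c c')
  then have "(?f has_sum A * cnj A) UNIV" by simp
  also have "?this \<longleftrightarrow> ((\<lambda>(l, k). of_real (a k * a (k - l)) * cis (2 * pi * of_int l * x)) has_sum A * cnj A) UNIV"
  proof (rule has_sum_reindex_bij_witness[of _ "\<lambda>(l, k). (k, k - l)" "\<lambda>(k, k'). (k - k', k)"])
    fix p :: "int \<times> int"
    obtain k k' where p: "p = (k, k')" by (cases p)
    have "cis (2 * pi * of_int k * x) * cnj (cis (2 * pi * of_int k' * x)) = cis (2 * pi * of_int (k - k') * x)"
      unfolding cis_cnj cis_mult by (simp add: algebra_simps)
    then show "(case case p of (k, k') \<Rightarrow> (k - k', k) of (l, k) \<Rightarrow> of_real (a k * a (k - l)) * cis (2 * pi * of_int l * x)) = ?f p"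
      by (simp add: p c_def mult_ac)
  qed auto
  also have "A * cnj A = of_real ((cmod A)\<^sup>2)" using complex_norm_square[of A] by simp
  finally show ?thesis unfolding A_def c_def .
qed

context decaying
begin

lemma corr_periodic: "corr a (w + of_int k) = corr a w"
  unfolding corr_def
  by (rule infsum_reindex_bij_witness[of UNIV "\<lambda>m. m + k" "\<lambda>m. m - k"]) (auto simp: algebra_simps)

lemma h_abs_summable: "(\<lambda>m::int. \<bar>h (w - of_int m)\<bar>) summable_on UNIV"
  using Infinite_Sum.abs_summable_on_comparison_test'[OF maj_summable[of "\<bar>w\<bar>"], of "\<lambda>m. h (w - of_int m)"] h_maj[of w "\<bar>w\<bar>"]
  by simp

text \<open>The sum of squared Zak transforms for \<open>\<beta> = 1 / N\<close>, freed of the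
  factor \<open>1 / \<beta>\<close> and written in \<open>w = N \<xi>\<close>, so that a step of
  \<open>\<beta>\<close> in \<open>\<xi>\<close> is a step of 1 in \<open>w\<close>.\<close>

definition zsum :: "nat \<Rightarrow> real \<Rightarrow> real \<Rightarrow> real" where
  "zsum N w x = (\<Sum>r<N. (cmod (\<Sum>\<^sub>\<infinity>k\<in>(UNIV :: int set). of_real (h (w - of_nat r - of_int k * of_nat N)) * cis (2 * pi * of_int k * x)))\<^sup>2)"

text \<open>Residue class \<open>r\<close> contributes the autocorrelation of \<open>h\<close> along
  the points \<open>w - r - k N\<close>. Division with remainder by \<open>N\<close> shows that the
  classes exhaust the integers, so the sum over \<open>r\<close> is the full lattice
  correlation.\<close>

lemma zsum_has_sum:
  assumes N: "N > 0"
  shows "((\<lambda>l::int. of_real (corr (of_int l * real N) w) * cis (2 * pi * of_int l * x)) has_sum of_real (zsum N w x)) UNIV"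
proof -
  define a where "a r k = h (w - of_nat r - of_int k * of_nat N)" for r :: nat and k :: int
  have aa: "a r k = h (w - of_int (int r + k * int N))" for r k by (simp add: a_def algebra_simps)
  have as: "(\<lambda>k. \<bar>a r k\<bar>) summable_on UNIV" for r
  proof -
    have "(\<lambda>m::int. \<bar>h (w - of_int m)\<bar>) summable_on range (\<lambda>k. int r + k * int N)"
      by (rule summable_on_subset[OF h_abs_summable]) simp
    then show ?thesis
      by (subst (asm) summable_on_reindex) (use N in \<open>auto simp: inj_on_def o_def aa\<close>)
  qed
  have "((\<lambda>p. \<Sum>r<N. case p of (l, k) \<Rightarrow> of_real (a r k * a r (k - l)) * cis (2 * pi * of_int l * x)) has_sum
      (\<Sum>r<N. of_real ((cmod (\<Sum>\<^sub>\<infinity>k. of_real (a r k) * cis (2 * pi * of_int k * x)))\<^sup>2))) UNIV"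
    by (rule has_sum_sum[OF finite_lessThan]) (rule norm_sq_fourier_series[OF as])
  also have "(\<Sum>r<N. complex_of_real ((cmod (\<Sum>\<^sub>\<infinity>k. of_real (a r k) * cis (2 * pi * of_int k * x)))\<^sup>2)) = of_real (zsum N w x)"
    by (simp add: zsum_def a_def)
  finally have *: "((\<lambda>p. \<Sum>r<N. case p of (l, k) \<Rightarrow> of_real (a r k * a r (k - l)) * cis (2 * pi * of_int l * x)) has_sum of_real (zsum N w x)) (UNIV \<times> UNIV)"
    by simp
  have inner: "((\<lambda>k. \<Sum>r<N. a r k * a r (k - l)) has_sum corr (of_int l * real N) w) UNIV" for l
  proof (rule has_sum_SigmaD)
    show "((\<lambda>(k, r). a r k * a r (k - l)) has_sum corr (of_int l * real N) w) (UNIV \<times> {..<N})"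
    proof -
      have "((\<lambda>m::int. h (w - of_int m) * h (w + of_int l * real N - of_int m)) has_sum corr (of_int l * real N) w) UNIV \<longleftrightarrow>
        ((\<lambda>(k, r). a r k * a r (k - l)) has_sum corr (of_int l * real N) w) (UNIV \<times> {..<N})"
      proof (rule has_sum_reindex_bij_witness[of _ "\<lambda>(k, r). int r + k * int N" "\<lambda>m. (m div int N, nat (m mod int N))"])
        fix m :: int
        have m: "int (nat (m mod int N)) + m div int N * int N = m" using N by simp
        have "a (nat (m mod int N)) (m div int N) = h (w - of_int m)" unfolding aa m ..
        moreover have "a (nat (m mod int N)) (m div int N - l) = h (w + of_int l * real N - of_int m)"
        proof -
          have "int (nat (m mod int N)) + (m div int N - l) * int N = m - l * int N" using m by (simp add: left_diff_distrib)
          then show ?thesis unfolding aa by (simp add: algebra_simps)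
        qed
        ultimately show "(case (m div int N, nat (m mod int N)) of (k, r) \<Rightarrow> a r k * a r (k - l)) = h (w - of_int m) * h (w + of_int l * real N - of_int m)"
          by simp
        show "(case (m div int N, nat (m mod int N)) of (k, r) \<Rightarrow> int r + k * int N) = m" using m by simp
        show "(m div int N, nat (m mod int N)) \<in> UNIV \<times> {..<N}" using N by (simp add: nat_less_iff)
      next
        fix p :: "int \<times> nat" assume p: "p \<in> UNIV \<times> {..<N}"
        then show "((case p of (k, r) \<Rightarrow> int r + k * int N) div int N, nat ((case p of (k, r) \<Rightarrow> int r + k * int N) mod int N)) = p"
          using N by auto
      qed auto
      then show ?thesis using corr_has_sum by blast
    qed
    show "((\<lambda>r. case (k, r) of (k, r) \<Rightarrow> a r k * a r (k - l)) has_sum (\<Sum>r<N. a r k * a r (k - l))) {..<N}" for k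
      by (simp add: has_sum_finiteI)
  qed
  have "((\<lambda>k. complex_of_real (\<Sum>r<N. a r k * a r (k - l)) * cis (2 * pi * of_int l * x)) has_sum
      of_real (corr (of_int l * real N) w) * cis (2 * pi * of_int l * x)) UNIV" for l
    by (intro has_sum_cmult_left has_sum_of_real inner)
  then show ?thesis
    by (intro has_sum_SigmaD[OF *]) (simp add: sum_distrib_right)
qed

lemma zsum_eq_1:
  assumes N: "N > 0" and c: "\<And>l::int. corr (of_int l * real N) w = (if l = 0 then 1 else 0)"
  shows "zsum N w x = 1"
proof -
  have "((\<lambda>l::int. complex_of_real (corr (of_int l * real N) w) * cis (2 * pi * of_int l * x)) has_sum 1) UNIV"
    by (rule has_sum_finite_neutralI[of "{0}"]) (use c[of 0] in \<open>auto simp: c\<close>)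
  from has_sum_unique[OF zsum_has_sum[OF N] this] show ?thesis by simp
qed

text \<open>For fixed \<open>w\<close> the Fourier series in \<open>x\<close> converges absolutely
  and can be integrated termwise against every exponential; a function equal to 1 almost everywhere
  has the coefficients of the constant.\<close>

lemma zsum_const_iff:
  assumes N: "N > 0"
  shows "(AE x in lebesgue. x \<in> {0..1} \<longrightarrow> zsum N w x = 1) \<longleftrightarrow> (\<forall>l::int. corr (of_int l * real N) w = (if l = 0 then 1 else 0))"
proof
  assume c: "\<forall>l::int. corr (of_int l * real N) w = (if l = 0 then 1 else 0)"
  then have "zsum N w x = 1" for x by (intro zsum_eq_1[OF N]) blast
  then show "AE x in lebesgue. x \<in> {0..1} \<longrightarrow> zsum N w x = 1" by simp
next
  assume ae: "AE x in lebesgue. x \<in> {0..1} \<longrightarrow> zsum N w x = 1"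
  define b where "b l = \<bar>corr (of_int l * real N) w\<bar>" for l :: int
  \<comment> \<open>At \<open>x = 0\<close> all exponentials are 1, and unconditional summability of
    complex numbers is absolute summability.\<close>
  have "(\<lambda>l::int. complex_of_real (corr (of_int l * real N) w) * cis (2 * pi * of_int l * 0)) summable_on UNIV"
    by (rule has_sum_imp_summable[OF zsum_has_sum[OF N]])
  then have b: "b summable_on UNIV"
    unfolding summable_on_iff_abs_summable_on_complex by (simp add: b_def[abs_def])
  show "\<forall>l::int. corr (of_int l * real N) w = (if l = 0 then 1 else 0)"
  proof
    fix l0 :: int
    let ?v = "indicat_real {0..<1::real}"
    let ?u = "\<lambda>l x. complex_of_real (corr (of_int l * real N) w) * (of_real (?v x) * cis (2 * pi * of_int (l - l0) * x / 1))"
    have vm [measurable]: "?v \<in> borel_measurable lebesgue" by (simp add: measurable_completion)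
    have vi: "integrable lebesgue ?v"
      by (intro integrable_real_indicator) auto
    have um: "?u l \<in> borel_measurable lebesgue" for l by measurable
    have ub: "norm (?u l x) \<le> b l * ?v x" for l x by (simp add: b_def norm_mult)
    have "((\<lambda>l. LINT x|lebesgue. ?u l x) has_sum (LINT x|lebesgue. (\<Sum>\<^sub>\<infinity>l. ?u l x))) UNIV"
      by (rule has_sum_integral(1)[OF um ub b vi])
    moreover have "(LINT x|lebesgue. ?u l x) = (if l = l0 then of_real (corr (of_int l * real N) w) else 0)" for l
      unfolding integral_mult_right_zero integral_cis_period[OF zero_less_one] by simp
    ultimately have "((\<lambda>l. if l = l0 then complex_of_real (corr (of_int l * real N) w) else 0) has_sum (LINT x|lebesgue. (\<Sum>\<^sub>\<infinity>l. ?u l x))) UNIV"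
      by simp
    moreover have "((\<lambda>l. if l = l0 then complex_of_real (corr (of_int l * real N) w) else 0) has_sum of_real (corr (of_int l0 * real N) w)) UNIV"
      by (rule has_sum_finite_neutralI[of "{l0}"]) auto
    ultimately have "complex_of_real (corr (of_int l0 * real N) w) = (LINT x|lebesgue. (\<Sum>\<^sub>\<infinity>l. ?u l x))"
      by (rule has_sum_unique[symmetric])
    also have "\<dots> = (LINT x|lebesgue. of_real (?v x) * cis (2 * pi * of_int (- l0) * x / 1))"
    proof (rule integral_cong_AE)
      show "(\<lambda>x. \<Sum>\<^sub>\<infinity>l. ?u l x) \<in> borel_measurable lebesgue"
        using has_sum_integral(2)[OF um ub b vi] by simp
      show "(\<lambda>x. complex_of_real (?v x) * cis (2 * pi * of_int (- l0) * x / 1)) \<in> borel_measurable lebesgue" by measurable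
      show "AE x in lebesgue. (\<Sum>\<^sub>\<infinity>l. ?u l x) = of_real (?v x) * cis (2 * pi * of_int (- l0) * x / 1)"
        using ae
      proof eventually_elim
        case (elim x)
        have "((\<lambda>l. (of_real (corr (of_int l * real N) w) * cis (2 * pi * of_int l * x)) * (of_real (?v x) * cis (2 * pi * of_int (- l0) * x / 1))) has_sum
          of_real (zsum N w x) * (of_real (?v x) * cis (2 * pi * of_int (- l0) * x / 1))) UNIV"
          by (intro has_sum_cmult_left zsum_has_sum N)
        also have "(\<lambda>l. (complex_of_real (corr (of_int l * real N) w) * cis (2 * pi * of_int l * x)) * (of_real (?v x) * cis (2 * pi * of_int (- l0) * x / 1))) = (\<lambda>l. ?u l x)"
        proof
          fix l
          have "cis (2 * pi * of_int l * x) * cis (2 * pi * of_int (- l0) * x / 1) = cis (2 * pi * of_int (l - l0) * x / 1)"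
            unfolding cis_mult by (simp add: algebra_simps)
          then show "(complex_of_real (corr (of_int l * real N) w) * cis (2 * pi * of_int l * x)) * (of_real (?v x) * cis (2 * pi * of_int (- l0) * x / 1)) = ?u l x"
            by (simp add: mult_ac)
        qed
        finally have "(\<Sum>\<^sub>\<infinity>l. ?u l x) = of_real (zsum N w x) * (of_real (?v x) * cis (2 * pi * of_int (- l0) * x / 1))"
          by (rule infsumI)
        then show ?case using elim by (cases "x \<in> {0..<1}") auto
      qed
    qed
    also have "\<dots> = (if - l0 = 0 then of_real 1 else 0)" by (rule integral_cis_period) simp
    finally have "complex_of_real (corr (of_int l0 * real N) w) = of_real (if l0 = 0 then 1 else 0)" by simp
    then show "corr (of_int l0 * real N) w = (if l0 = 0 then 1 else 0)" by (simp only: of_real_eq_iff)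
  qed
qed

text \<open>As \<open>\<xi>\<close> runs through \<open>[0, 1]\<close>, \<open>w = N \<xi>\<close>
  covers at least one full period of the correlations, which have period 1 in \<open>w\<close>;
  hence the unit square decides the condition for almost all \<open>w\<close> on the line.\<close>

lemma zsum_AE_iff:
  assumes N: "N > 0"
  shows "(AE (x, \<xi>) in (lebesgue :: (real \<times> real) measure). x \<in> {0..1} \<and> \<xi> \<in> {0..1} \<longrightarrow> zsum N (real N * \<xi>) x = 1) \<longleftrightarrow>
    (\<forall>l::int. AE w in lebesgue. corr (of_int l * real N) w = (if l = 0 then 1 else 0))"
proof -
  define G where "G w \<longleftrightarrow> (\<forall>l::int. corr (of_int l * real N) w = (if l = 0 then 1 else 0))" for w
  have G: "(\<forall>l::int. AE w in lebesgue. corr (of_int l * real N) w = (if l = 0 then 1 else 0)) \<longleftrightarrow> (AE w in lebesgue. G w)"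
    unfolding G_def AE_all_countable ..
  have Gper: "G (w + of_int k) \<longleftrightarrow> G w" for w k by (simp add: G_def corr_periodic)
  show ?thesis unfolding G
  proof
    assume "AE w in lebesgue. G w"
    then have "AE \<xi> in lebesgue. G (0 + real N * \<xi>)" using N by (intro AE_lebesgue_affine) auto
    then have "AE \<xi> in lebesgue. \<forall>x. zsum N (real N * \<xi>) x = 1"
      by eventually_elim (use zsum_eq_1[OF N] in \<open>simp add: G_def\<close>)
    then have "AE p in (lebesgue :: (real \<times> real) measure). \<forall>x. zsum N (real N * snd p) x = 1"
      by (rule AE_lebesgue_prod_snd)
    then show "AE (x, \<xi>) in (lebesgue :: (real \<times> real) measure). x \<in> {0..1} \<and> \<xi> \<in> {0..1} \<longrightarrow> zsum N (real N * \<xi>) x = 1"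
      by eventually_elim auto
  next
    assume "AE (x, \<xi>) in (lebesgue :: (real \<times> real) measure). x \<in> {0..1} \<and> \<xi> \<in> {0..1} \<longrightarrow> zsum N (real N * \<xi>) x = 1"
    from AE_lebesgue_prod_swap[OF this]
    have "AE \<xi> in lebesgue. \<xi> \<in> {0..1} \<longrightarrow> G (real N * \<xi>)"
    proof eventually_elim
      case (elim \<xi>)
      show ?case
      proof
        assume "\<xi> \<in> {0..1}"
        with elim have "AE x in lebesgue. x \<in> {0..1} \<longrightarrow> zsum N (real N * \<xi>) x = 1" by simp
        then show "G (real N * \<xi>)" unfolding G_def zsum_const_iff[OF N] .
      qed
    qed
    \<comment> \<open>All integer translates are secured at once, so that \<open>w\<close> can
      afterwards be reduced by its own floor.\<close>
    then have "AE w in lebesgue. - of_int k / real N + 1 / real N * w \<in> {0..1} \<longrightarrow> G (real N * (- of_int k / real N + 1 / real N * w))" for k :: int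
      by (rule AE_lebesgue_affine[rotated]) (use N in simp)
    then have "AE w in lebesgue. \<forall>k::int. - of_int k / real N + 1 / real N * w \<in> {0..1} \<longrightarrow> G (real N * (- of_int k / real N + 1 / real N * w))"
      unfolding AE_all_countable by blast
    then show "AE w in lebesgue. G w"
    proof eventually_elim
      case (elim w)
      have e: "real N * (- of_int \<lfloor>w\<rfloor> / real N + 1 / real N * w) = w + of_int (- \<lfloor>w\<rfloor>)" using N by (simp add: field_simps)
      have f: "- of_int \<lfloor>w\<rfloor> / real N + 1 / real N * w = (w - of_int \<lfloor>w\<rfloor>) / real N" by (simp add: diff_divide_distrib)
      have "0 \<le> w - of_int \<lfloor>w\<rfloor>" "w - of_int \<lfloor>w\<rfloor> \<le> real N" using N by linarith+
      then have "- of_int \<lfloor>w\<rfloor> / real N + 1 / real N * w \<in> {0..1}" unfolding f using N by simp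
      with elim have "G (w + of_int (- \<lfloor>w\<rfloor>))" unfolding e[symmetric] by blast
      then show ?case by (simp only: Gper)
    qed
  qed
qed

text \<open>Division by \<open>\<beta>\<close> turns \<open>\<xi> - \<beta> r - k\<close> into
  \<open>w - r - 2 n k\<close> with \<open>w = 2 n \<xi>\<close>, and the squared prefactor of
  \<open>zak\<close> is \<open>1 / \<beta>\<close>.\<close>

lemma zak_zsum:
  assumes n: "n > 0" and b: "\<beta> = 1 / (2 * real n)"
  shows "(\<Sum>r = 0..2 * n - 1. (cmod (zak \<beta> (\<lambda>w. complex_of_real (h w)) x (\<xi> - \<beta> * real r)))\<^sup>2) = (1 / \<beta>) * zsum (2 * n) (real (2 * n) * \<xi>) x"
proof -
  have b0: "\<beta> > 0" using b n by simp
  have "zak \<beta> (\<lambda>w. complex_of_real (h w)) x (\<xi> - \<beta> * real r) =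
    of_real (1 / sqrt \<beta>) * (\<Sum>\<^sub>\<infinity>k\<in>(UNIV :: int set). of_real (h (real (2 * n) * \<xi> - of_nat r - of_int k * of_nat (2 * n))) * cis (2 * pi * of_int k * x))" for r
  proof -
    have "(\<xi> - \<beta> * real r - of_int k) / \<beta> = real (2 * n) * \<xi> - of_nat r - of_int k * of_nat (2 * n)" for k :: int
      unfolding b using n by (simp add: field_simps)
    then show ?thesis unfolding zak_def by simp
  qed
  moreover have "{0..2 * n - 1} = {..<2 * n}" using n by auto
  moreover have "(cmod (of_real (1 / sqrt \<beta>) * z))\<^sup>2 = (1 / \<beta>) * (cmod z)\<^sup>2" for z
    unfolding norm_mult power_mult_distrib norm_of_real power2_abs power_divide using b0 by simp
  ultimately show ?thesis unfolding zsum_def sum_distrib_left by simp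
qed

end

section \<open>Gabor and Wilson systems\<close>

lemma L2_shift: "f \<in> L2 \<Longrightarrow> (\<lambda>x. f (x + a)) \<in> L2"
  using measurable_shift[of f a] integrable_lebesgue_affine[of "\<lambda>x. (cmod (f x))\<^sup>2" a] by (simp add: L2_def)

lemma norm_L2_shift: "norm_L2 (\<lambda>x. f (x + a)) = norm_L2 f"
  unfolding norm_L2_def using integral_lebesgue_shift[of "\<lambda>x. (cmod (f x))\<^sup>2" a] by simp

lemma integrable_cis_mult:
  assumes "integrable lebesgue f"
  shows "integrable lebesgue (\<lambda>x. cis (a * x + b) * f x)"
proof (rule Bochner_Integration.integrable_bound[OF assms])
  have [measurable]: "f \<in> borel_measurable lebesgue" using assms by simp
  show "(\<lambda>x. cis (a * x + b) * f x) \<in> borel_measurable lebesgue" by measurable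
qed (simp add: norm_mult)

text \<open>The adjoint of a Gabor translation and modulation, applied to the test pair. Stability
  of the pairs under it reduces the coefficients of all Gabor functions to
  \<open>inner_fourier_L2\<close> for \<open>\<phi>\<close> itself.\<close>

lemma fourier_pair_shift_modulate:
  assumes fg: "fourier_pair f g"
  shows "fourier_pair (\<lambda>y. cis (- 2 * pi * m * (y + a)) * f (y + a)) (\<lambda>w. cis (2 * pi * a * w) * g (w + m))"
    (is "fourier_pair ?f ?g")
  unfolding fourier_pair_def
proof (intro conjI allI)
  have e: "?f = (\<lambda>y. cis ((- 2 * pi * m) * y + (- 2 * pi * m * a)) * f (y + a))" "?g = (\<lambda>w. cis ((2 * pi * a) * w + 0) * g (w + m))"
    by (simp_all add: algebra_simps)
  show "?f \<in> L2" "?g \<in> L2" unfolding e by (intro L2_cis L2_shift fourier_pair_L2[OF fg])+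
  show "integrable lebesgue ?f" "integrable lebesgue ?g"
    unfolding e by (intro integrable_cis_mult integrable_lebesgue_affine fourier_pair_integrable[OF fg])+
  show "?f y = fourier_L1 ?g (- y)" for y
  proof -
    have "fourier_L1 ?g (- y) = (LINT w|lebesgue. cis (2 * pi * a * w) * g (w + m) * cis (- 2 * pi * w * - y))"
      by (simp add: fourier_L1_def)
    also have "\<dots> = (LINT w|lebesgue. cis (2 * pi * a * (w - m)) * g w * cis (- 2 * pi * (w - m) * - y))"
      using integral_lebesgue_shift[of "\<lambda>w. cis (2 * pi * a * (w - m)) * g w * cis (- 2 * pi * (w - m) * - y)" m] by simp
    also have "(\<lambda>w. cis (2 * pi * a * (w - m)) * g w * cis (- 2 * pi * (w - m) * - y)) =
       (\<lambda>w. cis (- 2 * pi * m * (y + a)) * (g w * cis (- 2 * pi * w * - (y + a))))"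
    proof
      fix w
      have "cis (2 * pi * a * (w - m)) * cis (- 2 * pi * (w - m) * - y) = cis (- 2 * pi * m * (y + a)) * cis (- 2 * pi * w * - (y + a))"
        unfolding cis_mult by (simp add: algebra_simps)
      then show "cis (2 * pi * a * (w - m)) * g w * cis (- 2 * pi * (w - m) * - y) = cis (- 2 * pi * m * (y + a)) * (g w * cis (- 2 * pi * w * - (y + a)))"
        by (simp only: mult_ac)
    qed
    also have "(LINT w|lebesgue. cis (- 2 * pi * m * (y + a)) * (g w * cis (- 2 * pi * w * - (y + a)))) =
        cis (- 2 * pi * m * (y + a)) * fourier_L1 g (- (y + a))"
      unfolding fourier_L1_def by (rule integral_mult_right_zero)
    finally show ?thesis by (simp only: fourier_pair_eq(1)[OF fg])
  qed
  show "?g w = fourier_L1 ?f w" for w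
  proof -
    have "fourier_L1 ?f w = (LINT y|lebesgue. cis (- 2 * pi * m * (y + a)) * f (y + a) * cis (- 2 * pi * y * w))"
      by (simp add: fourier_L1_def)
    also have "\<dots> = (LINT y|lebesgue. cis (- 2 * pi * m * y) * f y * cis (- 2 * pi * (y - a) * w))"
      using integral_lebesgue_shift[of "\<lambda>y. cis (- 2 * pi * m * y) * f y * cis (- 2 * pi * (y - a) * w)" a] by simp
    also have "(\<lambda>y. cis (- 2 * pi * m * y) * f y * cis (- 2 * pi * (y - a) * w)) =
       (\<lambda>y. cis (2 * pi * a * w) * (f y * cis (- 2 * pi * y * (w + m))))"
    proof
      fix y
      have "cis (- 2 * pi * m * y) * cis (- 2 * pi * (y - a) * w) = cis (2 * pi * a * w) * cis (- 2 * pi * y * (w + m))"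
        unfolding cis_mult by (simp add: algebra_simps)
      then show "cis (- 2 * pi * m * y) * f y * cis (- 2 * pi * (y - a) * w) = cis (2 * pi * a * w) * (f y * cis (- 2 * pi * y * (w + m)))"
        by (simp only: mult_ac)
    qed
    also have "(LINT y|lebesgue. cis (2 * pi * a * w) * (f y * cis (- 2 * pi * y * (w + m)))) = cis (2 * pi * a * w) * fourier_L1 f (w + m)"
      unfolding fourier_L1_def by (rule integral_mult_right_zero)
    finally show ?thesis by (simp only: fourier_pair_eq(2)[OF fg])
  qed
qed

lemma gabor_L2: "\<phi> \<in> L2 \<Longrightarrow> gabor \<phi> \<alpha> \<beta> j m \<in> L2"
  using L2_cis[OF L2_shift[of \<phi> "- \<beta> * of_int j"], of "2 * pi * \<alpha> * of_int m" 0]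
  unfolding gabor_def[abs_def] by (simp add: mult.commute)

lemma norm_gabor: "norm_L2 (gabor \<phi> \<alpha> \<beta> j m) = norm_L2 \<phi>"
  unfolding norm_L2_shift[of \<phi> "- \<beta> * of_int j", symmetric]
  by (simp add: norm_L2_def gabor_def norm_mult)

lemma wilson_X_L2: "\<phi> \<in> L2 \<Longrightarrow> wilson_X \<phi> \<alpha> \<beta> j m \<in> L2"
  unfolding wilson_X_def[abs_def] by (intro L2_scale gabor_L2)

lemma wilson_Y_L2: "\<phi> \<in> L2 \<Longrightarrow> wilson_Y \<phi> \<alpha> \<beta> j m \<in> L2"
  unfolding wilson_Y_def[abs_def] by (intro L2_scale gabor_L2)

lemma wilson_L2:
  assumes "\<phi> \<in> L2" shows "wilson \<phi> \<alpha> \<beta> j m \<in> L2"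
proof (cases "m = 0")
  case True
  then show ?thesis unfolding wilson_def[abs_def] using assms by (simp add: L2_scale gabor_L2)
next
  case False
  then show ?thesis unfolding wilson_def[abs_def]
    using L2_scale[OF L2_add[OF wilson_X_L2[OF assms] wilson_Y_L2[OF assms]]] by simp
qed

text \<open>\<open>wilson_X\<close> and \<open>wilson_Y\<close> both have the norm of
  \<open>\<phi>\<close>, so for \<open>m > 0\<close> only the real part of their inner product can
  vary with \<open>j\<close> and \<open>m\<close>. This is the origin of the criterion for an
  orthonormal basis.\<close>

lemma norm_wilson_sq:
  assumes "\<phi> \<in> L2" "\<beta> > 0"
  shows "(norm_L2 (wilson \<phi> \<alpha> \<beta> j m))\<^sup>2 =
    (if m = 0 then 2 * \<beta> * (norm_L2 \<phi>)\<^sup>2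
     else \<beta> * (2 * (norm_L2 \<phi>)\<^sup>2 + 2 * Re (inner_L2 (wilson_X \<phi> \<alpha> \<beta> j m) (wilson_Y \<phi> \<alpha> \<beta> j m))))"
proof (cases "m = 0")
  case True
  have "norm_L2 (wilson \<phi> \<alpha> \<beta> j m) = sqrt (2 * \<beta>) * norm_L2 \<phi>"
    unfolding wilson_def[abs_def] using True assms(2) by (simp add: norm_L2_scale norm_gabor)
  then show ?thesis using True assms(2) by (simp add: power_mult_distrib)
next
  case False
  have "cmod ((-1) powi k) = 1" for k :: int by (simp add: norm_power_int)
  then have XY: "norm_L2 (wilson_X \<phi> \<alpha> \<beta> j m) = norm_L2 \<phi>" "norm_L2 (wilson_Y \<phi> \<alpha> \<beta> j m) = norm_L2 \<phi>"
    unfolding wilson_X_def[abs_def] wilson_Y_def[abs_def] by (simp_all add: norm_L2_scale norm_mult norm_gabor)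
  have "norm_L2 (wilson \<phi> \<alpha> \<beta> j m) = sqrt \<beta> * norm_L2 (\<lambda>x. wilson_X \<phi> \<alpha> \<beta> j m x + wilson_Y \<phi> \<alpha> \<beta> j m x)"
    unfolding wilson_def[abs_def] using False assms(2) by (simp add: norm_L2_scale)
  then have "(norm_L2 (wilson \<phi> \<alpha> \<beta> j m))\<^sup>2 = \<beta> * (norm_L2 (\<lambda>x. wilson_X \<phi> \<alpha> \<beta> j m x + wilson_Y \<phi> \<alpha> \<beta> j m x))\<^sup>2"
    using assms(2) by (simp add: power_mult_distrib)
  then show ?thesis
    using False by (simp add: norm_L2_add_sq[OF wilson_X_L2[OF assms(1)] wilson_Y_L2[OF assms(1)]] XY)
qed

text \<open>For \<open>f = e i\<close> the Parseval sum equals 1 and its term at \<open>i\<close> is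
  1 already, so all other inner products vanish. Completeness follows from
  \<open>orthonormal_dist\<close>, as the partial Parseval sums exhaust the norm.\<close>

lemma parseval_orthonormal_iff:
  fixes e :: "'i::countable \<Rightarrow> real \<Rightarrow> complex"
  assumes "parseval_frame e"
  shows "orthonormal_basis e \<longleftrightarrow> (\<forall>i. (norm_L2 (e i))\<^sup>2 = 1)"
proof
  assume "orthonormal_basis e"
  then have "inner_L2 (e i) (e i) = 1" for i by (simp add: orthonormal_basis_def)
  then show "\<forall>i. (norm_L2 (e i))\<^sup>2 = 1" by (metis inner_self of_real_eq_1_iff)
next
  assume n1: "\<forall>i. (norm_L2 (e i))\<^sup>2 = 1"
  have e: "e i \<in> L2" for i using assms by (simp add: parseval_frame_def tight_frame_def)
  have par: "((\<lambda>i. (cmod (inner_L2 f (e i)))\<^sup>2) has_sum (norm_L2 f)\<^sup>2) UNIV" if "f \<in> L2" for f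
    using assms that by (simp add: parseval_frame_def tight_frame_def)
  have on: "inner_L2 (e i) (e j) = (if i = j then 1 else 0)" for i j
  proof (cases "i = j")
    case True
    then show ?thesis using n1 by (simp add: inner_self)
  next
    case False
    have "(\<Sum>k\<in>{i, j}. (cmod (inner_L2 (e i) (e k)))\<^sup>2) \<le> (norm_L2 (e i))\<^sup>2"
      by (rule finite_sum_le_has_sum[OF par[OF e]]) auto
    moreover have "cmod (inner_L2 (e i) (e i)) = 1" using n1 by (simp add: inner_self)
    ultimately have "(cmod (inner_L2 (e i) (e j)))\<^sup>2 \<le> 0" using False n1 by simp
    then show ?thesis using False by simp
  qed
  show "orthonormal_basis e"
    unfolding orthonormal_basis_def
  proof (intro conjI allI ballI impI)
    show "e i \<in> L2" for i by (rule e)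
    show "inner_L2 (e i) (e j) = (if i = j then 1 else 0)" for i j by (rule on)
    fix f :: "real \<Rightarrow> complex" and \<delta> :: real assume f: "f \<in> L2" and d: "\<delta> > 0"
    have "\<forall>\<^sub>F I in finite_subsets_at_top UNIV. (\<Sum>i\<in>I. (cmod (inner_L2 f (e i)))\<^sup>2) > (norm_L2 f)\<^sup>2 - \<delta>\<^sup>2"
      using par[OF f] d unfolding has_sum_def by (intro order_tendstoD(1)) auto
    then obtain I where I: "finite I" "(\<Sum>i\<in>I. (cmod (inner_L2 f (e i)))\<^sup>2) > (norm_L2 f)\<^sup>2 - \<delta>\<^sup>2"
      unfolding eventually_finite_subsets_at_top by blast
    have "(norm_L2 (\<lambda>x. f x - (\<Sum>i\<in>I. inner_L2 f (e i) * e i x)))\<^sup>2 < \<delta>\<^sup>2"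
      using orthonormal_dist[OF e on f I(1), of "\<lambda>i. inner_L2 f (e i)"] I(2) by simp
    then have "norm_L2 (\<lambda>x. f x - (\<Sum>i\<in>I. inner_L2 f (e i) * e i x)) < \<delta>"
      using d by (intro power2_less_imp_less[of _ \<delta>]) auto
    then show "\<exists>I c. finite I \<and> norm_L2 (\<lambda>x. f x - (\<Sum>i\<in>I. c i * e i x)) < \<delta>"
      using I(1) by (intro exI conjI)
  qed
qed

section \<open>Transfer to the frequency side\<close>

context decaying
begin

text \<open>Translation and modulation are moved from \<open>\<phi>\<close> onto \<open>f\<close>,
  the transform is taken with \<open>\<phi>\<close> bare, and the resulting factors are moved from
  \<open>g\<close> onto \<open>h\<close>.\<close>

lemma inner_gabor_gabor_hat:
  assumes \<phi>: "fourier_L2 \<phi> (\<lambda>w. complex_of_real (h w))" and fg: "fourier_pair f g"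
  shows "inner_L2 f (gabor \<phi> 1 \<beta> j m) = inner_L2 g (gabor_hat \<beta> j m)"
proof -
  let ?f = "\<lambda>y. cis (- 2 * pi * of_int m * (y + \<beta> * of_int j)) * f (y + \<beta> * of_int j)"
  let ?g = "\<lambda>w. cis (2 * pi * (\<beta> * of_int j) * w) * g (w + of_int m)"
  have fg': "fourier_pair ?f ?g" by (rule fourier_pair_shift_modulate[OF fg])
  have "inner_L2 f (gabor \<phi> 1 \<beta> j m) = inner_L2 ?f \<phi>"
  proof -
    have "inner_L2 f (gabor \<phi> 1 \<beta> j m) = (LINT x|lebesgue. f (x + \<beta> * of_int j) * cnj (gabor \<phi> 1 \<beta> j m (x + \<beta> * of_int j)))"
      unfolding inner_L2_def by (rule integral_lebesgue_shift[symmetric])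
    then show ?thesis unfolding inner_L2_def by (simp add: gabor_def cis_cnj mult_ac)
  qed
  also have "\<dots> = inner_L2 ?g (\<lambda>w. complex_of_real (h w))"
    using arg_cong[OF inner_fourier_L2[OF \<phi> fg'], of cnj] by (simp only: inner_cnj)
  also have "\<dots> = inner_L2 g (gabor_hat \<beta> j m)"
  proof -
    have "inner_L2 g (gabor_hat \<beta> j m) = (LINT w|lebesgue. g (w + of_int m) * cnj (gabor_hat \<beta> j m (w + of_int m)))"
      unfolding inner_L2_def by (rule integral_lebesgue_shift[symmetric])
    then show ?thesis unfolding inner_L2_def by (simp add: gabor_hat_def cis_cnj mult_ac)
  qed
  finally show ?thesis .
qed

lemma gabor_hat_L2:
  assumes "(\<lambda>w. complex_of_real (h w)) \<in> L2"
  shows "gabor_hat \<beta> j m \<in> L2"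
proof -
  have "gabor_hat \<beta> j m = (\<lambda>w. cis ((- 2 * pi * \<beta> * of_int j) * w + 2 * pi * \<beta> * of_int j * of_int m) * complex_of_real (h (w + - of_int m)))"
    by (rule ext) (simp add: gabor_hat_def algebra_simps)
  then show ?thesis by (simp only:) (rule L2_cis[OF L2_shift[OF assms]])
qed

lemma wilson_hat_L2:
  assumes "(\<lambda>w. complex_of_real (h w)) \<in> L2"
  shows "wilson_hat \<beta> j m \<in> L2"
  unfolding wilson_hat_def[abs_def]
  by (cases "m = 0") (simp_all add: L2_scale L2_add gabor_hat_L2[OF assms])

lemma inner_wilson_wilson_hat:
  assumes \<phi>: "fourier_L2 \<phi> (\<lambda>w. complex_of_real (h w))" and fg: "fourier_pair f g"
  shows "inner_L2 f (wilson \<phi> 1 \<beta> j m) = inner_L2 g (wilson_hat \<beta> j m)"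
proof -
  have L: "\<phi> \<in> L2" "(\<lambda>w. complex_of_real (h w)) \<in> L2" using \<phi> by (auto simp: fourier_L2_def)
  show ?thesis
  proof (cases "m = 0")
    case True
    then show ?thesis unfolding wilson_def[abs_def] wilson_hat_def[abs_def]
      by (simp add: inner_scale_r inner_gabor_gabor_hat[OF \<phi> fg])
  next
    case False
    have "inner_L2 f (wilson \<phi> 1 \<beta> j m) = of_real (sqrt \<beta>) * (inner_L2 f (wilson_X \<phi> 1 \<beta> j m) + inner_L2 f (wilson_Y \<phi> 1 \<beta> j m))"
      unfolding wilson_def[abs_def] using False
      by (simp add: inner_scale_r inner_add_r[OF wilson_X_L2[OF L(1)] wilson_Y_L2[OF L(1)] fourier_pair_L2(1)[OF fg]])
    moreover have "inner_L2 g (wilson_hat \<beta> j m) = of_real (sqrt \<beta>) *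
      (inner_L2 g (\<lambda>w. cis (- 2 * pi * \<beta> * of_int j * real m) * gabor_hat \<beta> j (int m) w)
       + inner_L2 g (\<lambda>w. (-1) powi (j + int m) * cis (2 * pi * \<beta> * of_int j * real m) * gabor_hat \<beta> j (- int m) w))"
      unfolding wilson_hat_def[abs_def] using False
      by (simp add: inner_scale_r inner_add_r[OF L2_scale[OF gabor_hat_L2[OF L(2)]] L2_scale[OF gabor_hat_L2[OF L(2)]] fourier_pair_L2(2)[OF fg]])
    ultimately show ?thesis
      unfolding wilson_X_def[abs_def] wilson_Y_def[abs_def] inner_scale_r inner_gabor_gabor_hat[OF \<phi> fg] by simp
  qed
qed

lemma gabor_tight_iff:
  assumes \<phi>: "fourier_L2 \<phi> (\<lambda>w. complex_of_real (h w))" and n: "n > 0" and b: "\<beta> = 1 / (2 * real n)"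
  shows "tight_frame (1 / \<beta>) (gabor_system \<phi> 1 \<beta>) \<longleftrightarrow>
    (\<forall>l::int. AE w in lebesgue. corr (of_int l * real (2 * n)) w = (if l = 0 then 1 else 0))"
proof -
  have L: "\<phi> \<in> L2" "(\<lambda>w. complex_of_real (h w)) \<in> L2" using \<phi> by (auto simp: fourier_L2_def)
  have b0: "\<beta> > 0" and bi: "1 / \<beta> = real (2 * n)" using n by (simp_all add: b)
  let ?e = "\<lambda>p. gabor_hat \<beta> (fst p) (snd p)"
  have "tight_frame (1 / \<beta>) (gabor_system \<phi> 1 \<beta>) \<longleftrightarrow> tight_frame (1 / \<beta>) ?e"
    by (rule tight_frame_fourier) (auto simp: gabor_system_def gabor_L2 gabor_hat_L2 L inner_gabor_gabor_hat[OF \<phi>])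
  also have "\<dots> \<longleftrightarrow> (\<forall>l::int. AE w in lebesgue. corr (of_int l * real (2 * n)) w = (if l = 0 then 1 else 0))"
  proof (rule tight_iff_corr)
    fix g R and L :: int
    assume "bcs g" "\<And>x. \<bar>x\<bar> > R \<Longrightarrow> g x = 0" "R \<ge> 0" "of_int L * real (2 * n) \<ge> 2 * R"
    from gabor_quad[OF b0 this(1,2,3), of L] this(4)
    show "((\<lambda>p. (cmod (inner_L2 g (?e p)))\<^sup>2) has_sum 1 / \<beta> * quad (real (2 * n)) L g) UNIV"
      unfolding bi by (simp add: case_prod_unfold)
  qed (use b0 n gabor_hat_L2[OF L(2)] in auto)
  finally show ?thesis .
qed

lemma wilson_parseval_iff:
  assumes \<phi>: "fourier_L2 \<phi> (\<lambda>w. complex_of_real (h w))" and n: "odd n" and b: "\<beta> = 1 / (2 * real n)"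
  shows "parseval_frame (wilson_system \<phi> 1 \<beta>) \<longleftrightarrow>
    (\<forall>l::int. AE w in lebesgue. corr (of_int l * real (2 * n)) w = (if l = 0 then 1 else 0))"
proof -
  have n0: "n > 0" using n by (cases n) auto
  have L: "\<phi> \<in> L2" "(\<lambda>w. complex_of_real (h w)) \<in> L2" using \<phi> by (auto simp: fourier_L2_def)
  let ?e = "\<lambda>p. wilson_hat \<beta> (fst p) (snd p)"
  have "tight_frame 1 (wilson_system \<phi> 1 \<beta>) \<longleftrightarrow> tight_frame 1 ?e"
    by (rule tight_frame_fourier) (auto simp: wilson_system_def wilson_L2 wilson_hat_L2 L inner_wilson_wilson_hat[OF \<phi>])
  also have "\<dots> \<longleftrightarrow> (\<forall>l::int. AE w in lebesgue. corr (of_int l * real (2 * n)) w = (if l = 0 then 1 else 0))"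
  proof (rule tight_iff_corr)
    fix g R and L :: int
    assume "bcs g" "\<And>x. \<bar>x\<bar> > R \<Longrightarrow> g x = 0" "R \<ge> 0" "of_int L * real (2 * n) \<ge> 2 * R"
    from wilson_quad[OF n b this(1,2,3), of L] this(4)
    show "((\<lambda>p. (cmod (inner_L2 g (?e p)))\<^sup>2) has_sum 1 * quad (real (2 * n)) L g) UNIV"
      by (simp add: case_prod_unfold)
  qed (use n0 wilson_hat_L2[OF L(2)] in auto)
  finally show ?thesis unfolding parseval_frame_def .
qed

end

theorem theorem4p1:
  fixes \<phi> :: "real \<Rightarrow> complex" and \<phi>hat :: "real \<Rightarrow> real"
    and \<epsilon> C \<beta> :: real and n :: nat
  assumes fourier: "fourier_L2 \<phi> (\<lambda>w. complex_of_real (\<phi>hat w))"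
    and eps: "\<epsilon> > 0"
    and decay: "\<And>\<xi>. \<bar>\<phi>hat \<xi>\<bar> \<le> C * (1 + \<bar>\<xi>\<bar>) powr (- 1 - \<epsilon>)"
    and n: "odd n"
    and beta: "\<beta> = 1 / (2 * real n)"
  defines "S1 \<equiv> tight_frame (1 / \<beta>) (gabor_system \<phi> 1 \<beta>)"
    and "S2 \<equiv> parseval_frame (wilson_system \<phi> 1 \<beta>)"
    and "S3 \<equiv> (AE (x, \<xi>) in (lebesgue :: (real \<times> real) measure).
           x \<in> {0..1} \<and> \<xi> \<in> {0..1} \<longrightarrow>
           (\<Sum>r = 0..2 * n - 1.
              (cmod (zak \<beta> (\<lambda>w. complex_of_real (\<phi>hat w)) x (\<xi> - \<beta> * real r)))\<^sup>2) = 1 / \<beta>)"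
  shows "(S1 \<longleftrightarrow> S2) \<and> (S2 \<longleftrightarrow> S3) \<and>
    (S1 \<or> S2 \<or> S3 \<longrightarrow>
      (orthonormal_basis (wilson_system \<phi> 1 \<beta>) \<longleftrightarrow>
        (\<forall>(j::int) (m::nat). m \<ge> 1 \<longrightarrow>
           Re (inner_L2 (wilson_X \<phi> 1 \<beta> j m) (wilson_Y \<phi> 1 \<beta> j m)) = 0) \<and>
        norm_L2 \<phi> = 1 / sqrt (2 * \<beta>)))"
proof -
  have n0: "n > 0" using n by (cases n) auto
  have b0: "\<beta> > 0" using n0 by (simp add: beta)
  have \<phi>L: "\<phi> \<in> L2" and hL: "(\<lambda>w. complex_of_real (\<phi>hat w)) \<in> L2" using fourier by (auto simp: fourier_L2_def)
  \<comment> \<open>Measurability of \<open>\<phi>hat\<close> is read off from its membership in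
    \<open>L2\<close>.\<close>
  have "(\<lambda>w. Re (complex_of_real (\<phi>hat w))) \<in> borel_measurable lebesgue"
    using L2_measurable[OF hL] by measurable
  then interpret decaying \<phi>hat C \<epsilon>
    using eps decay by unfold_locales simp_all
  let ?D = "\<forall>l::int. AE w in lebesgue. corr (of_int l * real (2 * n)) w = (if l = 0 then 1 else 0)"
  have S1: "S1 \<longleftrightarrow> ?D" unfolding S1_def by (rule gabor_tight_iff[OF fourier n0 beta])
  have S2: "S2 \<longleftrightarrow> ?D" unfolding S2_def by (rule wilson_parseval_iff[OF fourier n beta])
  have "(1 / \<beta>) * z = 1 / \<beta> \<longleftrightarrow> z = 1" for z using b0 by simp
  then have S3: "S3 \<longleftrightarrow> ?D"
    unfolding S3_def zak_zsum[OF n0 beta] using zsum_AE_iff[of "2 * n"] n0 by simp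
  have onb: "orthonormal_basis (wilson_system \<phi> 1 \<beta>) \<longleftrightarrow>
        (\<forall>(j::int) (m::nat). m \<ge> 1 \<longrightarrow>
           Re (inner_L2 (wilson_X \<phi> 1 \<beta> j m) (wilson_Y \<phi> 1 \<beta> j m)) = 0) \<and>
        norm_L2 \<phi> = 1 / sqrt (2 * \<beta>)" if "S2"
  proof -
    let ?Re = "\<lambda>j m. Re (inner_L2 (wilson_X \<phi> 1 \<beta> j m) (wilson_Y \<phi> 1 \<beta> j m))"
    have nsq: "norm_L2 \<phi> = 1 / sqrt (2 * \<beta>) \<longleftrightarrow> 2 * \<beta> * (norm_L2 \<phi>)\<^sup>2 = 1"
    proof -
      have "norm_L2 \<phi> = 1 / sqrt (2 * \<beta>) \<longleftrightarrow> (norm_L2 \<phi>)\<^sup>2 = (1 / sqrt (2 * \<beta>))\<^sup>2"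
        using b0 by (subst power2_eq_iff_nonneg) (auto simp: norm_L2_nonneg)
      also have "(1 / sqrt (2 * \<beta>))\<^sup>2 = 1 / (2 * \<beta>)" using b0 by (simp add: power_divide)
      finally show ?thesis using b0 by (simp add: field_simps)
    qed
    have "orthonormal_basis (wilson_system \<phi> 1 \<beta>) \<longleftrightarrow> (\<forall>j m. (norm_L2 (wilson \<phi> 1 \<beta> j m))\<^sup>2 = 1)"
      using parseval_orthonormal_iff[OF that[unfolded S2_def]] by (simp add: wilson_system_def)
    also have "\<dots> \<longleftrightarrow> 2 * \<beta> * (norm_L2 \<phi>)\<^sup>2 = 1 \<and> (\<forall>j m. m \<ge> 1 \<longrightarrow> \<beta> * (2 * (norm_L2 \<phi>)\<^sup>2 + 2 * ?Re j m) = 1)"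
      unfolding norm_wilson_sq[OF \<phi>L b0] by (auto simp: not_less_eq_eq split: if_splits)
    \<comment> \<open>The members with \<open>m = 0\<close> fix the norm of \<open>\<phi>\<close>;
      once it is fixed, the diagonal part for \<open>m \<ge> 1\<close> is already 1 and the real
      part has to vanish.\<close>
    also have "\<dots> \<longleftrightarrow> 2 * \<beta> * (norm_L2 \<phi>)\<^sup>2 = 1 \<and> (\<forall>j m. m \<ge> 1 \<longrightarrow> ?Re j m = 0)"
    proof (rule conj_cong[OF refl])
      assume "2 * \<beta> * (norm_L2 \<phi>)\<^sup>2 = 1"
      then have "\<beta> * (2 * (norm_L2 \<phi>)\<^sup>2 + 2 * z) = 1 + 2 * \<beta> * z" for z by (simp add: algebra_simps)
      then show "(\<forall>j m. m \<ge> 1 \<longrightarrow> \<beta> * (2 * (norm_L2 \<phi>)\<^sup>2 + 2 * ?Re j m) = 1) \<longleftrightarrow> (\<forall>j m. m \<ge> 1 \<longrightarrow> ?Re j m = 0)"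
        using b0 by simp
    qed
    finally show ?thesis unfolding nsq by blast
  qed
  show ?thesis using S1 S2 S3 onb by blast
qed

end
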